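(* Assume that $\mathcal{D}(A)\subset\mathcal{D}(Q^{-1/2})$, $|(-A)^{1/2}Q^{1/2}|_{\mathcal{L}_2(H)}<\infty$ and $|Q^{-1/2}(-A)^{-1}|_{\mathcal{L}(H)}<\infty$. Assume that $F\colon H\to H$ is Fréchet differentiable and that there exist $L_F,L>0$ such that $|F(u)-F(v)|\le L_F|u-v|$ for $u,v\in H$, $|F(u)|_{\dot H^1}\le L(1+|u|_{\dot H^1})$ for $u\in\dot H^1$, and $|F'(u)v|_{\dot H^2}\le L(1+|u|_{\dot H^2}^2)|v|_{\dot H^2}$ for $u,v\in\dot H^2$. Assume moreover that $F(0)=0$ and $L_F<\lambda_1$. Let $n\in\mathbb{N}^+$ and $0<\tau\le\tau_0$, where $\tau_0>0$ satisfies $\frac{e^{\lambda_1\tau_0}-1}{\lambda_1\tau_0}=\frac{\lambda_1+L_F}{2L_F}$. Then $\{\mu^{\varepsilon,n,\tau}\}_{\varepsilon>0}$ satisfies a large deviations principle on $H_n$ with rate $1/\varepsilon^2$ and good rate function $$V^{n,\tau}(u)=\inf\{I_{0,T}^{n,\tau,0}(z):T>0,\ z\in C([0,T];H_n),\ z(0)=0,\ z(T)=u\},\quad u\in H_n.$$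
   Context: $H:=L^2((0,1);\mathbb{R})$ with inner product $\langle\cdot,\cdot\rangle$ and norm $|\cdot|$; $\mathcal{L}(H)$ and $\mathcal{L}_2(H)$ are the bounded and the Hilbert–Schmidt operators on $H$. $A$ is the Dirichlet Laplacian on $(0,1)$, $\mathcal{D}(A)=H_0^1\cap H^2$; $e_i(\xi)=\sqrt2\sin(i\pi\xi)$ is an orthonormal basis of $H$ with $-Ae_i=\lambda_ie_i$, $\lambda_i=\pi^2i^2$. For $\gamma\in\mathbb{R}$, $\dot H^\gamma:=\mathcal{D}((-A)^{\gamma/2})$ with norm $|u|_{\dot H^\gamma}=|(-A)^{\gamma/2}u|$. $Q$ is a self-adjoint, positive definite bounded linear operator on $H$ with $Qe_i=q_ie_i$, $q_i>0$; $Q^{-1/2}\colon Q^{1/2}(H)\to H$ is the inverse of $Q^{1/2}$ and $\mathcal{D}(Q^{-1/2})=Q^{1/2}(H)$. $W(t)=\sum_i\beta_i(t)e_i$ is a cylindrical Wiener process, $\beta_i$ independent standard real Brownian motions. For $n\in\mathbb{N}^+$: $H_n:=\mathrm{span}\{e_1,\dots,e_n\}$, $P_n$ is the orthogonal projection of $H$ onto $H_n$, $A_n:=P_nA$ (on $H_n$), $F_n:=P_nF$, $Q_n^{1/2}:=P_nQ^{1/2}$, $W_n:=P_nW$. For $y\in H_n$ and $\varepsilon,\tau>0$, $Y_y^{\varepsilon,n}$ (continuous-time form of the accelerated exponential Euler method with stepsize $\tau$) is the solution of $dY(t)=(A_nY(t)+F_n(Y(\tau\lfloor t/\tau\rfloor)))dt+\varepsilon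 Q_n^{1/2}dW_n(t)$, $Y(0)=y$. The measure $\mu^{\varepsilon,n,\tau}$: the time averages $\mu_t^{\varepsilon,n,\tau}(B):=\frac1t\int_0^t\mathbb{P}(Y_0^{\varepsilon,n}(s)\in B)ds$, $B\in\mathcal{B}(H_n)$, form a tight family, and for each $\varepsilon>0$, $\mu^{\varepsilon,n,\tau}$ denotes a weak limit of $\mu_{t_i}^{\varepsilon,n,\tau}$ along some sequence $t_i\uparrow+\infty$ (possibly depending on $\varepsilon$); it is referred to as the invariant measure of the full discretization. $I_{0,T}^{n,\tau,y}(z)=\tfrac12\inf\{|\phi|_{L^2(0,T;H)}^2:\phi\in L^2(0,T;H_n),\ z_{0,y}^{n,\tau,\phi}=z\}$ for $z\in C([0,T];H_n)$ ($\inf\emptyset=+\infty$), where $z_{0,y}^{n,\tau,\phi}$ is the mild solution of $\frac{dz(t)}{dt}=A_nz(t)+F_n(z(\tau\lfloor t/\tau\rfloor))+Q_n^{1/2}\phi(t)$, $z(0)=y$. A rate function on a Polish space $\mathcal U$ is a lower semicontinuous map $I\colon\mathcal{U}\to[0,+\infty]$; it is good if all level sets $\{I\le\alpha\}$, $\alpha\ge0$, are compact. A family $\{\mu^\varepsilon\}_{\varepsilon>0}$ of Borel probability measures on $\mathcal{U}$ satisfies a large deviations principle with rate $1/\varepsilon^2$ and rate function $I$ if for every Borel set $U$, $-\inf_{U^o}I\le\liminf_{\varepsilon\to0}\varepsilon^2\log\mu^\varepsilon(U)\le\limsup_{\varepsilon\to0}\varepsilon^2\log\mu^\varepsilon(U)\le-\inf_{\overline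 U}I$. *)

theory Defs
  imports "HOL-Probability.Probability"
begin

section \<open>The Hilbert space $H = L^2((0,1);\mathbb{R})$\<close>

definition sq_int :: "(real \<Rightarrow> real) \<Rightarrow> bool" where
  "sq_int f \<longleftrightarrow> f \<in> borel_measurable (lebesgue_on {0<..<1}) \<and>
     integrable (lebesgue_on {0<..<1}) (\<lambda>x. (f x)\<^sup>2)"

definition L2rel :: "(real \<Rightarrow> real) \<Rightarrow> (real \<Rightarrow> real) \<Rightarrow> bool" where
  "L2rel f g \<longleftrightarrow> sq_int f \<and> sq_int g \<and> (AE x in lebesgue_on {0<..<1}. f x = g x)"

lemma sq_int_zero [simp]: "sq_int (\<lambda>x. 0)"
  by (simp add: sq_int_def)

lemma sq_int_measurable: "sq_int f \<Longrightarrow> f \<in> borel_measurable (lebesgue_on {0<..<1})"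
  by (simp add: sq_int_def)

lemma sq_int_prod:
  assumes "sq_int f" "sq_int g"
  shows "integrable (lebesgue_on {0<..<1}) (\<lambda>x. f x * g x)"
proof (rule Bochner_Integration.integrable_bound)
  show "integrable (lebesgue_on {0<..<1}) (\<lambda>x. (f x)\<^sup>2 + (g x)\<^sup>2)"
    using assms by (simp add: sq_int_def)
  show "(\<lambda>x. f x * g x) \<in> borel_measurable (lebesgue_on {0<..<1})"
    by (intro borel_measurable_times sq_int_measurable assms)
  have "\<bar>a * b\<bar> \<le> a\<^sup>2 + b\<^sup>2" for a b :: real
  proof -
    have "2 * (\<bar>a\<bar> * \<bar>b\<bar>) \<le> a\<^sup>2 + b\<^sup>2"
      using sum_squares_bound[of "\<bar>a\<bar>" "\<bar>b\<bar>"] by simp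
    moreover have "0 \<le> \<bar>a\<bar> * \<bar>b\<bar>" by simp
    ultimately show ?thesis unfolding abs_mult by linarith
  qed
  then show "AE x in lebesgue_on {0<..<1}. norm (f x * g x) \<le> norm ((f x)\<^sup>2 + (g x)\<^sup>2)"
    by auto
qed

lemma sq_int_scale: "sq_int f \<Longrightarrow> sq_int (\<lambda>x. c * f x)"
  by (auto simp: sq_int_def power_mult_distrib intro!: borel_measurable_times)

lemma sq_int_uminus: "sq_int f \<Longrightarrow> sq_int (\<lambda>x. - f x)"
  using sq_int_scale[of f "-1"] by simp

lemma sq_int_add:
  assumes "sq_int f" "sq_int g"
  shows "sq_int (\<lambda>x. f x + g x)"
  using assms sq_int_prod[OF assms]
  by (auto simp: sq_int_def power2_sum mult.assoc intro!: borel_measurable_add)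

lemma part_equivp_L2rel: "part_equivp L2rel"
proof (rule part_equivpI)
  show "\<exists>f. L2rel f f"
    by (rule exI[of _ "\<lambda>x. 0"]) (simp add: L2rel_def)
  show "symp L2rel"
    by (rule sympI) (auto simp: L2rel_def elim: AE_mp)
  show "transp L2rel"
  proof (rule transpI)
    fix f g h assume "L2rel f g" "L2rel g h"
    then show "L2rel f h"
      unfolding L2rel_def by (auto elim: AE_mp)
  qed
qed

quotient_type L2 = "real \<Rightarrow> real" / partial: L2rel
  by (rule part_equivp_L2rel)

lemma L2rel_sq_int: "L2rel f g \<Longrightarrow> sq_int f" "L2rel f g \<Longrightarrow> sq_int g"
  by (auto simp: L2rel_def)

instantiation L2 :: real_vector
begin

lift_definition zero_L2 :: L2 is "\<lambda>x. 0"
  by (simp add: L2rel_def)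

lift_definition plus_L2 :: "L2 \<Rightarrow> L2 \<Rightarrow> L2" is "\<lambda>f g x. f x + g x"
  unfolding L2rel_def by (auto intro!: sq_int_add)

lift_definition uminus_L2 :: "L2 \<Rightarrow> L2" is "\<lambda>f x. - f x"
  unfolding L2rel_def by (auto intro!: sq_int_uminus)

lift_definition scaleR_L2 :: "real \<Rightarrow> L2 \<Rightarrow> L2" is "\<lambda>c f x. c * f x"
  unfolding L2rel_def by (auto intro!: sq_int_scale)

definition minus_L2 :: "L2 \<Rightarrow> L2 \<Rightarrow> L2" where "minus_L2 u v = u + - v"

instance
proof
  fix u v w :: L2 and a b :: real
  show "u + v + w = u + (v + w)"
    by transfer (auto simp: L2rel_def add.assoc intro!: sq_int_add)
  show "u + v = v + u"
    by transfer (auto simp: L2rel_def add.commute intro!: sq_int_add)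
  show "0 + u = u"
    by transfer (auto simp: L2rel_def)
  show "- u + u = 0"
    by transfer (auto simp: L2rel_def)
  show "u - v = u + - v" by (rule minus_L2_def)
  show "a *\<^sub>R (u + v) = a *\<^sub>R u + a *\<^sub>R v"
    by transfer (auto simp: L2rel_def distrib_left intro!: sq_int_add sq_int_scale)
  show "(a + b) *\<^sub>R u = a *\<^sub>R u + b *\<^sub>R u"
    by transfer (auto simp: L2rel_def distrib_right intro!: sq_int_add sq_int_scale)
  show "a *\<^sub>R b *\<^sub>R u = (a * b) *\<^sub>R u"
    by transfer (auto simp: L2rel_def mult.assoc intro!: sq_int_scale)
  show "1 *\<^sub>R u = u"
    by transfer (auto simp: L2rel_def)
qed

end

instantiation L2 :: real_inner
begin

lift_definition inner_L2 :: "L2 \<Rightarrow> L2 \<Rightarrow> real" is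
  "\<lambda>f g. integral\<^sup>L (lebesgue_on {0<..<1}) (\<lambda>x. f x * g x)"
  unfolding L2rel_def by (intro integral_cong_AE) (auto intro: borel_measurable_times sq_int_measurable)

definition norm_L2 :: "L2 \<Rightarrow> real" where "norm_L2 u = sqrt (inner u u)"
definition sgn_L2 :: "L2 \<Rightarrow> L2" where "sgn_L2 u = u /\<^sub>R norm u"
definition dist_L2 :: "L2 \<Rightarrow> L2 \<Rightarrow> real" where "dist_L2 u v = norm (u - v)"
definition uniformity_L2 :: "(L2 \<times> L2) filter" where
  "uniformity_L2 = (INF e\<in>{0<..}. principal {(x, y). dist x y < e})"
definition open_L2 :: "L2 set \<Rightarrow> bool" where
  "open_L2 U \<longleftrightarrow> (\<forall>x\<in>U. eventually (\<lambda>(x', y). x' = x \<longrightarrow> y \<in> U) uniformity)"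

instance
proof
  fix u v w :: L2 and a :: real and U :: "L2 set"
  show "sgn u = u /\<^sub>R norm u" by (rule sgn_L2_def)
  show "dist u v = norm (u - v)" by (rule dist_L2_def)
  show "uniformity = (INF e\<in>{0<..}. principal {(x, y). dist (x::L2) y < e})"
    by (rule uniformity_L2_def)
  show "open U = (\<forall>x\<in>U. \<forall>\<^sub>F (x', y) in uniformity. x' = x \<longrightarrow> y \<in> U)"
    by (rule open_L2_def)
  show "inner u v = inner v u"
    by transfer (simp add: mult.commute)
  show "inner (u + v) w = inner u w + inner v w"
  proof transfer
    fix f g h assume "L2rel f f" "L2rel g g" "L2rel h h"
    then have "integrable (lebesgue_on {0<..<1}) (\<lambda>x. f x * h x)"
      "integrable (lebesgue_on {0<..<1}) (\<lambda>x. g x * h x)"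
      by (auto intro: sq_int_prod L2rel_sq_int)
    then show "integral\<^sup>L (lebesgue_on {0<..<1}) (\<lambda>x. (f x + g x) * h x) =
        integral\<^sup>L (lebesgue_on {0<..<1}) (\<lambda>x. f x * h x) +
        integral\<^sup>L (lebesgue_on {0<..<1}) (\<lambda>x. g x * h x)"
      by (simp add: distrib_right)
  qed
  show "inner (a *\<^sub>R u) v = a * inner u v"
    by transfer (simp add: mult.assoc)
  show "0 \<le> inner u u"
    by transfer simp
  show "inner u u = 0 \<longleftrightarrow> u = 0"
  proof transfer
    fix f assume "L2rel f f"
    then have sq: "sq_int f" by (rule L2rel_sq_int)
    then have "integral\<^sup>L (lebesgue_on {0<..<1}) (\<lambda>x. f x * f x) = 0 \<longleftrightarrow>
        (AE x in lebesgue_on {0<..<1}. f x * f x = 0)"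
      by (intro integral_nonneg_eq_0_iff_AE) (auto simp: sq_int_def power2_eq_square)
    with sq show "integral\<^sup>L (lebesgue_on {0<..<1}) (\<lambda>x. f x * f x) = 0 \<longleftrightarrow> L2rel f (\<lambda>x. 0)"
      by (simp add: L2rel_def)
  qed
  show "norm u = sqrt (inner u u)" by (rule norm_L2_def)
qed

end

definition L2_of :: "(real \<Rightarrow> real) \<Rightarrow> L2" where
  "L2_of f = (if sq_int f then abs_L2 f else 0)"


section \<open>The Dirichlet Laplacian and its fractional powers\<close>

text \<open>Smooth functions with compact support in (0,1), defined on the whole real line.\<close>

definition test_funs :: "(real \<Rightarrow> real) set" where
  "test_funs = {\<phi>. (\<forall>k x. (deriv ^^ k) \<phi> differentiable (at x)) \<and>
     (\<exists>K. compact K \<and> K \<subseteq> {0<..<1} \<and> (\<forall>x. x \<notin> K \<longrightarrow> \<phi> x = 0))}"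

definition weak_deriv :: "L2 \<Rightarrow> L2 \<Rightarrow> bool" where
  "weak_deriv u v \<longleftrightarrow> (\<forall>\<phi>\<in>test_funs. inner u (L2_of (deriv \<phi>)) = - inner v (L2_of \<phi>))"

definition Sobolev_H2 :: "L2 set" where
  "Sobolev_H2 = {u. \<exists>v w. weak_deriv u v \<and> weak_deriv v w}"

text \<open>Closure of the test functions in the norm of $H^1(0,1)$.\<close>

definition Sobolev_H10 :: "L2 set" where
  "Sobolev_H10 = {u. \<exists>v. weak_deriv u v \<and>
     (\<forall>\<epsilon>>0. \<exists>\<phi>\<in>test_funs. sqrt ((norm (u - L2_of \<phi>))\<^sup>2 + (norm (v - L2_of (deriv \<phi>)))\<^sup>2) < \<epsilon>)}"

definition dom_A :: "L2 set" where
  "dom_A = Sobolev_H10 \<inter> Sobolev_H2"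

definition A_op :: "L2 \<Rightarrow> L2" where
  "A_op u = (THE w. \<exists>v. weak_deriv u v \<and> weak_deriv v w)"

definition neg_A_inv :: "L2 \<Rightarrow> L2" where
  "neg_A_inv = inv_into dom_A (\<lambda>u. - A_op u)"

text \<open>The eigenbasis is indexed by the positive integers; index 0 is never used.\<close>

definition eb :: "nat \<Rightarrow> L2" where
  "eb i = L2_of (\<lambda>\<xi>. sqrt 2 * sin (real i * pi * \<xi>))"

definition lam :: "nat \<Rightarrow> real" where
  "lam i = pi\<^sup>2 * (real i)\<^sup>2"

text \<open>The powers $(-A)^s$ by functional calculus in the eigenbasis, with their natural domain
  (used only for $s \ge 0$).\<close>

definition dom_neg_A_pow :: "real \<Rightarrow> L2 set" where
  "dom_neg_A_pow s = {u. summable (\<lambda>i. (lam (Suc i) powr s * inner u (eb (Suc i)))\<^sup>2)}"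

definition neg_A_pow :: "real \<Rightarrow> L2 \<Rightarrow> L2" where
  "neg_A_pow s u = (\<Sum>i. (lam (Suc i) powr s * inner u (eb (Suc i))) *\<^sub>R eb (Suc i))"

definition Hdot :: "real \<Rightarrow> L2 set" where
  "Hdot \<gamma> = dom_neg_A_pow (\<gamma> / 2)"

definition Hdot_norm :: "real \<Rightarrow> L2 \<Rightarrow> real" where
  "Hdot_norm \<gamma> u = norm (neg_A_pow (\<gamma> / 2) u)"


section \<open>Operators on $H$\<close>

definition self_adjoint :: "(L2 \<Rightarrow> L2) \<Rightarrow> bool" where
  "self_adjoint T \<longleftrightarrow> (\<forall>u v. inner (T u) v = inner u (T v))"

definition positive_definite :: "(L2 \<Rightarrow> L2) \<Rightarrow> bool" where
  "positive_definite T \<longleftrightarrow> (\<forall>u. u \<noteq> 0 \<longrightarrow> inner (T u) u > 0)"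

text \<open>\<open>R\<close> is the (unique) nonnegative self-adjoint square root of \<open>T\<close>.\<close>

definition is_pos_sqrt :: "(L2 \<Rightarrow> L2) \<Rightarrow> (L2 \<Rightarrow> L2) \<Rightarrow> bool" where
  "is_pos_sqrt R T \<longleftrightarrow> bounded_linear R \<and> self_adjoint R \<and> (\<forall>u. inner (R u) u \<ge> 0) \<and> R \<circ> R = T"

definition hilbert_schmidt :: "(L2 \<Rightarrow> L2) \<Rightarrow> bool" where
  "hilbert_schmidt T \<longleftrightarrow> bounded_linear T \<and> summable (\<lambda>i. (norm (T (eb (Suc i))))\<^sup>2)"


section \<open>Finite-dimensional projections\<close>

definition Hn :: "nat \<Rightarrow> L2 set" where
  "Hn n = span (eb ` {1..n})"

definition Pn :: "nat \<Rightarrow> L2 \<Rightarrow> L2" where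
  "Pn n u = (\<Sum>i=1..n. inner u (eb i) *\<^sub>R eb i)"

text \<open>The semigroup $e^{tA_n}$ on $H_n$.\<close>

definition Sn :: "nat \<Rightarrow> real \<Rightarrow> L2 \<Rightarrow> L2" where
  "Sn n t u = (\<Sum>i=1..n. (exp (- lam i * t) * inner u (eb i)) *\<^sub>R eb i)"

definition grid :: "real \<Rightarrow> real \<Rightarrow> real" where
  "grid \<tau> t = \<tau> * of_int \<lfloor>t / \<tau>\<rfloor>"


section \<open>Brownian motions and the full discretization\<close>

definition standard_BM :: "'w measure \<Rightarrow> (real \<Rightarrow> 'w \<Rightarrow> real) \<Rightarrow> bool" where
  "standard_BM M X \<longleftrightarrow>
     (\<forall>t\<ge>0. X t \<in> borel_measurable M) \<and>
     (AE \<omega> in M. X 0 \<omega> = 0) \<and>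
     (AE \<omega> in M. continuous_on {0..} (\<lambda>t. X t \<omega>)) \<and>
     (\<forall>s t. 0 \<le> s \<and> s < t \<longrightarrow>
        distributed M lborel (\<lambda>\<omega>. X t \<omega> - X s \<omega>) (normal_density 0 (sqrt (t - s)))) \<and>
     (\<forall>(k::nat) (t :: nat \<Rightarrow> real). 0 \<le> t 0 \<and> (\<forall>j<k. t j < t (Suc j)) \<longrightarrow>
        prob_space.indep_vars M (\<lambda>_. borel) (\<lambda>j \<omega>. X (t (Suc j)) \<omega> - X (t j) \<omega>) {..<k})"

text \<open>The coordinate processes \<open>\<beta> i\<close>, \<open>i \<ge> 1\<close>, of the cylindrical Wiener process. Mutual
  independence is independence of the whole paths, as random elements of the product space.\<close>

definition cylindrical_wiener :: "'w measure \<Rightarrow> (nat \<Rightarrow> real \<Rightarrow> 'w \<Rightarrow> real) \<Rightarrow> bool" where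
  "cylindrical_wiener M \<beta> \<longleftrightarrow> (\<forall>i\<ge>1. standard_BM M (\<beta> i)) \<and>
     prob_space.indep_vars M (\<lambda>_. PiM {0..} (\<lambda>_. borel)) (\<lambda>i \<omega>. \<lambda>t\<in>{0..}. \<beta> i t \<omega>) {1..}"

definition Wn :: "nat \<Rightarrow> (nat \<Rightarrow> real \<Rightarrow> 'w \<Rightarrow> real) \<Rightarrow> real \<Rightarrow> 'w \<Rightarrow> L2" where
  "Wn n \<beta> t \<omega> = (\<Sum>i=1..n. \<beta> i t \<omega> *\<^sub>R eb i)"

text \<open>The noise is additive, so the stochastic equation is a pathwise integral equation; its solution
  is pathwise unique, whence adaptedness is automatic. The integrand lies in the finite-dimensional
  space $H_n$ and is piecewise continuous, so the gauge integral is the usual one. \<open>Qh\<close>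
  stands for $Q^{1/2}$.\<close>

definition AEE_solution ::
  "'w measure \<Rightarrow> (nat \<Rightarrow> real \<Rightarrow> 'w \<Rightarrow> real) \<Rightarrow> (L2 \<Rightarrow> L2) \<Rightarrow> (L2 \<Rightarrow> L2) \<Rightarrow> nat \<Rightarrow> real \<Rightarrow>
   real \<Rightarrow> L2 \<Rightarrow> (real \<Rightarrow> 'w \<Rightarrow> L2) \<Rightarrow> bool" where
  "AEE_solution M \<beta> F Qh n \<tau> \<epsilon> y Y \<longleftrightarrow>
     (\<forall>t\<ge>0. Y t \<in> measurable M (restrict_space borel (Hn n))) \<and>
     (AE \<omega> in M. continuous_on {0..} (\<lambda>t. Y t \<omega>)) \<and>
     (AE \<omega> in M. \<forall>t\<ge>0.
        ((\<lambda>s. Pn n (A_op (Y s \<omega>)) + Pn n (F (Y (grid \<tau> s) \<omega>))) has_integral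
           (Y t \<omega> - y - \<epsilon> *\<^sub>R Pn n (Qh (Wn n \<beta> t \<omega>)))) {0..t})"

text \<open>The time averages $\mu_t(B) = \frac1t \int_0^t P(Y(s) \in B)\,ds$ on the Borel sets of
  $H_n$.\<close>

definition time_average :: "'w measure \<Rightarrow> nat \<Rightarrow> (real \<Rightarrow> 'w \<Rightarrow> L2) \<Rightarrow> real \<Rightarrow> L2 measure" where
  "time_average M n Y t = measure_of (Hn n) (sets (restrict_space borel (Hn n)))
     (\<lambda>B. (\<integral>\<^sup>+ s\<in>{0..t}. emeasure M {\<omega> \<in> space M. Y s \<omega> \<in> B} \<partial>lborel) / ennreal t)"

definition borel_prob :: "'a::topological_space set \<Rightarrow> 'a measure \<Rightarrow> bool" where
  "borel_prob S N \<longleftrightarrow> prob_space N \<and> sets N = sets (restrict_space borel S)"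

definition weak_limit ::
  "'a::topological_space set \<Rightarrow> (nat \<Rightarrow> 'a measure) \<Rightarrow> 'a measure \<Rightarrow> bool" where
  "weak_limit S \<nu> N \<longleftrightarrow> borel_prob S N \<and>
     (\<forall>f :: 'a \<Rightarrow> real. continuous_on S f \<and> bounded (f ` S) \<longrightarrow>
        (\<lambda>k. integral\<^sup>L (\<nu> k) f) \<longlonglongrightarrow> integral\<^sup>L N f)"

text \<open>\<open>N\<close> is a measure $\mu^{\varepsilon,n,\tau}$: a weak limit of the time averages of \<open>Y\<close>
  along some sequence of times increasing to infinity.\<close>

definition time_average_limit :: "'w measure \<Rightarrow> nat \<Rightarrow> (real \<Rightarrow> 'w \<Rightarrow> L2) \<Rightarrow> L2 measure \<Rightarrow> bool" where
  "time_average_limit M n Y N \<longleftrightarrow>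
     (\<exists>t :: nat \<Rightarrow> real. incseq t \<and> filterlim t at_top sequentially \<and> (\<forall>k. t k > 0) \<and>
        weak_limit (Hn n) (\<lambda>k. time_average M n Y (t k)) N)"


section \<open>The action functional and the quasi-potential\<close>

definition L2_controls :: "nat \<Rightarrow> real \<Rightarrow> (real \<Rightarrow> L2) set" where
  "L2_controls n T = {\<phi>. \<phi> \<in> measurable (lebesgue_on {0<..<T}) (restrict_space borel (Hn n)) \<and>
     integrable (lebesgue_on {0<..<T}) (\<lambda>t. (norm (\<phi> t))\<^sup>2)}"

definition skeleton_mild ::
  "(L2 \<Rightarrow> L2) \<Rightarrow> (L2 \<Rightarrow> L2) \<Rightarrow> nat \<Rightarrow> real \<Rightarrow> real \<Rightarrow> L2 \<Rightarrow> (real \<Rightarrow> L2) \<Rightarrow> (real \<Rightarrow> L2) \<Rightarrow> bool" where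
  "skeleton_mild F Qh n \<tau> T y \<phi> z \<longleftrightarrow> continuous_on {0..T} z \<and> z ` {0..T} \<subseteq> Hn n \<and>
     (\<forall>t\<in>{0..T}.
        ((\<lambda>s. Sn n (t - s) (Pn n (F (z (grid \<tau> s))) + Pn n (Qh (\<phi> s)))) has_integral
           (z t - Sn n t y)) {0..t})"

definition action ::
  "(L2 \<Rightarrow> L2) \<Rightarrow> (L2 \<Rightarrow> L2) \<Rightarrow> nat \<Rightarrow> real \<Rightarrow> real \<Rightarrow> L2 \<Rightarrow> (real \<Rightarrow> L2) \<Rightarrow> ereal" where
  "action F Qh n \<tau> T y z =
     ereal (1/2) * (INF \<phi> \<in> {\<phi> \<in> L2_controls n T. skeleton_mild F Qh n \<tau> T y \<phi> z}.
       ereal (integral\<^sup>L (lebesgue_on {0<..<T}) (\<lambda>t. (norm (\<phi> t))\<^sup>2)))"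

definition quasi_potential ::
  "(L2 \<Rightarrow> L2) \<Rightarrow> (L2 \<Rightarrow> L2) \<Rightarrow> nat \<Rightarrow> real \<Rightarrow> L2 \<Rightarrow> ereal" where
  "quasi_potential F Qh n \<tau> u =
     Inf {action F Qh n \<tau> T 0 z | T z. T > 0 \<and> continuous_on {0..T} z \<and> z ` {0..T} \<subseteq> Hn n \<and>
            z 0 = 0 \<and> z T = u}"


section \<open>Large deviations on a subspace $S$\<close>

definition rate_function_on :: "'a::topological_space set \<Rightarrow> ('a \<Rightarrow> ereal) \<Rightarrow> bool" where
  "rate_function_on S I \<longleftrightarrow> (\<forall>x\<in>S. 0 \<le> I x) \<and> (\<forall>x\<in>S. I x \<le> Liminf (at x within S) I)"

definition good_rate_function_on :: "'a::topological_space set \<Rightarrow> ('a \<Rightarrow> ereal) \<Rightarrow> bool" where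
  "good_rate_function_on S I \<longleftrightarrow> rate_function_on S I \<and>
     (\<forall>\<alpha>::real. \<alpha> \<ge> 0 \<longrightarrow> compact {x \<in> S. I x \<le> ereal \<alpha>})"

text \<open>Logarithm of a probability, with $\log 0 = -\infty$.\<close>

definition elog :: "real \<Rightarrow> ereal" where
  "elog p = (if p = 0 then -\<infinity> else ereal (ln p))"

text \<open>Rate $1/\varepsilon^2$; interior and closure are those of the subspace \<open>S\<close>.\<close>

definition LDP_on ::
  "'a::topological_space set \<Rightarrow> (real \<Rightarrow> 'a measure) \<Rightarrow> ('a \<Rightarrow> ereal) \<Rightarrow> bool" where
  "LDP_on S \<mu> I \<longleftrightarrow> rate_function_on S I \<and> (\<forall>\<epsilon>>0. borel_prob S (\<mu> \<epsilon>)) \<and>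
     (\<forall>U \<in> sets (restrict_space borel S).
        - (INF x \<in> top_of_set S interior_of U. I x)
          \<le> Liminf (at_right 0) (\<lambda>\<epsilon>. ereal (\<epsilon>\<^sup>2) * elog (measure (\<mu> \<epsilon>) U)) \<and>
        Liminf (at_right 0) (\<lambda>\<epsilon>. ereal (\<epsilon>\<^sup>2) * elog (measure (\<mu> \<epsilon>) U))
          \<le> Limsup (at_right 0) (\<lambda>\<epsilon>. ereal (\<epsilon>\<^sup>2) * elog (measure (\<mu> \<epsilon>) U)) \<and>
        Limsup (at_right 0) (\<lambda>\<epsilon>. ereal (\<epsilon>\<^sup>2) * elog (measure (\<mu> \<epsilon>) U))
          \<le> - (INF x \<in> top_of_set S closure_of U. I x))"

end

theory Submission
  imports Defs
begin

text \<open>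
  At the grid times the scheme is a Markov chain \<open>X \<mapsto> stepmap \<tau> X + \<epsilon> kick \<tau> \<zeta>\<close> driven by independent standard
  Gaussian vectors \<open>\<zeta>\<close>, and \<open>stepmap \<tau>\<close> is a contraction because \<open>L\<^sub>F < lam 1\<close>. Consequently the quasi-potential
  is the minimum of \<open>\<Sum>|z\<^sub>k|\<^sup>2 / 2\<close> over finite noise sequences steering the chain from 0 to the target, the last
  step having an arbitrary length \<open>s \<le> \<tau>\<close>. Up to an error \<open>\<rho>\<^sup>m R\<close>, on an event whose complement has probability
  at most \<open>C exp (- c R\<^sup>2 / \<epsilon>\<^sup>2)\<close>, the solution at any late time coincides with a chain restarted at 0 only
  \<open>m\<close> steps earlier. This reduces both large deviation bounds to exponential moments and box
  probabilities of finitely many Gaussian variables, uniformly in time, and uniform bounds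
  pass to the time averages and their weak limits. Sublevel sets are compact because a path of bounded
  cost must come close to 0 within a bounded number of steps before its end.
\<close>

section \<open>The Dirichlet Laplacian on trigonometric polynomials\<close>

text \<open>The measures studied are weak limits along time sequences that may depend on \<epsilon>,
  so the argument rests on inequalities that hold at all late times rather than on stationarity or
  uniqueness of an invariant law. Time averages sample every phase of a step, and between grid
  points the nonlinearity remembers the last grid value. Hence paths end with a step of arbitrary
  length, the discrete counterpart of the free horizon in the quasi-potential. For the lower bound
  only a short window of phases, ending at the nearly optimal one, is controlled; it fills a
  positive fraction of time, a factor that disappears on the exponential scale.

  Two further obstacles: \<open>A_op\<close> is given by weak derivatives, so its action on the sine
  functions has to be derived from their uniqueness; and the stochastic equation is a pathwise
  integral equation, so the noise of a step is recovered from the solution, as a limit of weighted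
  sums of Brownian increments.\<close>

lemma exp_power_bound:
  fixes w \<kappa> :: real
  assumes "w \<ge> 0" "\<kappa> > 0"
  shows "w ^ p * exp (- \<kappa> * w) \<le> fact p / \<kappa> ^ p"
proof -
  have "(\<lambda>n. (\<kappa> * w) ^ n /\<^sub>R fact n) sums exp (\<kappa> * w)" by (rule exp_converges)
  \<comment> \<open>A single term of the exponential series is at most the whole sum.\<close>
  then have "(\<Sum>n\<in>{p}. (\<kappa> * w) ^ n /\<^sub>R fact n) \<le> exp (\<kappa> * w)"
    using sums_unique[of _ "exp (\<kappa> * w)"] sum_le_suminf[of "\<lambda>n. (\<kappa> * w) ^ n /\<^sub>R fact n" "{p}"] assms
    by (auto simp: sums_iff)
  then have "w ^ p * \<kappa> ^ p \<le> fact p * exp (\<kappa> * w)"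
    by (simp add: field_simps power_mult_distrib)
  then show ?thesis
    using assms by (simp add: field_simps exp_minus)
qed

section \<open>Smooth bump functions with compact support\<close>

definition bump_mon :: "real \<Rightarrow> real \<Rightarrow> real \<Rightarrow> real \<Rightarrow> nat \<Rightarrow> nat \<Rightarrow> real \<Rightarrow> real" where
  "bump_mon a b \<kappa> c i j x = (if a < x \<and> x < b
     then c * (1 / (x - a)) ^ i * (1 / (b - x)) ^ j * exp (- \<kappa> * (1 / (x - a) + 1 / (b - x))) else 0)"

text \<open>The span of these functions is closed under differentiation, hence consists of smooth functions;
  as \<open>\<kappa>\<close> tends to 0, \<open>bump_mon a b \<kappa> 1 0 0\<close> tends to the indicator function of \<open>(a, b)\<close>.\<close>

inductive_set bumps :: "real \<Rightarrow> real \<Rightarrow> real \<Rightarrow> (real \<Rightarrow> real) set" for a b \<kappa> where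
  mon: "bump_mon a b \<kappa> c i j \<in> bumps a b \<kappa>"
| add: "f \<in> bumps a b \<kappa> \<Longrightarrow> g \<in> bumps a b \<kappa> \<Longrightarrow> (\<lambda>x. f x + g x) \<in> bumps a b \<kappa>"

text \<open>The exponential factors over the two end points, and each factor absorbs its own pole by
  \<open>exp_power_bound\<close>. The bound is uniform in \<open>x\<close>; for
  \<open>i = j = 0\<close> it reduces to the absolute value of \<open>c\<close>, which later
  supplies the dominating function.\<close>

lemma bump_mon_bounded:
  assumes "\<kappa> > 0"
  shows "\<bar>bump_mon a b \<kappa> c i j x\<bar> \<le> \<bar>c\<bar> * (fact i / \<kappa> ^ i) * (fact j / \<kappa> ^ j)"
proof (cases "a < x \<and> x < b")
  case True
  let ?w = "1 / (x - a)" and ?v = "1 / (b - x)"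
  have eq: "bump_mon a b \<kappa> c i j x = c * ((?w ^ i * exp (- \<kappa> * ?w)) * (?v ^ j * exp (- \<kappa> * ?v)))"
    using True by (simp add: bump_mon_def exp_add[symmetric] algebra_simps)
  have "?w ^ i * exp (- \<kappa> * ?w) \<le> fact i / \<kappa> ^ i" "?v ^ j * exp (- \<kappa> * ?v) \<le> fact j / \<kappa> ^ j"
    "0 \<le> ?w ^ i * exp (- \<kappa> * ?w)" "0 \<le> ?v ^ j * exp (- \<kappa> * ?v)"
    using True assms exp_power_bound[of ?w \<kappa> i] exp_power_bound[of ?v \<kappa> j] by auto
  then have "(?w ^ i * exp (- \<kappa> * ?w)) * (?v ^ j * exp (- \<kappa> * ?v)) \<le> (fact i / \<kappa> ^ i) * (fact j / \<kappa> ^ j)"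
    by (intro mult_mono) auto
  moreover have "0 \<le> (?w ^ i * exp (- \<kappa> * ?w)) * (?v ^ j * exp (- \<kappa> * ?v))"
    using True by (intro mult_nonneg_nonneg) auto
  ultimately show ?thesis
    unfolding eq abs_mult[of c] by (simp only: mult.assoc abs_of_nonneg mult_left_mono abs_ge_zero)
qed (use assms in \<open>auto simp: bump_mon_def\<close>)

text \<open>Meant for the two end points of a bump, where the defining formula changes: a quadratic
  bound valid on both sides at once replaces one-sided computations.\<close>

lemma DERIV_zero_of_quadratic_bound:
  fixes f :: "real \<Rightarrow> real"
  assumes "\<And>x. \<bar>f x\<bar> \<le> C * (x - p)\<^sup>2"
  shows "(f has_real_derivative 0) (at p)"
proof -
  have f0: "f p = 0" using assms[of p] by simp
  have "((\<lambda>x. (f x - f p) / (x - p)) \<longlongrightarrow> 0) (at p)"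
  proof (rule Lim_null_comparison)
    show "\<forall>\<^sub>F x in at p. norm ((f x - f p) / (x - p)) \<le> \<bar>C\<bar> * \<bar>x - p\<bar>"
    proof (rule eventually_at_filter[THEN iffD2], rule always_eventually, safe)
      fix x assume "x \<noteq> p"
      have "\<bar>f x\<bar> \<le> \<bar>C\<bar> * \<bar>x - p\<bar> * \<bar>x - p\<bar>"
      proof -
        have "C * (x - p)\<^sup>2 \<le> \<bar>C\<bar> * (x - p)\<^sup>2"
          by (intro mult_right_mono) auto
        also have "\<dots> = \<bar>C\<bar> * \<bar>x - p\<bar> * \<bar>x - p\<bar>"
          by (simp add: power2_eq_square mult.assoc)
        finally show ?thesis using assms[of x] by linarith
      qed
      then show "norm ((f x - f p) / (x - p)) \<le> \<bar>C\<bar> * \<bar>x - p\<bar>"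
        using \<open>x \<noteq> p\<close> by (simp add: f0 abs_divide field_simps)
    qed
    show "((\<lambda>x. \<bar>C\<bar> * \<bar>x - p\<bar>) \<longlongrightarrow> 0) (at p)"
      by (auto intro!: tendsto_eq_intros)
  qed
  then show ?thesis
    by (simp add: has_field_derivative_iff)
qed

lemma bump_mon_deriv:
  assumes "a < b" "\<kappa> > 0"
  shows "\<exists>g\<in>bumps a b \<kappa>. \<forall>x. (bump_mon a b \<kappa> c i j has_real_derivative g x) (at x)"
proof -
  \<comment> \<open>Product rule with \<open>w = 1 / (x - a)\<close> and
    \<open>v = 1 / (b - x)\<close>, for which \<open>w' = - w^2\<close> and \<open>v' = v^2\<close>:
    the first two terms differentiate the powers, the last two the exponential.\<close>
  define g where "g x = bump_mon a b \<kappa> (- c * real i) (Suc i) j x + (bump_mon a b \<kappa> (c * real j) i (Suc j) x +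
     (bump_mon a b \<kappa> (c * \<kappa>) (i + 2) j x + bump_mon a b \<kappa> (- c * \<kappa>) i (j + 2) x))" for x
  have g: "g \<in> bumps a b \<kappa>"
    unfolding g_def by (intro bumps.intros)
  have "(bump_mon a b \<kappa> c i j has_real_derivative g x) (at x)" for x
  proof -
    consider "a < x \<and> x < b" | "x < a \<or> x > b" | "x = a" | "x = b" using assms by linarith
    then show ?thesis
    proof cases
      case 1
      have ev: "\<forall>\<^sub>F y in nhds x. bump_mon a b \<kappa> c i j y =
        c * (1 / (y - a)) ^ i * (1 / (b - y)) ^ j * exp (- \<kappa> * (1 / (y - a) + 1 / (b - y)))"
        using 1 by (intro eventually_mono[OF eventually_nhds_in_open[of "{a<..<b}"]]) (auto simp: bump_mon_def)
      \<comment> \<open>At \<open>k = 0\<close> the truncated exponent does no harm, because the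
        factor \<open>real k\<close> vanishes.\<close>
      have pw: "real k * w ^ (k - Suc 0) * w\<^sup>2 = real k * w ^ Suc k" for k :: nat and w :: real
        by (cases k) (auto simp: power2_eq_square)
      have d1: "((\<lambda>y. 1 / (y - a)) has_real_derivative - (1 / (x - a))\<^sup>2) (at x)"
        using 1 by (auto intro!: derivative_eq_intros simp: power2_eq_square)
      have d2: "((\<lambda>y. 1 / (b - y)) has_real_derivative (1 / (b - x))\<^sup>2) (at x)"
        using 1 by (auto intro!: derivative_eq_intros simp: power2_eq_square)
      define w where "w = 1 / (x - a)"
      define v where "v = 1 / (b - x)"
      define W where "W = (\<lambda>y::real. 1 / (y - a))"
      define V where "V = (\<lambda>y::real. 1 / (b - y))"
      have W: "(W has_real_derivative - w\<^sup>2) (at x)" and V: "(V has_real_derivative v\<^sup>2) (at x)"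
        and Wx: "W x = w" and Vx: "V x = v"
        using d1 d2 by (auto simp: W_def V_def w_def v_def)
      have "((\<lambda>y. c * W y ^ i * V y ^ j * exp (- \<kappa> * (W y + V y))) has_real_derivative
          c * (real i * w ^ (i - Suc 0) * - w\<^sup>2) * v ^ j * exp (- \<kappa> * (w + v))
          + c * w ^ i * (real j * v ^ (j - Suc 0) * v\<^sup>2) * exp (- \<kappa> * (w + v))
          + c * w ^ i * v ^ j * (exp (- \<kappa> * (w + v)) * (- \<kappa> * (- w\<^sup>2 + v\<^sup>2)))) (at x)"
        by (rule derivative_eq_intros W V refl | simp add: Wx Vx)+ (simp add: algebra_simps)
      also have "c * (real i * w ^ (i - Suc 0) * - w\<^sup>2) * v ^ j * exp (- \<kappa> * (w + v))
          + c * w ^ i * (real j * v ^ (j - Suc 0) * v\<^sup>2) * exp (- \<kappa> * (w + v))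
          + c * w ^ i * v ^ j * (exp (- \<kappa> * (w + v)) * (- \<kappa> * (- w\<^sup>2 + v\<^sup>2))) = g x"
      proof -
        have "real i * w ^ (i - Suc 0) * - w\<^sup>2 = - (real i * w ^ Suc i)"
          using pw[of i w] by simp
        moreover have "real j * v ^ (j - Suc 0) * v\<^sup>2 = real j * v ^ Suc j" by (rule pw)
        ultimately show ?thesis
          using 1 by (simp only: bump_mon_def g_def if_True simp_thms w_def[symmetric] v_def[symmetric])
             (simp add: algebra_simps power2_eq_square)
      qed
      finally show ?thesis
        using DERIV_cong_ev[OF refl ev refl] by (simp add: W_def V_def)
    next
      case 2
      then have ev: "\<forall>\<^sub>F y in nhds x. bump_mon a b \<kappa> c i j y = 0"
      proof
        assume "x < a" then show ?thesis
          by (intro eventually_mono[OF eventually_nhds_in_open[of "{..<a}"]]) (auto simp: bump_mon_def)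
      next
        assume "x > b" then show ?thesis
          by (intro eventually_mono[OF eventually_nhds_in_open[of "{b<..}"]]) (auto simp: bump_mon_def)
      qed
      have "g x = 0" using 2 by (auto simp: g_def bump_mon_def)
      then show ?thesis using DERIV_cong_ev[OF refl ev refl] by simp
    next
      case 3
      have "\<bar>bump_mon a b \<kappa> c i j y\<bar> \<le> (\<bar>c\<bar> * (fact (i+2) / \<kappa> ^ (i+2)) * (fact j / \<kappa> ^ j)) * (y - a)\<^sup>2" for y
      proof -
        \<comment> \<open>Two extra poles are traded for the factor \<open>(y - a)^2\<close>; the
          function with the extra poles is still bounded.\<close>
        have "(1 / (y - a)) ^ (i + 2) * (y - a)\<^sup>2 = (1 / (y - a)) ^ i" if "a < y" "y < b"
          using that by (simp add: power_add power_divide power2_eq_square)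
        then have "bump_mon a b \<kappa> c i j y = bump_mon a b \<kappa> c (i+2) j y * (y - a)\<^sup>2"
          unfolding bump_mon_def by (simp only: if_distrib[of "\<lambda>u. u * _"] mult_zero_left cong: if_cong) (simp add: mult_ac del: power_Suc power_one_over)
        then show ?thesis using bump_mon_bounded[OF assms(2), of a b c "i+2" j y]
          by (simp only: abs_mult abs_power2 mult_right_mono zero_le_power2)
      qed
      then have "(bump_mon a b \<kappa> c i j has_real_derivative 0) (at a)"
        by (rule DERIV_zero_of_quadratic_bound)
      then show ?thesis using 3 by (simp add: g_def bump_mon_def)
    next
      case 4
      have "\<bar>bump_mon a b \<kappa> c i j y\<bar> \<le> (\<bar>c\<bar> * (fact i / \<kappa> ^ i) * (fact (j+2) / \<kappa> ^ (j+2))) * (y - b)\<^sup>2" for y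
      proof -
        have "(1 / (b - y)) ^ (j + 2) * (y - b)\<^sup>2 = (1 / (b - y)) ^ j" if "a < y" "y < b"
          using that by (simp add: power_add power_divide power2_commute[of y b]) (simp add: power2_eq_square)
        then have "bump_mon a b \<kappa> c i j y = bump_mon a b \<kappa> c i (j+2) y * (y - b)\<^sup>2"
          unfolding bump_mon_def by (simp only: if_distrib[of "\<lambda>u. u * _"] mult_zero_left cong: if_cong) (simp add: mult_ac del: power_Suc power_one_over)
        then show ?thesis using bump_mon_bounded[OF assms(2), of a b c i "j+2" y]
          by (simp only: abs_mult abs_power2 mult_right_mono zero_le_power2)
      qed
      then have "(bump_mon a b \<kappa> c i j has_real_derivative 0) (at b)"
        by (rule DERIV_zero_of_quadratic_bound)
      then show ?thesis using 4 by (simp add: g_def bump_mon_def)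
    qed
  qed
  with g show ?thesis by blast
qed

lemma bumps_deriv:
  assumes "a < b" "\<kappa> > 0" "f \<in> bumps a b \<kappa>"
  shows "\<exists>g\<in>bumps a b \<kappa>. \<forall>x. (f has_real_derivative g x) (at x)"
  using assms(3)
proof induction
  case (mon c i j)
  then show ?case using bump_mon_deriv[OF assms(1,2)] by blast
next
  case (add f g)
  then obtain f' g' where "f' \<in> bumps a b \<kappa>" "g' \<in> bumps a b \<kappa>"
    "\<forall>x. (f has_real_derivative f' x) (at x)" "\<forall>x. (g has_real_derivative g' x) (at x)" by auto
  then show ?case
    by (intro bexI[of _ "\<lambda>x. f' x + g' x"]) (auto intro!: derivative_intros bumps.add)
qed

lemma bumps_higher_deriv:
  assumes "a < b" "\<kappa> > 0" "f \<in> bumps a b \<kappa>"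
  shows "(deriv ^^ k) f \<in> bumps a b \<kappa>"
proof (induction k)
  case 0 then show ?case using assms by simp
next
  case (Suc k)
  from bumps_deriv[OF assms(1,2) this] obtain g where
    g: "g \<in> bumps a b \<kappa>" "\<And>x. ((deriv ^^ k) f has_real_derivative g x) (at x)" by auto
  then have "deriv ((deriv ^^ k) f) = g"
    by (intro ext DERIV_imp_deriv)
  with g show ?case by simp
qed

lemma bump_in_test_funs:
  assumes "0 < a" "a < b" "b < 1" "\<kappa> > 0"
  shows "bump_mon a b \<kappa> 1 0 0 \<in> test_funs"
proof -
  have "(deriv ^^ k) (bump_mon a b \<kappa> 1 0 0) differentiable (at x)" for k x
    using bumps_deriv[OF assms(2,4) bumps_higher_deriv[OF assms(2,4) bumps.mon[of a b \<kappa> 1 0 0]], of k]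
    by (auto simp: real_differentiable_def)
  moreover have "\<forall>x. x \<notin> {a..b} \<longrightarrow> bump_mon a b \<kappa> 1 0 0 x = 0"
    by (auto simp: bump_mon_def)
  ultimately show ?thesis
    unfolding test_funs_def using assms by (auto intro!: exI[of _ "{a..b}"])
qed

section \<open>The fundamental lemma of the calculus of variations\<close>

lemma borel_integral_zero_on_intervals:
  fixes g :: "real \<Rightarrow> real"
  assumes g: "integrable lborel g" and g0: "integral\<^sup>L lborel g = 0"
    and z: "\<And>a b. a < b \<Longrightarrow> (LINT x:{a<..<b}|lborel. g x) = 0"
  shows "AE x in lborel. g x = 0"
proof -
  have "(LINT x:A|lborel. g x) = 0" if "A \<in> sets borel" for A
  proof -
    \<comment> \<open>Dynkin's argument: the open intervals are an intersection-stable generator.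
      The vanishing total integral gives closure under complements, integrability gives closure
      under disjoint countable unions.\<close>
    let ?G = "range (\<lambda>(a, b). {a <..< b :: real})"
    have "sets (borel :: real measure) = sigma_sets UNIV ?G"
      by (subst borel_eq_box) (simp add: box_real case_prod_unfold sets_measure_of_conv)
    then have A: "A \<in> sigma_sets UNIV ?G" using that by simp
    have "Int_stable ?G"
    proof (rule Int_stableI)
      fix A B assume "A \<in> ?G" "B \<in> ?G"
      then obtain a b c d where "A = {a<..<b}" "B = {c<..<d}" by auto
      then show "A \<inter> B \<in> ?G" by (intro image_eqI[of _ _ "(max a c, min b d)"]) auto
    qed
    moreover have "?G \<subseteq> Pow UNIV" by simp
    ultimately show ?thesis
      using A
    proof (induction rule: sigma_sets_induct_disjoint)
      case (basic A)
      then obtain a b where "A = {a<..<b}" by auto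
      then show ?case using z[of a b] by (cases "a < b") (auto simp: set_lebesgue_integral_def)
    next
      case empty then show ?case by (simp add: set_lebesgue_integral_def)
    next
      case (compl A)
      then have A: "A \<in> sets borel"
        by (metis \<open>sets borel = sigma_sets UNIV ?G\<close>)
      have "(LINT x:A|lborel. g x) + (LINT x:UNIV - A|lborel. g x) = (LINT x:A \<union> (UNIV - A)|lborel. g x)"
      proof (rule set_integral_Un[symmetric])
        show "set_integrable lborel A g" "set_integrable lborel (UNIV - A) g"
          unfolding set_integrable_def using A by (intro integrable_mult_indicator g; simp)+
      qed simp
      also have "\<dots> = integral\<^sup>L lborel g" by (simp add: set_lebesgue_integral_def)
      finally show ?case using compl g0 by simp
    next
      case (union A)
      then have A: "A i \<in> sets borel" for i
        using \<open>sets borel = sigma_sets UNIV ?G\<close> by (metis range_subsetD)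
      have "(LINT x:(\<Union>i. A i)|lborel. g x) = (\<Sum>i. (LINT x:A i|lborel. g x))"
      proof (rule lebesgue_integral_countable_add)
        show "set_integrable lborel (\<Union>i. A i) g"
          using A g unfolding set_integrable_def by (intro integrable_mult_indicator) auto
      qed (use A union in \<open>auto simp: disjoint_family_on_def\<close>)
      then show ?case using union by simp
    qed
  qed
  then show ?thesis
    by (intro density_unique_real g) (auto simp: set_lebesgue_integral_def)
qed


lemma sq_int_continuous:
  fixes f :: "real \<Rightarrow> real"
  assumes "continuous_on UNIV f"
  shows "sq_int f"
proof -
  have c: "continuous_on {0..1} (\<lambda>x. (f x)\<^sup>2)"
    by (intro continuous_intros continuous_on_subset[OF assms]) auto
  have "set_integrable lebesgue {0..1} (\<lambda>x. (f x)\<^sup>2)"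
    using continuous_imp_integrable_real[OF c] by (simp add: integrable_restrict_space set_integrable_def)
  then have "set_integrable lebesgue {0<..<1} (\<lambda>x. (f x)\<^sup>2)"
    by (rule set_integrable_subset) auto
  moreover have "f \<in> borel_measurable (lebesgue_on {0<..<1})"
    using borel_measurable_continuous_onI[OF assms] by (simp add: measurable_completion measurable_restrict_space1)
  ultimately show ?thesis
    by (simp add: sq_int_def integrable_restrict_space set_integrable_def)
qed

lemma lebesgue_on_unit_continuous:
  fixes f :: "real \<Rightarrow> real"
  assumes "continuous_on UNIV f"
  shows "integral\<^sup>L (lebesgue_on {0<..<1}) f = integral {0..1} f"
proof -
  have c: "continuous_on {0..1} f"
    by (intro continuous_on_subset[OF assms]) auto
  have "set_integrable lebesgue {0..1} f"
    using continuous_imp_integrable_real[OF c] by (simp add: integrable_restrict_space set_integrable_def)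
  then have "set_integrable lebesgue {0<..<1} f"
    by (rule set_integrable_subset) auto
  then have "integrable (lebesgue_on {0<..<1}) f"
    by (simp add: integrable_restrict_space set_integrable_def)
  then show ?thesis
    by (simp add: lebesgue_integral_eq_integral integral_open_interval_real)
qed

lemma L2_cases:
  obtains f where "sq_int f" "u = L2_of f"
proof (induct u rule: L2.abs_induct)
  case (1 y)
  then show ?case using L2rel_sq_int(1)[OF 1(1)] by (auto simp: L2_of_def)
qed

lemma inner_L2_of:
  assumes "sq_int f" "sq_int g"
  shows "inner (L2_of f) (L2_of g) = integral\<^sup>L (lebesgue_on {0<..<1}) (\<lambda>x. f x * g x)"
  using assms by (simp add: L2_of_def inner_L2.abs_eq L2rel_def)

lemma L2_of_scale: "sq_int f \<Longrightarrow> L2_of (\<lambda>x. c * f x) = c *\<^sub>R L2_of f"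
  by (simp add: L2_of_def sq_int_scale scaleR_L2.abs_eq L2rel_def)

lemma L2_of_eq_0:
  assumes "sq_int f" "AE x in lebesgue_on {0<..<1}. f x = 0"
  shows "L2_of f = 0"
  using assms by (auto simp: L2_of_def zero_L2_def L2rel_def intro!: Quotient_rel_abs[OF Quotient_L2])

lemma test_fun_C1:
  assumes "\<phi> \<in> test_funs"
  shows "(\<phi> has_real_derivative deriv \<phi> x) (at x)" "continuous_on UNIV \<phi>" "continuous_on UNIV (deriv \<phi>)"
    "\<phi> 0 = 0" "\<phi> 1 = 0"
proof -
  have d: "(deriv ^^ k) \<phi> differentiable (at x)" for k x
    using assms by (auto simp: test_funs_def)
  from d[of 0] d[of 1] have d': "\<phi> differentiable (at x)" "deriv \<phi> differentiable (at x)" for x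
    by auto
  show "(\<phi> has_real_derivative deriv \<phi> x) (at x)"
    using d'(1) DERIV_deriv_iff_real_differentiable by blast
  show "continuous_on UNIV \<phi>" "continuous_on UNIV (deriv \<phi>)"
    using d' by (auto intro!: continuous_at_imp_continuous_on differentiable_imp_continuous_within)
  show "\<phi> 0 = 0" "\<phi> 1 = 0"
    using assms by (auto simp: test_funs_def)
qed

text \<open>Bumps on an interval are test functions tending to its indicator. By dominated
  convergence a representative of \<open>v\<close> therefore integrates to 0 over every subinterval,
  hence vanishes almost everywhere.\<close>

lemma orthogonal_test_funs_imp_0:
  assumes "\<And>\<phi>. \<phi> \<in> test_funs \<Longrightarrow> inner v (L2_of \<phi>) = 0"
  shows "v = 0"
proof -
  obtain f where f: "sq_int f" "v = L2_of f" by (rule L2_cases)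
  let ?I = "{0<..<1::real}"
  have int: "integrable (lebesgue_on ?I) f"
    using sq_int_prod[OF f(1), of "\<lambda>_. 1"] sq_int_continuous[of "\<lambda>_. 1"] by simp
  let ?h = "\<lambda>x. indicator ?I x * f x"
  have inth: "integrable lebesgue ?h"
    using int by (simp add: integrable_restrict_space)
  then have "?h \<in> borel_measurable (completion lborel)" by auto
  \<comment> \<open>A Borel representative is taken because intervals generate only the Borel
    sets.\<close>
  then obtain g where g: "g \<in> borel_measurable lborel" and "AE x in lborel. ?h x = g x"
    using completion_ex_borel_measurable_real by blast
  then have ae: "AE x in lebesgue. ?h x = g x" by (simp add: AE_completion)
  have mh: "?h \<in> borel_measurable lebesgue" using inth by auto
  have mg: "g \<in> borel_measurable lebesgue" using g by (intro measurable_completion) auto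
  have mi: "(indicator {a<..<b} :: real \<Rightarrow> real) \<in> borel_measurable lebesgue" for a b
    by (intro borel_measurable_indicator) simp
  have ai: "set_lebesgue_integral lborel {a<..<b} g = 0" if "a < b" "0 \<le> a" "b \<le> 1" for a b
  proof -
    \<comment> \<open>Retreating by \<open>d k\<close> keeps the support compact inside the open
      unit interval even if \<open>a = 0\<close> or \<open>b = 1\<close>; the summand 3 ensures
      \<open>a + d k < b - d k\<close> from the start.\<close>
    define d where "d k = (b - a) / (real k + 3)" for k
    define \<phi> where "\<phi> k = bump_mon (a + d k) (b - d k) (1 / real (Suc k)) 1 0 0" for k
    have d: "0 < d k" "a + d k < b - d k" for k
    proof -
      show "0 < d k" using that by (simp add: d_def)
      have "d k \<le> (b - a) / 3" unfolding d_def using that by (intro divide_left_mono) auto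
      then show "a + d k < b - d k" using that by (simp add: field_simps)
    qed
    have T: "\<phi> k \<in> test_funs" for k
      unfolding \<phi>_def using d[of k] that by (intro bump_in_test_funs) auto
    have m: "\<phi> k \<in> borel_measurable (lebesgue_on ?I)" for k
      using sq_int_continuous[OF test_fun_C1(2)[OF T]] by (simp add: sq_int_def)
    have "(\<lambda>k. integral\<^sup>L (lebesgue_on ?I) (\<lambda>x. f x * \<phi> k x)) \<longlonglongrightarrow>
        integral\<^sup>L (lebesgue_on ?I) (\<lambda>x. f x * indicator {a<..<b} x)"
    proof (rule integral_dominated_convergence[where w = "\<lambda>x. \<bar>f x\<bar>"])
      show "AE x in lebesgue_on ?I. (\<lambda>k. f x * \<phi> k x) \<longlonglongrightarrow> f x * indicator {a<..<b} x"
      proof (intro AE_I2 tendsto_mult tendsto_const)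
        fix x
        show "(\<lambda>k. \<phi> k x) \<longlonglongrightarrow> indicator {a<..<b} x"
        proof (cases "a < x \<and> x < b")
          case True
          have dl: "d \<longlonglongrightarrow> 0"
            unfolding d_def by (rule real_tendsto_divide_at_top[OF tendsto_const])
              (simp add: filterlim_tendsto_add_at_top[OF tendsto_const filterlim_real_sequentially] add.commute[of _ 3])
          have ev: "\<forall>\<^sub>F k in sequentially. exp (- (1 / real (Suc k)) * (1 / (x - (a + d k)) + 1 / ((b - d k) - x))) = \<phi> k x"
          proof -
            have "\<forall>\<^sub>F k in sequentially. d k < x - a" "\<forall>\<^sub>F k in sequentially. d k < b - x"
              using order_tendstoD(2)[OF dl] True by auto
            then show ?thesis
              by eventually_elim (auto simp: \<phi>_def bump_mon_def)
          qed
          have l1: "(\<lambda>k. 1 / real (Suc k)) \<longlonglongrightarrow> 0"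
            using LIMSEQ_inverse_real_of_nat by (simp add: inverse_eq_divide)
          have "(\<lambda>k. exp (- (1 / real (Suc k)) * (1 / (x - (a + d k)) + 1 / ((b - d k) - x))))
              \<longlonglongrightarrow> exp (- 0 * (1 / (x - (a + 0)) + 1 / ((b - 0) - x)))"
            using True by (intro tendsto_intros l1 dl) auto
          from Lim_transform_eventually[OF this ev] show ?thesis using True by simp
        next
          case False
          then have "\<phi> k x = 0" for k using d[of k] by (auto simp: \<phi>_def bump_mon_def)
          then show ?thesis using False by simp
        qed
      qed
      have le1: "\<bar>\<phi> k x\<bar> \<le> 1" for k x
        unfolding \<phi>_def using bump_mon_bounded[of "1 / real (Suc k)" "a + d k" "b - d k" 1 0 0 x] by simp
      show "AE x in lebesgue_on ?I. norm (f x * \<phi> k x) \<le> \<bar>f x\<bar>" for k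
        using mult_left_le[OF le1[of k]] by (auto simp: abs_mult)
      show "(\<lambda>x. f x * indicator {a<..<b} x) \<in> borel_measurable (lebesgue_on ?I)"
      proof (rule borel_measurable_times)
        show "(indicator {a<..<b} :: real \<Rightarrow> real) \<in> borel_measurable (lebesgue_on ?I)"
          by (rule measurable_restrict_space1[OF mi])
      qed (use f in \<open>simp add: sq_int_def\<close>)
    qed (use f m int in \<open>auto simp: sq_int_def intro!: borel_measurable_times\<close>)
    moreover have "integral\<^sup>L (lebesgue_on ?I) (\<lambda>x. f x * \<phi> k x) = 0" for k
      using assms[OF T] inner_L2_of[OF f(1) sq_int_continuous[OF test_fun_C1(2)[OF T]]] f by simp
    ultimately have "integral\<^sup>L (lebesgue_on ?I) (\<lambda>x. f x * indicator {a<..<b} x) = 0"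
      by (simp add: LIMSEQ_const_iff)
    also have "integral\<^sup>L (lebesgue_on ?I) (\<lambda>x. f x * indicator {a<..<b} x) =
      integral\<^sup>L lebesgue (\<lambda>x. indicator {a<..<b} x * ?h x)"
      by (simp add: integral_restrict_space mult_ac)
    also have "\<dots> = integral\<^sup>L lebesgue (\<lambda>x. indicator {a<..<b} x * g x)"
      using ae by (intro integral_cong_AE borel_measurable_times mi mh mg) (auto elim: eventually_mono)
    also have "\<dots> = integral\<^sup>L lborel (\<lambda>x. indicator {a<..<b} x * g x)"
      using g by (intro integral_completion) auto
    finally show ?thesis by (simp add: set_lebesgue_integral_def)
  qed
  let ?g = "\<lambda>x. indicator ?I x * g x"
  have ae': "AE x in lebesgue. ?h x = ?g x" using ae by eventually_elim (auto split: split_indicator)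
  have "integrable lebesgue ?g"
    using inth ae' by (subst integrable_cong_AE[OF borel_measurable_times[OF mi mg] mh]) (auto elim: eventually_mono)
  then have ig: "integrable lborel ?g"
    using g by (subst (asm) integrable_completion) auto
  have z: "(LINT x:{a<..<b}|lborel. ?g x) = 0" if "a < b" for a b
  proof (cases "max a 0 < min b 1")
    case True
    have "(LINT x:{a<..<b}|lborel. ?g x) = (LINT x:{max a 0<..<min b 1}|lborel. g x)"
      unfolding set_lebesgue_integral_def by (intro Bochner_Integration.integral_cong) (auto split: split_indicator)
    then show ?thesis using ai[OF True] by simp
  next
    case False
    then have "indicator {a<..<b} x *\<^sub>R ?g x = 0" for x
      by (auto split: split_indicator)
    then have "(\<lambda>x. indicator {a<..<b} x *\<^sub>R ?g x) = (\<lambda>x. 0)" by blast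
    then show ?thesis unfolding set_lebesgue_integral_def by (simp only: Bochner_Integration.integral_zero)
  qed
  have "AE x in lborel. ?g x = 0"
    using z ig ai[of 0 1] by (intro borel_integral_zero_on_intervals) (auto simp: set_lebesgue_integral_def)
  then have "AE x in lebesgue. ?g x = 0" by (rule AE_completion)
  with ae' have "AE x in lebesgue. ?h x = 0" by eventually_elim (rule trans)
  then have "AE x in lebesgue_on ?I. f x = 0"
    by (subst AE_restrict_space_iff) (auto elim!: eventually_mono split: split_indicator_asm)
  then show ?thesis using f L2_of_eq_0 by simp
qed

section \<open>Weak derivatives and the sine eigenfunctions\<close>

lemma weak_deriv_unique:
  assumes "weak_deriv u v" "weak_deriv u v'"
  shows "v = v'"
proof -
  have "inner (v - v') (L2_of \<phi>) = 0" if "\<phi> \<in> test_funs" for \<phi>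
    using assms that unfolding weak_deriv_def inner_diff_left by fastforce
  then show ?thesis using orthogonal_test_funs_imp_0[of "v - v'"] by simp
qed

text \<open>Uniqueness, applied once to each derivative, evaluates the definite description in
  \<open>A_op\<close>.\<close>

lemma A_op_eqI:
  assumes "weak_deriv u v" "weak_deriv v w"
  shows "A_op u = w"
  unfolding A_op_def using assms by (intro the_equality) (auto dest: weak_deriv_unique)

lemma weak_deriv_scale: "weak_deriv u v \<Longrightarrow> weak_deriv (c *\<^sub>R u) (c *\<^sub>R v)"
  by (simp add: weak_deriv_def)

lemma weak_deriv_sum:
  assumes "\<And>i. i \<in> I \<Longrightarrow> weak_deriv (u i) (v i)"
  shows "weak_deriv (\<Sum>i\<in>I. u i) (\<Sum>i\<in>I. v i)"
  using assms by (simp add: weak_deriv_def inner_sum_left sum_negf)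

text \<open>Integration by parts; the boundary terms vanish because the test function does, so
  \<open>f\<close> may be non-zero at 0 and 1, as the cosines in \<open>eb_cos\<close> are.\<close>

lemma weak_deriv_C1:
  fixes f f' :: "real \<Rightarrow> real"
  assumes d: "\<And>x. (f has_real_derivative f' x) (at x)" and c: "continuous_on UNIV f'"
  shows "weak_deriv (L2_of f) (L2_of f')"
  unfolding weak_deriv_def
proof
  fix \<phi> assume p: "\<phi> \<in> test_funs"
  note T = test_fun_C1[OF p]
  have cf: "continuous_on UNIV f"
    by (rule continuous_at_imp_continuous_on) (use d DERIV_isCont in blast)
  have "((\<lambda>x. f x * deriv \<phi> x + f' x * \<phi> x) has_integral (f 1 * \<phi> 1 - f 0 * \<phi> 0)) {0..1}"
  proof (rule fundamental_theorem_of_calculus)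
    fix x :: real
    have "((\<lambda>x. f x * \<phi> x) has_real_derivative f x * deriv \<phi> x + f' x * \<phi> x) (at x)"
      using DERIV_mult[OF d T(1)] by (simp add: algebra_simps)
    then show "((\<lambda>x. f x * \<phi> x) has_vector_derivative f x * deriv \<phi> x + f' x * \<phi> x) (at x within {0..1})"
      by (simp add: has_field_derivative_at_within flip: has_real_derivative_iff_has_vector_derivative)
  qed simp
  then have "integral {0..1} (\<lambda>x. f x * deriv \<phi> x + f' x * \<phi> x) = 0"
    using T by (simp add: integral_unique)
  moreover have "integral {0..1} (\<lambda>x. f x * deriv \<phi> x + f' x * \<phi> x)
      = integral {0..1} (\<lambda>x. f x * deriv \<phi> x) + integral {0..1} (\<lambda>x. f' x * \<phi> x)"
    by (intro integral_add integrable_continuous_real continuous_intros continuous_on_subset[OF cf]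
         continuous_on_subset[OF c] continuous_on_subset[OF T(2)] continuous_on_subset[OF T(3)]) auto
  ultimately show "inner (L2_of f) (L2_of (deriv \<phi>)) = - inner (L2_of f') (L2_of \<phi>)"
    by (simp add: inner_L2_of sq_int_continuous cf c T lebesgue_on_unit_continuous continuous_on_mult)
qed

definition eb_cos :: "nat \<Rightarrow> L2" where
  "eb_cos i = L2_of (\<lambda>\<xi>. (sqrt 2 * (real i * pi)) * cos (real i * pi * \<xi>))"

lemma weak_deriv_eb: "weak_deriv (eb i) (eb_cos i)"
  unfolding eb_def eb_cos_def
  by (rule weak_deriv_C1) (auto intro!: derivative_eq_intros continuous_intros)

lemma weak_deriv_eb_cos: "weak_deriv (eb_cos i) (- lam i *\<^sub>R eb i)"
proof -
  have "weak_deriv (eb_cos i) (L2_of (\<lambda>\<xi>. - lam i * (sqrt 2 * sin (real i * pi * \<xi>))))"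
    unfolding eb_cos_def
    by (rule weak_deriv_C1) (auto intro!: derivative_eq_intros continuous_intros simp: lam_def power2_eq_square)
  then show ?thesis
    unfolding eb_def by (simp only: L2_of_scale sq_int_continuous continuous_intros)
qed

text \<open>Both derivatives are taken term by term. This is the only property of the Laplacian that
  enters the analysis of the scheme on \<open>Hn n\<close>.\<close>

lemma A_op_eb_sum: "A_op (\<Sum>i\<in>I. c i *\<^sub>R eb i) = (\<Sum>i\<in>I. (- lam i * c i) *\<^sub>R eb i)"
proof (rule A_op_eqI)
  show "weak_deriv (\<Sum>i\<in>I. c i *\<^sub>R eb i) (\<Sum>i\<in>I. c i *\<^sub>R eb_cos i)"
    by (intro weak_deriv_sum weak_deriv_scale weak_deriv_eb)
  have "weak_deriv (c i *\<^sub>R eb_cos i) ((- lam i * c i) *\<^sub>R eb i)" for i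
    using weak_deriv_scale[OF weak_deriv_eb_cos, of "c i" i] by (simp add: mult.commute)
  then show "weak_deriv (\<Sum>i\<in>I. c i *\<^sub>R eb_cos i) (\<Sum>i\<in>I. (- lam i * c i) *\<^sub>R eb i)"
    by (intro weak_deriv_sum)
qed

lemma integral_cos_pi_int: "integral {0..1} (\<lambda>x. cos (real_of_int k * pi * x)) = (if k = 0 then 1 else 0)"
proof (cases "k = 0")
  case False
  have "((\<lambda>x. cos (real_of_int k * pi * x)) has_integral
      (sin (real_of_int k * pi * 1) / (real_of_int k * pi) - sin (real_of_int k * pi * 0) / (real_of_int k * pi))) {0..1}"
    using False by (intro fundamental_theorem_of_calculus)
       (auto intro!: derivative_eq_intros simp: has_real_derivative_iff_has_vector_derivative[symmetric])
  then show ?thesis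
    using False sin_integer_2pi[of "of_int k / 2"] by (simp add: integral_unique mult.commute[of _ pi] sin_zero_iff_int2)
qed simp

text \<open>Product-to-sum formula: for positive indices the frequency \<open>i + j\<close> never
  vanishes, and \<open>i - j\<close> vanishes exactly on the diagonal.\<close>

lemma inner_eb:
  assumes "i \<ge> 1" "j \<ge> 1"
  shows "inner (eb i) (eb j) = (if i = j then 1 else 0)"
proof -
  have e: "sqrt 2 * sin (real i * pi * x) * (sqrt 2 * sin (real j * pi * x))
     = cos (real_of_int (int i - int j) * pi * x) - cos (real_of_int (int i + int j) * pi * x)" for x
  proof -
    have "real_of_int (int i - int j) * pi * x = real i * pi * x - real j * pi * x"
      "real_of_int (int i + int j) * pi * x = real i * pi * x + real j * pi * x"
      by (simp_all add: algebra_simps)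
    moreover have "sqrt 2 * a * (sqrt 2 * b) = 2 * (a * b)" for a b :: real
      by simp
    ultimately show ?thesis by (simp only: sin_times_sin) simp
  qed
  have "inner (eb i) (eb j) = integral {0..1} (\<lambda>x. sqrt 2 * sin (real i * pi * x) * (sqrt 2 * sin (real j * pi * x)))"
    unfolding eb_def by (simp add: inner_L2_of sq_int_continuous continuous_intros lebesgue_on_unit_continuous)
  also have "\<dots> = integral {0..1} (\<lambda>x. cos (real_of_int (int i - int j) * pi * x))
      - integral {0..1} (\<lambda>x. cos (real_of_int (int i + int j) * pi * x))"
    unfolding e by (intro integral_diff integrable_continuous_real continuous_intros)
  also have "\<dots> = (if i = j then 1 else 0)"
    unfolding integral_cos_pi_int using assms by simp
  finally show ?thesis .
qed

text \<open>Factor \<open>R^2 - c\<close> as \<open>(R + sqrt c) (R - sqrt c)\<close>: the vector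
  \<open>v = R u - sqrt c u\<close> satisfies \<open>R v = - sqrt c v\<close>, and nonnegativity of
  \<open>R\<close> forces \<open>v = 0\<close>. This identifies the given square root on the
  eigenbasis.\<close>

lemma pos_sqrt_eigenvector:
  fixes u :: L2
  assumes R: "is_pos_sqrt R T" and T: "T u = c *\<^sub>R u" and c: "c > 0"
  shows "R u = sqrt c *\<^sub>R u"
proof -
  interpret R: bounded_linear R using R by (simp add: is_pos_sqrt_def)
  define v where "v = R u - sqrt c *\<^sub>R u"
  have "R v = R (R u) - sqrt c *\<^sub>R R u" by (simp add: v_def R.diff R.scaleR)
  also have "R (R u) = c *\<^sub>R u" using R T unfolding is_pos_sqrt_def by (metis comp_apply)
  finally have "R v = - sqrt c *\<^sub>R v"
    using c by (simp add: v_def scaleR_diff_right real_sqrt_mult_self)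
  moreover have "inner (R v) v \<ge> 0" using R by (simp add: is_pos_sqrt_def)
  ultimately have "sqrt c * inner v v \<le> 0" by simp
  then have "inner v v \<le> 0" using c by (simp add: mult_le_0_iff)
  then have "v = 0" using inner_ge_zero[of v] by (simp add: inner_eq_zero_iff)
  then show ?thesis by (simp add: v_def)
qed

section \<open>The contracting chain and its reachable sets\<close>

declare One_nat_def [simp del]

section \<open>Coordinates in the finite-dimensional space\<close>

lemma inner_eb_sum:
  assumes "j \<in> {1..n}"
  shows "inner (\<Sum>i=1..n. c i *\<^sub>R eb i) (eb j) = c j"
proof -
  have "inner (\<Sum>i=1..n. c i *\<^sub>R eb i) (eb j) = (\<Sum>i=1..n. if i = j then c i else 0)"
    unfolding inner_sum_left using assms by (intro sum.cong) (auto simp: inner_eb)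
  then show ?thesis using assms by simp
qed

lemma norm_eb_sum: "(norm (\<Sum>i=1..n. c i *\<^sub>R eb i))\<^sup>2 = (\<Sum>i=1..n. (c i)\<^sup>2)"
proof -
  have "(norm (\<Sum>i=1..n. c i *\<^sub>R eb i))\<^sup>2 = (\<Sum>j=1..n. c j * inner (\<Sum>i=1..n. c i *\<^sub>R eb i) (eb j))"
    unfolding power2_norm_eq_inner by (subst inner_sum_right) simp
  also have "\<dots> = (\<Sum>j=1..n. (c j)\<^sup>2)"
    by (intro sum.cong refl) (subst inner_eb_sum, auto simp: power2_eq_square)
  finally show ?thesis .
qed

lemma eb_sum_in_Hn: "(\<Sum>i=1..n. c i *\<^sub>R eb i) \<in> Hn n"
  unfolding Hn_def by (intro span_sum span_scale span_base) auto

lemma Hn_expand: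
  assumes "u \<in> Hn n"
  shows "u = (\<Sum>i=1..n. inner u (eb i) *\<^sub>R eb i)"
proof -
  from assms obtain c where "u = (\<Sum>v\<in>eb ` {1..n}. c v *\<^sub>R v)"
    unfolding Hn_def by (auto simp: span_finite)
  also have "\<dots> = (\<Sum>i=1..n. c (eb i) *\<^sub>R eb i)"
  proof (rule sum.reindex_cong[OF _ refl refl])
    show "inj_on eb {1..n}"
      by (rule inj_onI) (metis atLeastAtMost_iff inner_eb zero_neq_one)
  qed
  finally have u: "u = (\<Sum>i=1..n. c (eb i) *\<^sub>R eb i)" .
  have "inner u (eb j) = c (eb j)" if "j \<in> {1..n}" for j
    unfolding u using that by (rule inner_eb_sum)
  then show ?thesis using u by simp
qed

lemma Pn_in_Hn: "Pn n u \<in> Hn n"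
  unfolding Pn_def by (rule eb_sum_in_Hn)

lemma Pn_id: "u \<in> Hn n \<Longrightarrow> Pn n u = u"
  unfolding Pn_def by (rule Hn_expand[symmetric])

lemma Hn_iff: "u \<in> Hn n \<longleftrightarrow> Pn n u = u"
  using Pn_id Pn_in_Hn by metis

lemma closed_Hn: "closed (Hn n)"
proof -
  have "Hn n = {u. Pn n u = u}" using Hn_iff by auto
  moreover have "closed {u. Pn n u = u}"
    unfolding Pn_def by (intro closed_Collect_eq continuous_intros)
  ultimately show ?thesis by simp
qed

lemma subspace_Hn: "subspace (Hn n)"
  unfolding Hn_def by (rule subspace_span)

lemma inner_Pn: "j \<in> {1..n} \<Longrightarrow> inner (Pn n u) (eb j) = inner u (eb j)"
  unfolding Pn_def by (rule inner_eb_sum)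

lemma bessel: "(\<Sum>i=1..n. (inner u (eb i))\<^sup>2) \<le> (norm u)\<^sup>2"
proof -
  have "inner (u - Pn n u) (eb j) = 0" if "j \<in> {1..n}" for j
    using that by (simp add: inner_diff_left inner_Pn)
  then have "inner (u - Pn n u) (Pn n u) = 0"
    by (subst (2) Pn_def) (simp add: inner_sum_right)
  then have "(norm u)\<^sup>2 = (norm (Pn n u))\<^sup>2 + (norm (u - Pn n u))\<^sup>2"
    by (simp add: power2_norm_eq_inner inner_diff_left inner_diff_right inner_commute)
  moreover have "(norm (Pn n u))\<^sup>2 = (\<Sum>i=1..n. (inner u (eb i))\<^sup>2)"
    unfolding Pn_def by (rule norm_eb_sum)
  ultimately show ?thesis by simp
qed

lemma norm_diag_le:
  assumes "\<And>i. i \<in> {1..n} \<Longrightarrow> 0 \<le> a i \<and> a i \<le> b" and b: "0 \<le> b"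
  shows "norm (\<Sum>i=1..n. (a i * inner u (eb i)) *\<^sub>R eb i) \<le> b * norm u"
proof -
  have "(norm (\<Sum>i=1..n. (a i * inner u (eb i)) *\<^sub>R eb i))\<^sup>2 = (\<Sum>i=1..n. (a i)\<^sup>2 * (inner u (eb i))\<^sup>2)"
    unfolding norm_eb_sum by (simp add: power_mult_distrib)
  also have "\<dots> \<le> (\<Sum>i=1..n. b\<^sup>2 * (inner u (eb i))\<^sup>2)"
    using assms by (intro sum_mono mult_right_mono power_mono) auto
  also have "\<dots> \<le> b\<^sup>2 * (norm u)\<^sup>2"
    unfolding sum_distrib_left[symmetric] by (intro mult_left_mono bessel) auto
  finally have "(norm (\<Sum>i=1..n. (a i * inner u (eb i)) *\<^sub>R eb i))\<^sup>2 \<le> (b * norm u)\<^sup>2"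
    by (simp add: power_mult_distrib)
  then show ?thesis by (rule power2_le_imp_le) (use b in auto)
qed

lemma lam_pos: "i \<ge> 1 \<Longrightarrow> lam i > 0"
  by (simp add: lam_def)

lemma lam_nz: "i \<ge> 1 \<Longrightarrow> lam i \<noteq> 0"
  using lam_pos[of i] by simp

lemma lam_mono: "i \<ge> 1 \<Longrightarrow> lam 1 \<le> lam i"
  by (simp add: lam_def power_mono)

lemma one_minus_exp_div_antimono:
  fixes a b h :: real
  assumes "0 < a" "a \<le> b" "0 \<le> h"
  shows "(1 - exp (- b * h)) / b \<le> (1 - exp (- a * h)) / a"
proof -
  have "exp (- a * h) = exp ((1 - a / b) * 0 + (a / b) * (- b * h))"
    using assms by simp
  also have "\<dots> \<le> (1 - a / b) * exp 0 + (a / b) * exp (- b * h)"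
    using convex_onD[OF exp_convex, of "a / b" 0 "- b * h"] assms by simp
  finally have "(a / b) * (1 - exp (- b * h)) \<le> 1 - exp (- a * h)" by (simp add: algebra_simps)
  then have "((a / b) * (1 - exp (- b * h))) / a \<le> (1 - exp (- a * h)) / a"
    using assms by (intro divide_right_mono) auto
  then show ?thesis using assms by simp
qed

definition sqsum :: "nat \<Rightarrow> (nat \<Rightarrow> real) \<Rightarrow> real" where
  "sqsum n z = (\<Sum>i=1..n. (z i)\<^sup>2)"

lemma sqsum_nonneg: "0 \<le> sqsum n z"
  by (simp add: sqsum_def sum_nonneg)

locale aee =
  fixes q :: "nat \<Rightarrow> real" and F :: "L2 \<Rightarrow> L2" and L\<^sub>F \<tau> :: real and n :: nat
  assumes n1: "n \<ge> 1" and qpos: "\<And>i. i \<ge> 1 \<Longrightarrow> q i > 0" and LF: "0 < L\<^sub>F" "L\<^sub>F < lam 1"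
    and F_lip: "\<And>u v. norm (F u - F v) \<le> L\<^sub>F * norm (u - v)" and F0: "F 0 = 0" and tau: "0 < \<tau>"
begin

text \<open>Variation of constants over time \<open>h\<close>: the linear part is solved exactly,
  the nonlinearity is frozen at the starting point.\<close>

definition stepmap :: "real \<Rightarrow> L2 \<Rightarrow> L2" where
  "stepmap h x = (\<Sum>i=1..n. (exp (- lam i * h) * inner x (eb i)
      + (1 - exp (- lam i * h)) / lam i * inner (F x) (eb i)) *\<^sub>R eb i)"

text \<open>Standard deviation of the stochastic convolution of mode \<open>i\<close> over time
  \<open>h\<close> at unit noise intensity, as given by the Ito isometry.\<close>

definition sd :: "real \<Rightarrow> nat \<Rightarrow> real" where
  "sd h i = sqrt (q i * ((1 - exp (- 2 * lam i * h)) / (2 * lam i)))"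

definition kick :: "real \<Rightarrow> (nat \<Rightarrow> real) \<Rightarrow> L2" where
  "kick h z = (\<Sum>i=1..n. (sd h i * z i) *\<^sub>R eb i)"

primrec chain :: "L2 \<Rightarrow> (nat \<Rightarrow> nat \<Rightarrow> real) \<Rightarrow> nat \<Rightarrow> L2" where
  "chain x z 0 = x"
| "chain x z (Suc k) = stepmap \<tau> (chain x z k) + kick \<tau> (z k)"

text \<open>After \<open>m\<close> full steps comes one of length \<open>s\<close>, driven by the
  vector \<open>z m\<close>. So \<open>m + 1\<close> noise vectors are involved, which is why
  \<open>cost\<close> sums over \<open>k \<le> m\<close>.\<close>

definition endpt :: "L2 \<Rightarrow> nat \<Rightarrow> real \<Rightarrow> (nat \<Rightarrow> nat \<Rightarrow> real) \<Rightarrow> L2" where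
  "endpt x m s z = stepmap s (chain x z m) + kick s (z m)"

definition cost :: "nat \<Rightarrow> (nat \<Rightarrow> nat \<Rightarrow> real) \<Rightarrow> real" where
  "cost m z = (\<Sum>k\<le>m. sqsum n (z k)) / 2"

definition qpot :: "L2 \<Rightarrow> ereal" where
  "qpot u = Inf {ereal (cost m z) | m s z. 0 < s \<and> s \<le> \<tau> \<and> endpt 0 m s z = u}"

definition contr :: "real \<Rightarrow> real" where
  "contr h = exp (- lam 1 * h) + L\<^sub>F * ((1 - exp (- lam 1 * h)) / lam 1)"

definition \<rho> :: real where "\<rho> = contr \<tau>"

text \<open>Noise coefficient in the recursion for squared norms of the chain, see
  \<open>chain_step_sq\<close>; the division by \<open>1 - \<rho>\<close> is the price of
  \<open>convex_square\<close>.\<close>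

definition noise_bd :: real where
  "noise_bd = (\<Sum>i=1..n. q i / (2 * lam i)) / (1 - \<rho>)"

lemma contr_le_1: "0 \<le> h \<Longrightarrow> contr h \<le> 1"
proof -
  assume "0 \<le> h"
  have "0 \<le> (1 - L\<^sub>F / lam 1) * (1 - exp (- lam 1 * h))"
    using LF \<open>0 \<le> h\<close> by (intro mult_nonneg_nonneg) auto
  then show ?thesis by (simp add: contr_def algebra_simps diff_divide_distrib)
qed

text \<open>The gap \<open>1 - \<rho>\<close> equals
  \<open>(1 - L\<^sub>F / lam 1) * (1 - exp (- lam 1 * \<tau>))\<close>, and both factors are
  positive.\<close>

lemma rho: "0 < \<rho>" "\<rho> < 1"
proof -
  have "0 < (1 - L\<^sub>F / lam 1) * (1 - exp (- lam 1 * \<tau>))"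
    using LF tau by (intro mult_pos_pos) auto
  then show "\<rho> < 1" by (simp add: \<rho>_def contr_def algebra_simps diff_divide_distrib)
  show "0 < \<rho>" unfolding \<rho>_def contr_def using LF tau
    by (intro add_pos_nonneg mult_nonneg_nonneg divide_nonneg_nonneg) auto
qed

lemma noise_bd_nonneg: "0 \<le> noise_bd"
proof -
  have "0 \<le> q i / (2 * lam i)" if "i \<ge> 1" for i
    using qpos[OF that] lam_pos[OF that] by simp
  then have "0 \<le> (\<Sum>i=1..n. q i / (2 * lam i))" by (intro sum_nonneg) auto
  then show ?thesis using rho by (simp add: noise_bd_def)
qed

lemma stepmap_in_Hn [simp]: "stepmap h x \<in> Hn n"
  and kick_in_Hn [simp]: "kick h z \<in> Hn n"
  unfolding stepmap_def kick_def by (rule eb_sum_in_Hn)+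

lemma zero_in_Hn [simp]: "0 \<in> Hn n" using subspace_Hn subspace_0 by blast

lemma add_in_Hn: "x \<in> Hn n \<Longrightarrow> y \<in> Hn n \<Longrightarrow> x + y \<in> Hn n"
  using subspace_Hn subspace_add by blast

lemma chain_in_Hn: "x \<in> Hn n \<Longrightarrow> chain x z k \<in> Hn n"
  by (cases k) (auto intro: add_in_Hn)

lemma endpt_in_Hn: "endpt x m s z \<in> Hn n"
  by (auto simp: endpt_def intro: add_in_Hn)

lemma stepmap_0 [simp]: "stepmap h 0 = 0"
  by (simp add: stepmap_def F0)

lemma stepmap_id: "x \<in> Hn n \<Longrightarrow> stepmap 0 x = x"
  using Hn_expand[of x n] by (simp add: stepmap_def)

lemma kick_0 [simp]: "kick h (\<lambda>i. 0) = 0" "kick 0 z = 0"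
  by (simp_all add: kick_def sd_def)

text \<open>The difference splits into two diagonal operators, applied to \<open>x - y\<close> and
  to \<open>F x - F y\<close>; each is bounded by its entry at mode 1.\<close>

lemma stepmap_lip:
  assumes h: "0 \<le> h"
  shows "norm (stepmap h x - stepmap h y) \<le> contr h * norm (x - y)"
proof -
  have "stepmap h x - stepmap h y = (\<Sum>i=1..n. (exp (- lam i * h) * inner (x - y) (eb i)) *\<^sub>R eb i)
      + (\<Sum>i=1..n. ((1 - exp (- lam i * h)) / lam i * inner (F x - F y) (eb i)) *\<^sub>R eb i)"
    unfolding stepmap_def sum.distrib[symmetric] sum_subtractf[symmetric]
    unfolding scaleR_left_distrib[symmetric] scaleR_left_diff_distrib[symmetric] inner_diff_left
    by (intro sum.cong refl arg_cong2[where f = scaleR]) (simp add: algebra_simps diff_divide_distrib)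
  also have "norm \<dots> \<le> exp (- lam 1 * h) * norm (x - y) + (1 - exp (- lam 1 * h)) / lam 1 * norm (F x - F y)"
  proof (intro norm_triangle_mono norm_diag_le conjI)
    fix i assume i: "i \<in> {1..n}"
    then have l: "0 < lam i" "lam 1 \<le> lam i" "0 < lam 1" using lam_pos lam_mono by auto
    show "0 \<le> (1 - exp (- lam i * h)) / lam i" using l h by simp
    show "exp (- lam i * h) \<le> exp (- lam 1 * h)" using l h by (simp add: mult_right_mono)
    show "(1 - exp (- lam i * h)) / lam i \<le> (1 - exp (- lam 1 * h)) / lam 1"
      using l h by (intro one_minus_exp_div_antimono) auto
  qed (use h lam_pos[of 1] in auto)
  also have "\<dots> \<le> exp (- lam 1 * h) * norm (x - y) + (1 - exp (- lam 1 * h)) / lam 1 * (L\<^sub>F * norm (x - y))"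
    using h LF by (intro add_left_mono mult_left_mono F_lip divide_nonneg_nonneg) auto
  finally show ?thesis by (simp add: contr_def algebra_simps)
qed

lemma sd_sq: "0 \<le> h \<Longrightarrow> i \<ge> 1 \<Longrightarrow> (sd h i)\<^sup>2 = q i * ((1 - exp (- 2 * lam i * h)) / (2 * lam i))"
  unfolding sd_def using qpos[of i] lam_pos[of i] by (subst real_sqrt_pow2) auto

lemma sd_pos: "0 < h \<Longrightarrow> i \<ge> 1 \<Longrightarrow> 0 < sd h i"
  unfolding sd_def using qpos[of i] lam_pos[of i] by auto

lemma norm_kick_sq:
  assumes h: "0 \<le> h"
  shows "(norm (kick h z))\<^sup>2 \<le> (1 - \<rho>) * noise_bd * sqsum n z"
proof -
  have sdle: "(sd h i)\<^sup>2 \<le> q i / (2 * lam i)" if "i \<ge> 1" for i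
    unfolding sd_sq[OF h that] using qpos[OF that] lam_pos[OF that] by (simp add: field_simps)
  have le: "(sd h i)\<^sup>2 \<le> (1 - \<rho>) * noise_bd" if "i \<in> {1..n}" for i
  proof -
    have "(sd h i)\<^sup>2 \<le> q i / (2 * lam i)" using sdle that by auto
    also have "\<dots> \<le> (\<Sum>i=1..n. q i / (2 * lam i))"
      using that qpos lam_pos by (intro member_le_sum) (auto intro!: divide_nonneg_nonneg less_imp_le)
    also have "\<dots> = (1 - \<rho>) * noise_bd" using rho by (simp add: noise_bd_def)
    finally show ?thesis .
  qed
  have "(norm (kick h z))\<^sup>2 = (\<Sum>i=1..n. (sd h i)\<^sup>2 * (z i)\<^sup>2)"
    unfolding kick_def norm_eb_sum by (simp add: power_mult_distrib)
  also have "\<dots> \<le> (\<Sum>i=1..n. (1 - \<rho>) * noise_bd * (z i)\<^sup>2)"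
    using le by (intro sum_mono mult_right_mono) auto
  finally show ?thesis by (simp add: sqsum_def sum_distrib_left)
qed

text \<open>Both chains are driven by the same noise, so the kicks cancel.\<close>

lemma chain_contract: "norm (chain x z k - chain y z k) \<le> \<rho> ^ k * norm (x - y)"
proof (induction k)
  case (Suc k)
  have "norm (chain x z (Suc k) - chain y z (Suc k)) \<le> \<rho> * norm (chain x z k - chain y z k)"
    using stepmap_lip[of \<tau> "chain x z k" "chain y z k"] tau by (simp add: \<rho>_def)
  also have "\<dots> \<le> \<rho> * (\<rho> ^ k * norm (x - y))" using rho Suc by (intro mult_left_mono) auto
  finally show ?case by (simp add: mult.assoc)
qed simp

text \<open>The last step may be arbitrarily short, so it is only counted as nonexpansive.\<close>

lemma endpt_contract:
  assumes "0 \<le> s"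
  shows "norm (endpt x m s z - endpt y m s z) \<le> \<rho> ^ m * norm (x - y)"
proof -
  have "norm (endpt x m s z - endpt y m s z) \<le> contr s * norm (chain x z m - chain y z m)"
    using stepmap_lip[OF assms, of "chain x z m" "chain y z m"] by (simp add: endpt_def)
  also have "\<dots> \<le> norm (chain x z m - chain y z m)"
    using mult_right_mono[OF contr_le_1[OF assms], of "norm (chain x z m - chain y z m)"] by simp
  finally show ?thesis using chain_contract[of x z m y] by linarith
qed

text \<open>Convexity of the square with weights \<open>r\<close> and \<open>1 - r\<close> at the
  points \<open>a\<close> and \<open>b / (1 - r)\<close>. The coefficient of \<open>a^2\<close>
  stays \<open>r\<close>, so squared norms contract with the ratio \<rho> as well.\<close>

lemma convex_square:
  fixes a b r :: real
  assumes "0 < r" "r < 1"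
  shows "(r * a + b)\<^sup>2 \<le> r * a\<^sup>2 + b\<^sup>2 / (1 - r)"
proof -
  have "r * a\<^sup>2 + b\<^sup>2 / (1 - r) - (r * a + b)\<^sup>2 = r * ((1 - r) * a - b)\<^sup>2 / (1 - r)"
    using assms by (simp add: field_simps power2_eq_square)
  also have "\<dots> \<ge> 0" using assms by (intro divide_nonneg_nonneg mult_nonneg_nonneg) auto
  finally show ?thesis by simp
qed

lemma chain_step_sq:
  "(norm (chain x z (Suc k)))\<^sup>2 \<le> \<rho> * (norm (chain x z k))\<^sup>2 + noise_bd * sqsum n (z k)"
proof -
  have "norm (chain x z (Suc k)) \<le> \<rho> * norm (chain x z k) + norm (kick \<tau> (z k))"
    using stepmap_lip[of \<tau> "chain x z k" 0] tau
      norm_triangle_ineq[of "stepmap \<tau> (chain x z k)" "kick \<tau> (z k)"] by (simp add: \<rho>_def)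
  then have "(norm (chain x z (Suc k)))\<^sup>2 \<le> (\<rho> * norm (chain x z k) + norm (kick \<tau> (z k)))\<^sup>2"
    by (intro power_mono) auto
  also have "\<dots> \<le> \<rho> * (norm (chain x z k))\<^sup>2 + (norm (kick \<tau> (z k)))\<^sup>2 / (1 - \<rho>)"
    using rho by (intro convex_square)
  also have "(norm (kick \<tau> (z k)))\<^sup>2 / (1 - \<rho>) \<le> noise_bd * sqsum n (z k)"
    using norm_kick_sq[of \<tau> "z k"] rho tau by (simp add: field_simps)
  finally show ?thesis by simp
qed

text \<open>The recursion of \<open>chain_step_sq\<close> unrolled. The geometric weights are
  summable uniformly in \<open>k\<close>, which makes the tail estimate of \<open>tail_event\<close>
  uniform in time.\<close>

lemma chain_sq_bound:
  "(norm (chain 0 z k))\<^sup>2 \<le> noise_bd * (\<Sum>j<k. \<rho> ^ (k - Suc j) * sqsum n (z j))"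
proof (induction k)
  case (Suc k)
  have "(norm (chain 0 z (Suc k)))\<^sup>2 \<le> \<rho> * (noise_bd * (\<Sum>j<k. \<rho> ^ (k - Suc j) * sqsum n (z j))) + noise_bd * sqsum n (z k)"
    using chain_step_sq[of 0 z k] mult_left_mono[OF Suc, of \<rho>] rho by linarith
  also have "\<rho> * (noise_bd * (\<Sum>j<k. \<rho> ^ (k - Suc j) * sqsum n (z j))) = noise_bd * (\<Sum>j<k. \<rho> ^ (Suc k - Suc j) * sqsum n (z j))"
  proof -
    have "\<rho> * (\<rho> ^ (k - Suc j) * c) = \<rho> ^ (Suc k - Suc j) * c" if "j < k" for j and c :: real
      using that by (metis Suc_diff_Suc diff_Suc_Suc mult.assoc power_Suc)
    then have "(\<Sum>j<k. \<rho> * (\<rho> ^ (k - Suc j) * sqsum n (z j))) = (\<Sum>j<k. \<rho> ^ (Suc k - Suc j) * sqsum n (z j))"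
      by (intro sum.cong) auto
    then show ?thesis by (simp only: mult.left_commute[of \<rho> noise_bd] sum_distrib_left[of \<rho>])
  qed
  finally show ?case by (simp add: distrib_left)
qed simp

text \<open>The same recursion summed: the total of the squared norms is controlled by the total
  cost, whatever the number of steps. The separate term at the last index closes the
  induction.\<close>

lemma chain_sq_sum_bound:
  "(1 - \<rho>) * (\<Sum>k\<le>m. (norm (chain 0 z k))\<^sup>2) + \<rho> * (norm (chain 0 z m))\<^sup>2 \<le> noise_bd * (\<Sum>k<m. sqsum n (z k))"
proof (induction m)
  case (Suc m)
  then show ?case using chain_step_sq[of 0 z m] by (simp add: algebra_simps)
qed simp

lemma chain_shift: "chain x z (j + k) = chain (chain x z j) (\<lambda>i. z (j + i)) k"
  by (induction k) auto

lemma endpt_shift: "endpt x (j + m) s z = endpt (chain x z j) m s (\<lambda>i. z (j + i))"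
  by (simp add: endpt_def chain_shift)

lemma chain_cong:
  assumes "\<And>j i. j < k \<Longrightarrow> i \<in> {1..n} \<Longrightarrow> z j i = z' j i"
  shows "chain x z k = chain x z' k"
  using assms by (induction k) (auto simp: kick_def intro!: sum.cong)

lemma endpt_cong:
  assumes "\<And>j i. j \<le> m \<Longrightarrow> i \<in> {1..n} \<Longrightarrow> z j i = z' j i"
  shows "endpt x m s z = endpt x m s z'"
proof -
  have "chain x z m = chain x z' m" using assms by (intro chain_cong) auto
  moreover have "kick s (z m) = kick s (z' m)" using assms by (auto simp: kick_def intro!: sum.cong)
  ultimately show ?thesis by (simp add: endpt_def)
qed

lemma cost_cong:
  assumes "\<And>j i. j \<le> m \<Longrightarrow> i \<in> {1..n} \<Longrightarrow> z j i = z' j i"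
  shows "cost m z = cost m z'"
  using assms by (auto simp: cost_def sqsum_def intro!: sum.cong)

lemma cost_nonneg: "0 \<le> cost m z"
  by (simp add: cost_def sum_nonneg sqsum_nonneg)

lemma F_isCont: "isCont F x"
proof -
  have "((\<lambda>u. F u - F x) \<longlongrightarrow> 0) (at x)"
  proof (rule Lim_null_comparison)
    show "\<forall>\<^sub>F u in at x. norm (F u - F x) \<le> L\<^sub>F * norm (u - x)" using F_lip by auto
    show "((\<lambda>u. L\<^sub>F * norm (u - x)) \<longlongrightarrow> 0) (at x)" by (auto intro!: tendsto_eq_intros)
  qed
  then show ?thesis by (simp add: isCont_def LIM_zero_iff)
qed

lemma tendsto_stepmap:
  assumes "(f \<longlongrightarrow> x) G" "(h \<longlongrightarrow> h0) G"
  shows "((\<lambda>a. stepmap (h a) (f a)) \<longlongrightarrow> stepmap h0 x) G"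
  unfolding stepmap_def using lam_pos
  by (intro tendsto_intros assms isCont_tendsto_compose[OF F_isCont]) (auto simp: lam_nz)

lemma tendsto_kick:
  assumes "\<And>i. i \<in> {1..n} \<Longrightarrow> ((\<lambda>a. z a i) \<longlongrightarrow> z0 i) G" "(h \<longlongrightarrow> h0) G"
  shows "((\<lambda>a. kick (h a) (z a)) \<longlongrightarrow> kick h0 z0) G"
  unfolding kick_def sd_def using lam_pos by (intro tendsto_intros assms) (auto simp: lam_nz)

lemma tendsto_chain:
  assumes "\<And>k i. k < m \<Longrightarrow> i \<in> {1..n} \<Longrightarrow> ((\<lambda>a. z a k i) \<longlongrightarrow> z0 k i) G"
  shows "((\<lambda>a. chain x (z a) m) \<longlongrightarrow> chain x z0 m) G"
  using assms by (induction m) (auto intro!: tendsto_add tendsto_stepmap tendsto_kick)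

lemma tendsto_endpt:
  assumes "\<And>k i. k \<le> m \<Longrightarrow> i \<in> {1..n} \<Longrightarrow> ((\<lambda>a. z a k i) \<longlongrightarrow> z0 k i) G" "(s \<longlongrightarrow> s0) G"
  shows "((\<lambda>a. endpt x m (s a) (z a)) \<longlongrightarrow> endpt x m s0 z0) G"
  unfolding endpt_def using assms by (auto intro!: tendsto_add tendsto_stepmap tendsto_kick tendsto_chain)

end

section \<open>Compactness of reachable sets and of sublevel sets\<close>

lemma compact_fun_box:
  fixes R :: real
  shows "compact {z :: nat \<Rightarrow> nat \<Rightarrow> real. \<forall>k i. \<bar>z k i\<bar> \<le> R}"
proof -
  \<comment> \<open>Tychonoff's theorem, once for the modes and once for the steps.\<close>
  have 1: "compact (PiE UNIV (\<lambda>i::nat. {-R..R}))"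
    using compactin_PiE[of "\<lambda>_. euclidean" UNIV "\<lambda>_. {-R..R}"] by (simp add: euclidean_product_topology)
  have 2: "compact (PiE UNIV (\<lambda>k::nat. PiE UNIV (\<lambda>i::nat. {-R..R})))"
    using compactin_PiE[of "\<lambda>_. euclidean" UNIV "\<lambda>k::nat. PiE UNIV (\<lambda>i::nat. {-R..R})"] 1
    by (simp add: euclidean_product_topology)
  have "{z :: nat \<Rightarrow> nat \<Rightarrow> real. \<forall>k i. \<bar>z k i\<bar> \<le> R} = PiE UNIV (\<lambda>k. PiE UNIV (\<lambda>i. {-R..R}))"
    by (auto simp: PiE_UNIV_domain abs_le_iff Pi_iff minus_le_iff)
  with 2 show ?thesis by simp
qed

context aee
begin

definition reach :: "nat \<Rightarrow> real \<Rightarrow> L2 set" where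
  "reach m c = {endpt 0 m s z | s z. 0 \<le> s \<and> s \<le> \<tau> \<and> cost m z \<le> c}"

lemma coord_cont: "continuous_on UNIV (\<lambda>z::nat \<Rightarrow> nat \<Rightarrow> real. z k i)"
  by (rule continuous_on_product_then_coordinatewise[OF continuous_on_product_coordinates])

lemma coord_le_cost:
  assumes "k \<le> m" "i \<in> {1..n}"
  shows "(z k i)\<^sup>2 \<le> 2 * cost m z"
proof -
  have "(z k i)\<^sup>2 \<le> sqsum n (z k)"
    unfolding sqsum_def using assms by (intro member_le_sum) auto
  also have "\<dots> \<le> (\<Sum>k\<le>m. sqsum n (z k))"
    using assms by (intro member_le_sum) (auto simp: sqsum_nonneg)
  finally show ?thesis by (simp add: cost_def)
qed

lemma compact_reach:
  assumes c: "0 \<le> c"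
  shows "compact (reach m c)"
proof -
  \<comment> \<open>By \<open>coord_le_cost\<close> every entry that matters is at most
    \<open>sqrt (2 * c)\<close> in absolute value; the cost condition is closed in the product
    topology.\<close>
  define Z where "Z = {z :: nat \<Rightarrow> nat \<Rightarrow> real. \<forall>k i. \<bar>z k i\<bar> \<le> sqrt (2 * c)} \<inter> {z. cost m z \<le> c}"
  have "closed {z. cost m z \<le> c}"
    unfolding cost_def sqsum_def
    by (intro closed_Collect_le continuous_intros continuous_on_subset[OF coord_cont]) auto
  then have "compact Z" unfolding Z_def by (intro compact_Int_closed compact_fun_box)
  then have K: "compact ({0..\<tau>} \<times> Z)" by (intro compact_Times) auto
  have cont: "continuous_on ({0..\<tau>} \<times> Z) (\<lambda>p. endpt 0 m (fst p) (snd p))"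
    unfolding continuous_on_def
  proof (intro ballI tendsto_endpt)
    fix p :: "real \<times> (nat \<Rightarrow> nat \<Rightarrow> real)" and k i
    have "continuous_on UNIV (\<lambda>p::real \<times> (nat \<Rightarrow> nat \<Rightarrow> real). snd p k i)"
      by (rule continuous_on_compose2[OF coord_cont continuous_on_snd[OF continuous_on_id]]) auto
    then show "((\<lambda>a. snd a k i) \<longlongrightarrow> snd p k i) (at p within {0..\<tau>} \<times> Z)"
      by (meson UNIV_I continuous_on_def subset_UNIV tendsto_within_subset)
  qed (rule tendsto_fst[OF tendsto_ident_at])
  have "reach m c = (\<lambda>p. endpt 0 m (fst p) (snd p)) ` ({0..\<tau>} \<times> Z)"
  proof
    show "(\<lambda>p. endpt 0 m (fst p) (snd p)) ` ({0..\<tau>} \<times> Z) \<subseteq> reach m c"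
    proof clarify
      fix s z assume "s \<in> {0..\<tau>}" "z \<in> Z"
      then show "endpt 0 m (fst (s, z)) (snd (s, z)) \<in> reach m c"
        unfolding reach_def by (intro CollectI exI[of _ s] exI[of _ z]) (auto simp: Z_def)
    qed
    show "reach m c \<subseteq> (\<lambda>p. endpt 0 m (fst p) (snd p)) ` ({0..\<tau>} \<times> Z)"
    proof
      fix u assume "u \<in> reach m c"
      then obtain s z where u: "u = endpt 0 m s z" "0 \<le> s" "s \<le> \<tau>" "cost m z \<le> c"
        by (auto simp: reach_def)
      \<comment> \<open>Entries beyond step \<open>m\<close> or mode \<open>n\<close> influence
        neither the end point nor the cost, but may leave the box; they are set to 0.\<close>
      define z' where "z' k i = (if k \<le> m \<and> i \<in> {1..n} then z k i else 0)" for k i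
      have e: "endpt 0 m s z' = endpt 0 m s z" "cost m z' = cost m z"
        by (intro endpt_cong cost_cong; simp add: z'_def)+
      have "\<bar>z k i\<bar> \<le> sqrt (2 * c)" if "k \<le> m" "i \<in> {1..n}" for k i
      proof -
        have "(z k i)\<^sup>2 \<le> 2 * c" using coord_le_cost[OF that, of z] u by linarith
        then show ?thesis using real_le_rsqrt[of "\<bar>z k i\<bar>"] by simp
      qed
      then have "z' \<in> Z" using u e c by (auto simp: Z_def z'_def)
      then show "u \<in> (\<lambda>p. endpt 0 m (fst p) (snd p)) ` ({0..\<tau>} \<times> Z)"
        using u e by (intro image_eqI[of _ _ "(s, z')"]) auto
    qed
  qed
  then show ?thesis using compact_continuous_image[OF cont K] by simp
qed

text \<open>Padding goes at the front: under zero noise the chain rests at 0, so steps can be added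
  there without changing the end point or the cost.\<close>

lemma chain_pad: "chain 0 (case_nat (\<lambda>i. 0) z) (Suc k) = chain 0 z k"
  by (induction k) simp_all

lemma endpt_pad: "endpt 0 (Suc m) s (case_nat (\<lambda>i. 0) z) = endpt 0 m s z"
  unfolding endpt_def chain_pad by simp

lemma cost_Suc: "cost (Suc m) z = sqsum n (z 0) / 2 + cost m (\<lambda>k. z (Suc k))"
  unfolding cost_def by (subst sum.atMost_Suc_shift) (simp add: add_divide_distrib)

lemma cost_pad: "cost (Suc m) (case_nat (\<lambda>i. 0) z) = cost m z"
  by (simp add: cost_Suc sqsum_def)

lemma pad_exists:
  assumes "m \<le> M"
  obtains z' where "endpt 0 M s z' = endpt 0 m s z" "cost M z' = cost m z"
proof -
  have "\<exists>z'. endpt 0 M s z' = endpt 0 m s z \<and> cost M z' = cost m z"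
    using assms
  proof (induction M rule: dec_induct)
    case base
    show ?case by (rule exI[of _ z]) simp
  next
    case (step M)
    then obtain z' where "endpt 0 M s z' = endpt 0 m s z" "cost M z' = cost m z" by blast
    then show ?case by (intro exI[of _ "case_nat (\<lambda>i. 0) z'"]) (simp add: endpt_pad cost_pad)
  qed
  then show ?thesis using that by blast
qed

lemma reach_mono: "m \<le> M \<Longrightarrow> c \<le> c' \<Longrightarrow> reach m c \<subseteq> reach M c'"
proof
  fix u assume le: "m \<le> M" "c \<le> c'" and "u \<in> reach m c"
  then obtain s z where u: "u = endpt 0 m s z" "0 \<le> s" "s \<le> \<tau>" "cost m z \<le> c"
    by (auto simp: reach_def)
  obtain z' where "endpt 0 M s z' = endpt 0 m s z" "cost M z' = cost m z"
    using pad_exists[OF le(1)] .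
  then show "u \<in> reach M c'"
    using u le unfolding reach_def by (intro CollectI exI[of _ s] exI[of _ z']) auto
qed

text \<open>For \<open>s = 0\<close> the end point is a grid value, hence also the end of a full
  last step with one block fewer. If there is no such block, it is the origin, which zero noise
  reaches.\<close>

lemma qpot_endpt_le:
  assumes "0 \<le> s" "s \<le> \<tau>"
  shows "qpot (endpt 0 m s z) \<le> ereal (cost m z)"
proof (cases "s = 0")
  case False
  then show ?thesis unfolding qpot_def using assms
    by (intro Inf_lower CollectI exI[of _ m] exI[of _ s] exI[of _ z]) auto
next
  case True
  show ?thesis
  proof (cases m)
    case 0
    have "endpt 0 m s z = endpt 0 0 \<tau> (\<lambda>_ _. 0)" using True 0 by (simp add: endpt_def)
    then have "qpot (endpt 0 m s z) \<le> ereal (cost 0 (\<lambda>_ _. 0))"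
      unfolding qpot_def using tau by (intro Inf_lower CollectI exI[of _ 0] exI[of _ \<tau>] exI[of _ "\<lambda>_ _. 0"]) auto
    also have "\<dots> \<le> ereal (cost m z)" using cost_nonneg[of m z] by (simp add: cost_def sqsum_def)
    finally show ?thesis .
  next
    case (Suc m')
    have "endpt 0 m s z = endpt 0 m' \<tau> z" using True Suc
      by (simp add: endpt_def stepmap_id add_in_Hn chain_in_Hn)
    then have "qpot (endpt 0 m s z) \<le> ereal (cost m' z)"
      unfolding qpot_def using tau by (intro Inf_lower CollectI exI[of _ m'] exI[of _ \<tau>] exI[of _ z]) auto
    also have "\<dots> \<le> ereal (cost m z)" using Suc by (simp add: cost_def sqsum_nonneg)
    finally show ?thesis .
  qed
qed

lemma qpot_nonneg: "0 \<le> qpot u"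
  unfolding qpot_def by (rule Inf_greatest) (auto simp: cost_nonneg)

lemma qpot_lessE:
  assumes "qpot u < ereal c"
  obtains m s z where "0 < s" "s \<le> \<tau>" "endpt 0 m s z = u" "cost m z < c"
proof -
  obtain x where x: "x \<in> {ereal (cost m z) | m s z. 0 < s \<and> s \<le> \<tau> \<and> endpt 0 m s z = u}" "x < ereal c"
    using assms unfolding qpot_def Inf_less_iff by blast
  from x(1) obtain m s z where "x = ereal (cost m z)" "0 < s" "s \<le> \<tau>" "endpt 0 m s z = u" by blast
  with x(2) show ?thesis by (intro that) simp_all
qed

definition jump_bd :: real where
  "jump_bd = (\<Sum>i=1..n. 1 / (sd \<tau> i)\<^sup>2)"

text \<open>The noise vector that carries the chain from 0 to \<open>x\<close> in one full step. It
  exists since every \<open>sd \<tau> i\<close> with \<open>i \<ge> 1\<close> is positive and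
  \<open>stepmap\<close> fixes 0.\<close>

definition jump :: "L2 \<Rightarrow> nat \<Rightarrow> real" where
  "jump x i = inner x (eb i) / sd \<tau> i"

lemma kick_jump: "x \<in> Hn n \<Longrightarrow> kick \<tau> (jump x) = x"
proof -
  assume x: "x \<in> Hn n"
  have "kick \<tau> (jump x) = (\<Sum>i=1..n. inner x (eb i) *\<^sub>R eb i)"
    unfolding kick_def jump_def using sd_pos[OF tau] by (intro sum.cong) (auto simp: less_imp_neq[symmetric])
  then show ?thesis using Hn_expand[OF x] by simp
qed

lemma sqsum_jump: "sqsum n (jump x) \<le> jump_bd * (norm x)\<^sup>2"
proof -
  have "sqsum n (jump x) \<le> (\<Sum>i=1..n. 1 / (sd \<tau> i)\<^sup>2 * (norm x)\<^sup>2)"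
    unfolding sqsum_def jump_def
  proof (intro sum_mono)
    fix i assume i: "i \<in> {1..n}"
    have "(inner x (eb i))\<^sup>2 \<le> (\<Sum>i=1..n. (inner x (eb i))\<^sup>2)"
      using i by (intro member_le_sum) auto
    also have "\<dots> \<le> (norm x)\<^sup>2" by (rule bessel)
    finally show "(inner x (eb i) / sd \<tau> i)\<^sup>2 \<le> 1 / (sd \<tau> i)\<^sup>2 * (norm x)\<^sup>2"
      by (simp add: power_divide divide_right_mono)
  qed
  then show ?thesis by (simp add: jump_bd_def sum_distrib_right)
qed

lemma jump_bd_nonneg: "0 \<le> jump_bd"
  by (simp add: jump_bd_def sum_nonneg)

text \<open>A path of bounded cost must come close to the origin within a bounded number of steps before
  its end; restarting it there with one cheap jump from \<open>0\<close> makes the horizon uniform.\<close>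

lemma sublevel_subset_reach:
  assumes "0 \<le> a" "a < b"
  obtains M where "{u. qpot u \<le> ereal a} \<subseteq> reach M b"
proof -
  \<comment> \<open>The budget \<open>b\<close> is split: the given path costs less than
    \<open>a'\<close>, and \<open>b - a'\<close> remains for the jump.\<close>
  define a' where "a' = (a + b) / 2"
  have a': "a < a'" "a' < b" "0 < a'" using assms by (auto simp: a'_def)
  define C where "C = jump_bd * (noise_bd * (2 * a') / (1 - \<rho>))"
  have C: "0 \<le> C" unfolding C_def using jump_bd_nonneg noise_bd_nonneg rho a' by simp
  \<comment> \<open>With \<open>M\<close> grid values of bounded total squared norm, one has squared
    norm at most a constant over \<open>M\<close>. This \<open>M\<close> makes the corresponding
    jump fit into \<open>b - a'\<close>.\<close>
  obtain M :: nat where M: "C / (b - a') < real M" using reals_Archimedean2 by blast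
  then have M0: "0 < M" using C a' by (metis diff_gt_0_iff_gt divide_nonneg_pos not_gr_zero not_less of_nat_0)
  have MC: "C \<le> (b - a') * real M" using M a' by (simp add: pos_divide_less_eq mult.commute)
  have "u \<in> reach M b" if "qpot u \<le> ereal a" for u
  proof -
    have "qpot u < ereal a'" using that a' by (simp add: order_le_less_trans)
    then obtain m s z0 where 0: "0 < s" "s \<le> \<tau>" "endpt 0 m s z0 = u" "cost m z0 < a'"
      by (rule qpot_lessE)
    \<comment> \<open>Padding guarantees that there are \<open>M\<close> last grid indices to choose
      from, even when the original path was short.\<close>
    obtain z where "endpt 0 (m + M) s z = endpt 0 m s z0" "cost (m + M) z = cost m z0"
      by (rule pad_exists[of m "m + M" s z0]) auto
    with 0 have z: "endpt 0 (m + M) s z = u" "cost (m + M) z < a'" by auto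
    let ?K = "m + M"
    define D where "D = noise_bd * (2 * a') / (1 - \<rho>)"
    have "\<exists>k\<in>{m + 1..m + M}. real M * (norm (chain 0 z k))\<^sup>2 \<le> D"
    proof (rule ccontr)
      assume "\<not> (\<exists>k\<in>{m + 1..m + M}. real M * (norm (chain 0 z k))\<^sup>2 \<le> D)"
      then have neg: "D < real M * (norm (chain 0 z k))\<^sup>2" if "k \<in> {m + 1..m + M}" for k
        using that not_le by blast
      have "real M * D = (\<Sum>k\<in>{m + 1..m + M}. D)" by simp
      also have "\<dots> < (\<Sum>k\<in>{m + 1..m + M}. real M * (norm (chain 0 z k))\<^sup>2)"
        using neg M0 by (intro sum_strict_mono) auto
      also have "\<dots> = real M * (\<Sum>k\<in>{m + 1..m + M}. (norm (chain 0 z k))\<^sup>2)"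
        by (rule sum_distrib_left[symmetric])
      finally have "D < (\<Sum>k\<in>{m + 1..m + M}. (norm (chain 0 z k))\<^sup>2)"
        using M0 by simp
      also have "\<dots> \<le> (\<Sum>k\<le>?K. (norm (chain 0 z k))\<^sup>2)"
        by (intro sum_mono2) auto
      also have "\<dots> \<le> noise_bd * (\<Sum>k<?K. sqsum n (z k)) / (1 - \<rho>)"
      proof -
        have "0 \<le> \<rho> * (norm (chain 0 z ?K))\<^sup>2" using rho by simp
        then have "(\<Sum>k\<le>?K. (norm (chain 0 z k))\<^sup>2) * (1 - \<rho>) \<le> noise_bd * (\<Sum>k<?K. sqsum n (z k))"
          using chain_sq_sum_bound[of z ?K] by (simp only: mult.commute[of _ "1 - \<rho>"])
        then show ?thesis using rho by (simp only: pos_le_divide_eq diff_gt_0_iff_gt)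
      qed
      also have "\<dots> \<le> D"
      proof -
        have "(\<Sum>k<?K. sqsum n (z k)) \<le> 2 * a'"
          using z(2) sqsum_nonneg[of n "z ?K"] by (simp add: cost_def lessThan_Suc_atMost[symmetric])
        then show ?thesis unfolding D_def
          using rho noise_bd_nonneg by (intro divide_right_mono mult_left_mono) auto
      qed
      finally show False by simp
    qed
    then obtain k where k: "k \<in> {m + 1..m + M}" "real M * (norm (chain 0 z k))\<^sup>2 \<le> D" by blast
    define x where "x = chain 0 z k"
    have x: "x \<in> Hn n" by (simp add: x_def chain_in_Hn)
    \<comment> \<open>One jump from 0 to \<open>x\<close>, then the old noise from index
      \<open>k\<close> on. Since \<open>k \<ge> m + 1\<close>, at most \<open>M\<close> full steps
      result, jump included.\<close>
    define z' where "z' = case_nat (jump x) (\<lambda>i. z (k + i))"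
    have "endpt 0 (Suc (?K - k)) s z' = endpt (chain 0 z' 1) (?K - k) s (\<lambda>i. z' (1 + i))"
      using endpt_shift[of 0 1 "?K - k" s z'] by (simp only: plus_1_eq_Suc)
    also have "chain 0 z' 1 = x" using kick_jump[OF x] by (simp add: z'_def One_nat_def)
    also have "(\<lambda>i. z' (1 + i)) = (\<lambda>i. z (k + i))" by (simp only: z'_def plus_1_eq_Suc nat.case)
    also have "endpt x (?K - k) s (\<lambda>i. z (k + i)) = u"
      using endpt_shift[of 0 k "?K - k" s z] k z by (simp add: x_def)
    finally have e: "endpt 0 (Suc (?K - k)) s z' = u" .
    have "real M * sqsum n (jump x) \<le> jump_bd * (real M * (norm x)\<^sup>2)"
      using mult_left_mono[OF sqsum_jump[of x], of "real M"] by (simp add: mult_ac)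
    also have "\<dots> \<le> C" unfolding C_def D_def[symmetric] using k jump_bd_nonneg by (intro mult_left_mono) (auto simp: x_def)
    finally have "real M * sqsum n (jump x) \<le> real M * (b - a')" using MC by (simp add: mult.commute)
    then have j: "sqsum n (jump x) \<le> b - a'" using M0 by simp
    have "(\<Sum>i\<le>?K - k. sqsum n (z (k + i))) = (\<Sum>i\<in>{k..?K}. sqsum n (z i))"
      using k by (intro sum.reindex_bij_witness[of _ "\<lambda>i. i - k" "\<lambda>i. k + i"]) auto
    also have "\<dots> \<le> (\<Sum>i\<le>?K. sqsum n (z i))" by (intro sum_mono2) (auto simp: sqsum_nonneg)
    finally have "cost (?K - k) (\<lambda>i. z (k + i)) \<le> cost ?K z" by (simp add: cost_def)
    then have "cost (Suc (?K - k)) z' \<le> b"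
      using j z(2) a' sqsum_nonneg[of n "jump x"] by (simp add: cost_Suc z'_def)
    then have "u \<in> reach (Suc (?K - k)) b"
      using e 0 unfolding reach_def by (intro CollectI exI[of _ s] exI[of _ z']) auto
    also have "reach (Suc (?K - k)) b \<subseteq> reach M b" using k by (intro reach_mono) auto
    finally show ?thesis .
  qed
  then show ?thesis using that[of M] by auto
qed

lemma reach_subset_sublevel: "reach m c \<subseteq> {u. qpot u \<le> ereal c}"
proof
  fix u assume "u \<in> reach m c"
  then obtain s z where u: "u = endpt 0 m s z" "0 \<le> s" "s \<le> \<tau>" "cost m z \<le> c"
    by (auto simp: reach_def)
  have "qpot u \<le> ereal (cost m z)" unfolding u(1) by (rule qpot_endpt_le[OF u(2,3)])
  then show "u \<in> {u. qpot u \<le> ereal c}" using u(4) by (simp add: order_trans[of _ "ereal (cost m z)"])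
qed

text \<open>A sublevel set is squeezed between reachable sets with arbitrarily little extra budget.
  It therefore equals the intersection over all budgets \<open>b > a\<close>, which requires no
  minimiser.\<close>

lemma compact_sublevel:
  assumes "0 \<le> a"
  shows "compact {u. qpot u \<le> ereal a}"
proof -
  have "\<exists>M. {u. qpot u \<le> ereal a} \<subseteq> reach M b" if "a < b" for b
    using sublevel_subset_reach[OF assms that] by metis
  then obtain M where M: "\<And>b. a < b \<Longrightarrow> {u. qpot u \<le> ereal a} \<subseteq> reach (M b) b" by metis
  have "{u. qpot u \<le> ereal a} = (\<Inter>b\<in>{a<..}. reach (M b) b)"
  proof
    show "{u. qpot u \<le> ereal a} \<subseteq> (\<Inter>b\<in>{a<..}. reach (M b) b)" using M by auto
    show "(\<Inter>b\<in>{a<..}. reach (M b) b) \<subseteq> {u. qpot u \<le> ereal a}"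
    proof
      fix u assume u: "u \<in> (\<Inter>b\<in>{a<..}. reach (M b) b)"
      have "qpot u \<le> ereal b" if "a < b" for b using u that reach_subset_sublevel by auto
      then have "qpot u \<le> ereal a"
        by (metis ereal_dense2 ereal_less(2) less_ereal.simps(1) not_le)
      then show "u \<in> {u. qpot u \<le> ereal a}" by simp
    qed
  qed
  moreover have "compact (\<Inter>b\<in>{a<..}. reach (M b) b)"
  proof -
    have c: "compact (reach (M b) b)" if "a < b" for b using assms that by (intro compact_reach) simp
    have "compact (reach (M (a + 1)) (a + 1) \<inter> (\<Inter>b\<in>{a<..}. reach (M b) b))"
      using c by (intro compact_Int_closed closed_INT) (auto intro: compact_imp_closed)
    moreover have "reach (M (a + 1)) (a + 1) \<inter> (\<Inter>b\<in>{a<..}. reach (M b) b) = (\<Inter>b\<in>{a<..}. reach (M b) b)"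
      by (rule Int_absorb1) (auto intro: INT_lower)
    ultimately show ?thesis by simp
  qed
  ultimately show ?thesis by simp
qed

end

section \<open>The quasi-potential as a discrete minimisation\<close>

lemma measurable_eb_sum:
  assumes "\<And>i. i \<in> {1..n} \<Longrightarrow> c i \<in> borel_measurable M"
  shows "(\<lambda>r. \<Sum>i=1..n. c i r *\<^sub>R eb i) \<in> measurable M (restrict_space borel (Hn n))"
proof (rule measurable_restrict_space2)
  define c' where "c' r i = (if i \<in> {1..n} then c i r else 0)" for r i
  have m: "c' \<in> borel_measurable M"
  proof (rule measurable_coordinatewise_then_product)
    fix i show "(\<lambda>r. c' r i) \<in> borel_measurable M"
      using assms by (cases "i \<in> {1..n}") (auto simp: c'_def)
  qed
  \<comment> \<open>The sum is a continuous function of the coefficient sequence, so measurability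
    is only checked coordinatewise for real functions.\<close>
  have "continuous_on UNIV (\<lambda>x::nat \<Rightarrow> real. \<Sum>i=1..n. x i *\<^sub>R eb i)"
    by (intro continuous_intros continuous_on_product_coordinates)
  then have "(\<lambda>x::nat \<Rightarrow> real. \<Sum>i=1..n. x i *\<^sub>R eb i) \<in> borel_measurable borel"
    by (rule borel_measurable_continuous_onI)
  from measurable_compose[OF m this] show "(\<lambda>r. \<Sum>i=1..n. c i r *\<^sub>R eb i) \<in> borel_measurable M"
    unfolding c'_def by (rule measurable_cong[THEN iffD1, rotated]) (auto intro!: sum.cong)
qed (simp add: eb_sum_in_Hn)

text \<open>Integrate the square of \<open>\<phi> - (d / s) * g\<close>; the multiplier
  \<open>d / s\<close> is the optimal one.\<close>

lemma has_integral_cauchy_schwarz: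
  fixes g \<phi> :: "real \<Rightarrow> real"
  assumes g: "((\<lambda>r. (g r)\<^sup>2) has_integral s) S" and s: "0 < s"
    and d: "((\<lambda>r. g r * \<phi> r) has_integral d) S"
    and p: "((\<lambda>r. (\<phi> r)\<^sup>2) has_integral c) S"
  shows "d\<^sup>2 / s \<le> c"
proof -
  have "((\<lambda>r. ((\<phi> r)\<^sup>2 - (2 * d / s) * (g r * \<phi> r)) + (d / s)\<^sup>2 * (g r)\<^sup>2) has_integral
      ((c - (2 * d / s) * d) + (d / s)\<^sup>2 * s)) S"
    by (intro has_integral_add has_integral_diff has_integral_mult_right assms)
  moreover have "((\<phi> r)\<^sup>2 - (2 * d / s) * (g r * \<phi> r)) + (d / s)\<^sup>2 * (g r)\<^sup>2 = (\<phi> r - (d / s) * g r)\<^sup>2" for r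
    by (simp add: power2_eq_square algebra_simps)
  ultimately have "((\<lambda>r. (\<phi> r - (d / s) * g r)\<^sup>2) has_integral ((c - (2 * d / s) * d) + (d / s)\<^sup>2 * s)) S"
    by (simp only:)
  then have "0 \<le> (c - (2 * d / s) * d) + (d / s)\<^sup>2 * s"
    by (rule has_integral_nonneg) simp
  also have "\<dots> = c - d\<^sup>2 / s" using s by (simp add: field_simps power2_eq_square)
  finally show ?thesis by simp
qed

lemma grid_eq:
  assumes "0 < \<tau>" "real k * \<tau> \<le> r" "r < real (Suc k) * \<tau>"
  shows "grid \<tau> r = real k * \<tau>" "nat \<lfloor>r / \<tau>\<rfloor> = k"
proof -
  have "\<lfloor>r / \<tau>\<rfloor> = int k"
    using assms by (intro floor_unique) (auto simp: field_simps)
  then show "grid \<tau> r = real k * \<tau>" "nat \<lfloor>r / \<tau>\<rfloor> = k" by (auto simp: grid_def)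
qed

text \<open>Rounding up and subtracting 1 puts the remainder into the interval from 0 (excluded) to
  \<tau> (included): a multiple of \<tau> ends with a full step, never with an empty one.\<close>

lemma horizon_cases:
  assumes "0 < \<tau>" "0 < (T::real)"
  obtains m :: nat and s where "0 < s" "s \<le> \<tau>" "T = real m * \<tau> + s"
proof -
  define m where "m = nat (\<lceil>T / \<tau>\<rceil> - 1)"
  have "1 \<le> \<lceil>T / \<tau>\<rceil>" using assms by (simp add: one_le_ceiling)
  then have m: "real m = of_int \<lceil>T / \<tau>\<rceil> - 1" by (simp add: m_def)
  have "real m < T / \<tau>" "T / \<tau> \<le> real m + 1"
    using ceiling_correct[of "T / \<tau>"] unfolding m by linarith+
  then have "real m * \<tau> < T" "T \<le> real m * \<tau> + \<tau>"
    using assms by (simp_all add: field_simps)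
  then show ?thesis by (intro that[of "T - real m * \<tau>" m]) auto
qed

lemma exp_rev_has_integral:
  fixes a b l :: real
  assumes "a \<le> b" "l \<noteq> 0"
  shows "((\<lambda>r. exp (- l * (b - r))) has_integral ((1 - exp (- l * (b - a))) / l)) {a..b}"
proof -
  have "((\<lambda>r. exp (- l * (b - r))) has_integral (exp (- l * (b - b)) / l - exp (- l * (b - a)) / l)) {a..b}"
    using assms by (intro fundamental_theorem_of_calculus)
      (auto intro!: derivative_eq_intros simp: has_real_derivative_iff_has_vector_derivative[symmetric])
  then show ?thesis by (simp add: diff_divide_distrib)
qed

locale aee_noise = aee +
  fixes Qh :: "L2 \<Rightarrow> L2"
  assumes Qh_sa: "self_adjoint Qh" and Qh_lin: "bounded_linear Qh"
    and Qh_eb: "\<And>i. i \<ge> 1 \<Longrightarrow> Qh (eb i) = sqrt (q i) *\<^sub>R eb i"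
begin

section \<open>From controls to noise sequences\<close>

lemma inner_Qh: "i \<ge> 1 \<Longrightarrow> inner (Qh u) (eb i) = sqrt (q i) * inner u (eb i)"
  using Qh_sa Qh_eb[of i] by (simp add: self_adjoint_def)

lemma skeleton_integral_iff:
  assumes "z t \<in> Hn n"
  shows "((\<lambda>s. Sn n (t - s) (Pn n (F (z (grid \<tau> s))) + Pn n (Qh (\<phi> s)))) has_integral (z t - Sn n t 0)) {0..t}
     \<longleftrightarrow> (\<forall>i\<in>{1..n}. ((\<lambda>s. exp (- lam i * (t - s)) * (inner (F (z (grid \<tau> s))) (eb i) + sqrt (q i) * inner (\<phi> s) (eb i)))
           has_integral inner (z t) (eb i)) {0..t})" (is "?A \<longleftrightarrow> ?B")
proof -
  have S0: "Sn n t 0 = 0" by (simp add: Sn_def)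
  have S: "Sn n (t - s) (Pn n (F (z (grid \<tau> s))) + Pn n (Qh (\<phi> s))) = (\<Sum>i=1..n.
      (exp (- lam i * (t - s)) * (inner (F (z (grid \<tau> s))) (eb i) + sqrt (q i) * inner (\<phi> s) (eb i))) *\<^sub>R eb i)" for s
    unfolding Sn_def by (intro sum.cong refl) (simp add: inner_add_left inner_Pn inner_Qh)
  show ?thesis
  proof
    assume A: ?A
    show ?B
    proof
      fix i assume i: "i \<in> {1..n}"
      show "((\<lambda>s. exp (- lam i * (t - s)) * (inner (F (z (grid \<tau> s))) (eb i) + sqrt (q i) * inner (\<phi> s) (eb i)))
           has_integral inner (z t) (eb i)) {0..t}"
        using has_integral_linear[OF A[unfolded S S0] bounded_linear_inner_left[of "eb i"]]
        by (simp only: o_def inner_eb_sum[OF i] diff_zero)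
    qed
  next
    assume B: ?B
    have "((\<lambda>s. (exp (- lam i * (t - s)) * (inner (F (z (grid \<tau> s))) (eb i) + sqrt (q i) * inner (\<phi> s) (eb i))) *\<^sub>R eb i)
        has_integral (inner (z t) (eb i) *\<^sub>R eb i)) {0..t}" if "i \<in> {1..n}" for i
      using has_integral_linear[OF B[rule_format, OF that] bounded_linear_scaleR_left[of "eb i"]]
      by (simp only: o_def)
    then have "((\<lambda>s. \<Sum>i=1..n. (exp (- lam i * (t - s)) * (inner (F (z (grid \<tau> s))) (eb i) + sqrt (q i) * inner (\<phi> s) (eb i))) *\<^sub>R eb i)
        has_integral (\<Sum>i=1..n. inner (z t) (eb i) *\<^sub>R eb i)) {0..t}"
      by (intro has_integral_sum) auto
    then show ?A unfolding S S0 Hn_expand[OF assms, symmetric] diff_zero .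
  qed
qed

lemma stepmap_coord: "i \<in> {1..n} \<Longrightarrow> inner (stepmap h x) (eb i) =
    exp (- lam i * h) * inner x (eb i) + (1 - exp (- lam i * h)) / lam i * inner (F x) (eb i)"
  unfolding stepmap_def by (rule inner_eb_sum)

lemma kick_coord: "i \<in> {1..n} \<Longrightarrow> inner (kick h z) (eb i) = sd h i * z i"
  unfolding kick_def by (rule inner_eb_sum)

lemma Hn_eqI:
  assumes "x \<in> Hn n" "y \<in> Hn n" "\<And>i. i \<in> {1..n} \<Longrightarrow> inner x (eb i) = inner y (eb i)"
  shows "x = y"
  using Hn_expand[OF assms(1)] Hn_expand[OF assms(2)] assms(3) by simp

text \<open>Within a step the nonlinearity is constant, so the deviation from \<open>stepmap\<close>
  is, mode by mode, an integral of the control against an exponential kernel of squared norm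
  \<open>(sd h i)^2\<close>. Cauchy-Schwarz bounds the normalised deviation by the energy of the
  control.\<close>

lemma skeleton_step:
  assumes sk: "skeleton_mild F Qh n \<tau> T 0 \<phi> z" and h: "0 < h" "h \<le> \<tau>" "real k * \<tau> + h \<le> T"
    and p: "\<And>i. i \<in> {1..n} \<Longrightarrow> (\<lambda>r. (inner (\<phi> r) (eb i))\<^sup>2) integrable_on {0..T}"
  shows "\<exists>\<zeta>. z (real k * \<tau> + h) = stepmap h (z (real k * \<tau>)) + kick h \<zeta> \<and>
     sqsum n \<zeta> \<le> (\<Sum>i=1..n. integral {real k * \<tau>..real k * \<tau> + h} (\<lambda>r. (inner (\<phi> r) (eb i))\<^sup>2))"
proof -
  define a where "a = real k * \<tau>"
  have a: "0 \<le> a" "a + h \<le> T" using tau h by (auto simp: a_def)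
  define g where "g i r = inner (F (z (grid \<tau> r))) (eb i) + sqrt (q i) * inner (\<phi> r) (eb i)" for i r
  have zH: "z t \<in> Hn n" if "t \<in> {0..T}" for t
    using sk that by (auto simp: skeleton_mild_def)
  have I: "((\<lambda>s. exp (- lam i * (t - s)) * g i s) has_integral inner (z t) (eb i)) {0..t}"
    if "t \<in> {0..T}" "i \<in> {1..n}" for t i
    using sk that skeleton_integral_iff[where z = z and \<phi> = \<phi>, OF zH[OF that(1)]]
    unfolding skeleton_mild_def g_def by blast
  define \<zeta> where "\<zeta> i = inner (z (a + h) - stepmap h (z a)) (eb i) / sd h i" for i
  have sd0: "sd h i \<noteq> 0" if "i \<in> {1..n}" for i using sd_pos[OF h(1), of i] that by auto
  have "z (a + h) = stepmap h (z a) + kick h \<zeta>"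
  proof (rule Hn_eqI)
    fix i assume "i \<in> {1..n}"
    then show "inner (z (a + h)) (eb i) = inner (stepmap h (z a) + kick h \<zeta>) (eb i)"
      by (simp add: inner_add_left kick_coord \<zeta>_def sd0 inner_diff_left)
  qed (use a h zH in \<open>auto intro!: add_in_Hn\<close>)
  moreover have "sqsum n \<zeta> \<le> (\<Sum>i=1..n. integral {a..a + h} (\<lambda>r. (inner (\<phi> r) (eb i))\<^sup>2))"
    unfolding sqsum_def
  proof (rule sum_mono)
    fix i assume i: "i \<in> {1..n}"
    then have i1: "i \<ge> 1" by simp
    note l = lam_pos[OF i1] lam_nz[OF i1]
    define w where "w r = exp (- lam i * (a + h - r))" for r
    define f where "f = inner (F (z a)) (eb i)"
    have I1: "((\<lambda>r. w r * g i r) has_integral inner (z (a + h)) (eb i)) {0..a + h}"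
      using I[of "a + h" i] a h i by (simp add: w_def)
    \<comment> \<open>Multiplying the equation at time \<open>a\<close> by
      \<open>exp (- lam i * h)\<close> turns its kernel into that of time \<open>a + h\<close>, so
      subtraction leaves the integral over one step.\<close>
    have I0: "((\<lambda>r. exp (- lam i * h) * (exp (- lam i * (a - r)) * g i r)) has_integral exp (- lam i * h) * inner (z a) (eb i)) {0..a}"
      using I[of a i] a h i by (intro has_integral_mult_right) auto
    have "(\<lambda>r. exp (- lam i * h) * (exp (- lam i * (a - r)) * g i r)) = (\<lambda>r. w r * g i r)"
      by (simp add: w_def mult.assoc[symmetric] exp_add[symmetric] algebra_simps)
    with I0 have I0': "((\<lambda>r. w r * g i r) has_integral exp (- lam i * h) * inner (z a) (eb i)) {0..a}" by simp
    have "(\<lambda>r. w r * g i r) integrable_on {a..a + h}"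
      by (rule integrable_subinterval_real[OF has_integral_integrable[OF I1]]) (use a h in auto)
    then obtain J where J: "((\<lambda>r. w r * g i r) has_integral J) {a..a + h}" by blast
    have "inner (z (a + h)) (eb i) = exp (- lam i * h) * inner (z a) (eb i) + J"
      by (rule has_integral_unique[OF I1 has_integral_combine[OF _ _ I0' J]]) (use a h in auto)
    moreover have W: "(w has_integral (1 - exp (- lam i * h)) / lam i) {a..a + h}"
      using exp_rev_has_integral[of a "a + h" "lam i"] h l unfolding w_def by simp
    have W2: "((\<lambda>r. (sqrt (q i) * w r)\<^sup>2) has_integral (sd h i)\<^sup>2) {a..a + h}"
    proof -
      have "((\<lambda>r. q i * exp (- (2 * lam i) * (a + h - r))) has_integral q i * ((1 - exp (- (2 * lam i) * (a + h - a))) / (2 * lam i))) {a..a + h}"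
        using h l by (intro has_integral_mult_right exp_rev_has_integral) auto
      moreover have "q i * ((1 - exp (- (2 * lam i) * (a + h - a))) / (2 * lam i)) = (sd h i)\<^sup>2"
        using h by (subst sd_sq[OF _ i1]) auto
      moreover have "q i * exp (- (2 * lam i) * (a + h - r)) = (sqrt (q i) * w r)\<^sup>2" for r
        using qpos[OF i1] exp_double[of "- lam i * (a + h - r)"] by (simp add: w_def power_mult_distrib mult.assoc)
      ultimately show ?thesis by simp
    qed
    \<comment> \<open>For \<open>h = \<tau>\<close> the right end point already belongs to the next
      grid cell; it is removed as a null set.\<close>
    have fc: "g i r = f + sqrt (q i) * inner (\<phi> r) (eb i)" if "r \<in> {a..a + h} - {a + h}" for r
      using that h grid_eq(1)[OF tau, of k r] by (auto simp: g_def f_def a_def algebra_simps)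
    have "((\<lambda>r. w r * (f + sqrt (q i) * inner (\<phi> r) (eb i))) has_integral J) {a..a + h}"
      by (rule has_integral_spike[OF _ _ J, of "{a + h}"]) (use fc in auto)
    from has_integral_diff[OF this has_integral_mult_left[OF W, of f]]
    have "((\<lambda>r. (sqrt (q i) * w r) * inner (\<phi> r) (eb i)) has_integral (J - (1 - exp (- lam i * h)) / lam i * f)) {a..a + h}"
      by (simp add: algebra_simps)
    moreover have "((\<lambda>r. (inner (\<phi> r) (eb i))\<^sup>2) has_integral integral {a..a + h} (\<lambda>r. (inner (\<phi> r) (eb i))\<^sup>2)) {a..a + h}"
      by (rule integrable_integral, rule integrable_subinterval_real[OF p[OF i]]) (use a h in auto)
    ultimately have "(J - (1 - exp (- lam i * h)) / lam i * f)\<^sup>2 / (sd h i)\<^sup>2 \<le> integral {a..a + h} (\<lambda>r. (inner (\<phi> r) (eb i))\<^sup>2)"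
      using sd0[OF i] by (intro has_integral_cauchy_schwarz[OF W2]) auto
    moreover have "\<zeta> i = (J - (1 - exp (- lam i * h)) / lam i * f) / sd h i"
      unfolding \<zeta>_def inner_diff_left stepmap_coord[OF i]
      using \<open>inner (z (a + h)) (eb i) = exp (- lam i * h) * inner (z a) (eb i) + J\<close> by (simp add: f_def)
    ultimately show "(\<zeta> i)\<^sup>2 \<le> integral {a..a + h} (\<lambda>r. (inner (\<phi> r) (eb i))\<^sup>2)"
      by (simp add: power_divide)
  qed
  ultimately show ?thesis by (auto simp: a_def)
qed

end

lemma nonneg_has_integral_lebesgue_on:
  fixes f :: "real \<Rightarrow> real"
  assumes "(f has_integral c) {0..T}" "\<And>r. 0 \<le> f r"
  shows "integrable (lebesgue_on {0<..<T}) f" "integral\<^sup>L (lebesgue_on {0<..<T}) f = c"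
proof -
  have "f absolutely_integrable_on {0..T}"
    using assms by (intro nonnegative_absolutely_integrable_1) auto
  then have "f absolutely_integrable_on {0<..<T}"
    by (rule set_integrable_subset) auto
  then show i: "integrable (lebesgue_on {0<..<T}) f"
    by (simp add: integrable_restrict_space set_integrable_def)
  then have "integral\<^sup>L (lebesgue_on {0<..<T}) f = integral {0<..<T} f"
    by (intro lebesgue_integral_eq_integral) auto
  then show "integral\<^sup>L (lebesgue_on {0<..<T}) f = c"
    using assms(1) integral_unique[of f c "{0<..<T}"] by (simp add: has_integral_Icc_iff_Ioo)
qed

context aee_noise
begin

lemma control_coord_integrable:
  assumes "\<phi> \<in> L2_controls n T"
  shows "integrable (lebesgue_on {0<..<T}) (\<lambda>r. (inner (\<phi> r) (eb i))\<^sup>2)"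
    "(\<lambda>r. (inner (\<phi> r) (eb i))\<^sup>2) integrable_on {0..T}"
proof -
  have m: "\<phi> \<in> measurable (lebesgue_on {0<..<T}) borel"
    using assms measurable_restrict_space2_iff by (auto simp: L2_controls_def)
  have "continuous_on UNIV (\<lambda>x::L2. (inner x (eb i))\<^sup>2)" by (intro continuous_intros)
  from measurable_compose[OF m borel_measurable_continuous_onI[OF this]]
  have m2: "(\<lambda>r. (inner (\<phi> r) (eb i))\<^sup>2) \<in> borel_measurable (lebesgue_on {0<..<T})" .
  show i: "integrable (lebesgue_on {0<..<T}) (\<lambda>r. (inner (\<phi> r) (eb i))\<^sup>2)"
  proof (rule Bochner_Integration.integrable_bound[OF _ m2])
    show "integrable (lebesgue_on {0<..<T}) (\<lambda>r. (norm (\<phi> r))\<^sup>2 * (norm (eb i))\<^sup>2)"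
      using assms by (auto simp: L2_controls_def)
    show "AE r in lebesgue_on {0<..<T}. norm ((inner (\<phi> r) (eb i))\<^sup>2) \<le> norm ((norm (\<phi> r))\<^sup>2 * (norm (eb i))\<^sup>2)"
    proof (rule AE_I2)
      fix r
      have "\<bar>inner (\<phi> r) (eb i)\<bar>\<^sup>2 \<le> (norm (\<phi> r) * norm (eb i))\<^sup>2"
        using Cauchy_Schwarz_ineq2 by (intro power_mono) auto
      then show "norm ((inner (\<phi> r) (eb i))\<^sup>2) \<le> norm ((norm (\<phi> r))\<^sup>2 * (norm (eb i))\<^sup>2)"
        by (simp add: power_mult_distrib)
    qed
  qed
  show "(\<lambda>r. (inner (\<phi> r) (eb i))\<^sup>2) integrable_on {0..T}"
    using integrable_on_lebesgue_on[OF i] integrable_on_Icc_iff_Ioo by auto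
qed

text \<open>Block by block, \<open>skeleton_step\<close> converts the control into noise; the
  energies add up over the blocks, and Bessel's inequality returns to the full norm.\<close>

lemma qpot_le_control:
  assumes T: "0 < T" and c: "\<phi> \<in> L2_controls n T" and sk: "skeleton_mild F Qh n \<tau> T 0 \<phi> z" and z0: "z 0 = 0"
  shows "qpot (z T) \<le> ereal (integral\<^sup>L (lebesgue_on {0<..<T}) (\<lambda>r. (norm (\<phi> r))\<^sup>2) / 2)"
proof -
  obtain m s where s: "0 < s" "s \<le> \<tau>" "T = real m * \<tau> + s" by (rule horizon_cases[OF tau T])
  define h where "h k = (if k < m then \<tau> else s)" for k
  define \<Phi> where "\<Phi> r = (\<Sum>i=1..n. (inner (\<phi> r) (eb i))\<^sup>2)" for r
  have pi: "(\<lambda>r. (inner (\<phi> r) (eb i))\<^sup>2) integrable_on {0..T}" for i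
    by (rule control_coord_integrable(2)[OF c])
  have Pi: "\<Phi> integrable_on {0..T}" unfolding \<Phi>_def by (intro integrable_sum pi) auto
  have end_le: "real k * \<tau> + h k \<le> T" if "k \<le> m" for k
  proof (cases "k < m")
    case True
    then have "real (Suc k) * \<tau> \<le> real m * \<tau>" using tau by (intro mult_right_mono) auto
    then show ?thesis using True s by (simp add: h_def algebra_simps)
  qed (use s that in \<open>auto simp: h_def\<close>)
  have hp: "0 < h k" "h k \<le> \<tau>" for k using tau s by (auto simp: h_def)
  have "\<exists>\<zeta>. z (real k * \<tau> + h k) = stepmap (h k) (z (real k * \<tau>)) + kick (h k) \<zeta> \<and>
     sqsum n \<zeta> \<le> integral {real k * \<tau>..real k * \<tau> + h k} \<Phi>" if "k \<le> m" for k
  proof -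
    have sub: "(\<lambda>r. (inner (\<phi> r) (eb i))\<^sup>2) integrable_on {real k * \<tau>..real k * \<tau> + h k}" for i
      by (rule integrable_subinterval_real[OF pi]) (use end_le[OF that] tau in auto)
    have "integral {real k * \<tau>..real k * \<tau> + h k} \<Phi> =
      (\<Sum>i=1..n. integral {real k * \<tau>..real k * \<tau> + h k} (\<lambda>r. (inner (\<phi> r) (eb i))\<^sup>2))"
      unfolding \<Phi>_def using sub by (intro integral_sum) auto
    then show ?thesis using skeleton_step[OF sk hp(1)[of k] hp(2)[of k] end_le[OF that] pi] by simp
  qed
  then obtain \<zeta> where ze: "\<And>k. k \<le> m \<Longrightarrow> z (real k * \<tau> + h k) = stepmap (h k) (z (real k * \<tau>)) + kick (h k) (\<zeta> k)"
    "\<And>k. k \<le> m \<Longrightarrow> sqsum n (\<zeta> k) \<le> integral {real k * \<tau>..real k * \<tau> + h k} \<Phi>" by metis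
  have ch: "chain 0 \<zeta> k = z (real k * \<tau>)" if "k \<le> m" for k
    using that
  proof (induction k)
    case 0 then show ?case using z0 by simp
  next
    case (Suc k)
    then show ?case using ze(1)[of k] by (simp add: h_def algebra_simps)
  qed
  have "endpt 0 m s \<zeta> = z T" using ze(1)[of m] s by (simp add: endpt_def ch h_def)
  then have "qpot (z T) \<le> ereal (cost m \<zeta>)" using qpot_endpt_le[of s m \<zeta>] s by simp
  have sub: "\<Phi> integrable_on {a..b}" if "0 \<le> a" "b \<le> T" for a b
    by (rule integrable_subinterval_real[OF Pi]) (use that in auto)
  have le: "(\<Sum>j<k. sqsum n (\<zeta> j)) \<le> integral {0..real k * \<tau>} \<Phi>" if "k \<le> m" for k
    using that
  proof (induction k)
    case (Suc k)
    have hk: "real k * \<tau> + h k = real (Suc k) * \<tau>" using Suc by (simp add: h_def algebra_simps)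
    have "integral {0..real k * \<tau>} \<Phi> + integral {real k * \<tau>..real (Suc k) * \<tau>} \<Phi> = integral {0..real (Suc k) * \<tau>} \<Phi>"
      using tau end_le[of k] Suc hk by (intro Henstock_Kurzweil_Integration.integral_combine sub) auto
    then show ?case using Suc ze(2)[of k] hk by simp
  qed simp
  have "(\<Sum>j\<le>m. sqsum n (\<zeta> j)) \<le> integral {0..real m * \<tau>} \<Phi> + integral {real m * \<tau>..T} \<Phi>"
    using le[of m] ze(2)[of m] s by (simp add: h_def lessThan_Suc_atMost[symmetric])
  also have "\<dots> = integral {0..T} \<Phi>"
    using tau s by (intro Henstock_Kurzweil_Integration.integral_combine sub) auto
  also have "\<dots> = integral\<^sup>L (lebesgue_on {0<..<T}) \<Phi>"
    using nonneg_has_integral_lebesgue_on(2)[OF integrable_integral[OF Pi]] by (simp add: \<Phi>_def sum_nonneg)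
  also have "\<dots> \<le> integral\<^sup>L (lebesgue_on {0<..<T}) (\<lambda>r. (norm (\<phi> r))\<^sup>2)"
  proof (rule integral_mono)
    show "integrable (lebesgue_on {0<..<T}) \<Phi>"
      unfolding \<Phi>_def by (intro Bochner_Integration.integrable_sum control_coord_integrable(1)[OF c])
    show "integrable (lebesgue_on {0<..<T}) (\<lambda>r. (norm (\<phi> r))\<^sup>2)" using c by (simp add: L2_controls_def)
  qed (simp add: \<Phi>_def bessel)
  finally have "cost m \<zeta> \<le> integral\<^sup>L (lebesgue_on {0<..<T}) (\<lambda>r. (norm (\<phi> r))\<^sup>2) / 2"
    by (simp add: cost_def)
  with \<open>qpot (z T) \<le> ereal (cost m \<zeta>)\<close> show ?thesis by (metis ereal_less_eq(3) order_trans)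
qed

text \<open>The cheapest control realising given noise values: on a step of length \<open>h\<close> it is proportional
  to the exponential kernel, the equality case of the Cauchy-Schwarz inequality.\<close>

definition opt_control :: "nat \<Rightarrow> real \<Rightarrow> (nat \<Rightarrow> nat \<Rightarrow> real) \<Rightarrow> real \<Rightarrow> nat \<Rightarrow> real" where
  "opt_control m s \<zeta> r i = (let k = nat \<lfloor>r / \<tau>\<rfloor>; h = (if k < m then \<tau> else s)
     in \<zeta> k i / sd h i * (sqrt (q i) * exp (- lam i * (real k * \<tau> + h - r))))"

section \<open>From noise sequences to controls\<close>

lemma block_integral:
  assumes i: "i \<in> {1..n}" and h: "0 < h"
  shows "((\<lambda>r. exp (lam i * r) * (f + sqrt (q i) * (\<zeta> / sd h i * (sqrt (q i) * exp (- lam i * (a + h - r)))))) has_integral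
     (exp (lam i * (a + h)) * (exp (- lam i * h) * x + (1 - exp (- lam i * h)) / lam i * f + sd h i * \<zeta>) - exp (lam i * a) * x)) {a..a + h}"
    "((\<lambda>r. (\<zeta> / sd h i * (sqrt (q i) * exp (- lam i * (a + h - r))))\<^sup>2) has_integral \<zeta>\<^sup>2) {a..a + h}"
proof -
  have i1: "i \<ge> 1" using i by simp
  note l = lam_pos[OF i1] lam_nz[OF i1]
  have sd0: "sd h i \<noteq> 0" using sd_pos[OF h i1] by simp
  \<comment> \<open>With the integrating factor \<open>exp (lam i * r)\<close> the integral over a
    block is a difference of boundary values, so blocks telescope in
    \<open>blocks_has_integral\<close>. \<open>E\<close> is the factor at the end of the
    block.\<close>
  define E where "E = exp (lam i * (a + h))"
  have I1: "((\<lambda>r. exp (- lam i * (a + h - r))) has_integral (1 - exp (- lam i * h)) / lam i) {a..a + h}"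
    using exp_rev_has_integral[of a "a + h" "lam i"] h l by simp
  have I2: "((\<lambda>r. q i * exp (- (2 * lam i) * (a + h - r))) has_integral (sd h i)\<^sup>2) {a..a + h}"
  proof -
    have "((\<lambda>r. q i * exp (- (2 * lam i) * (a + h - r))) has_integral q i * ((1 - exp (- (2 * lam i) * (a + h - a))) / (2 * lam i))) {a..a + h}"
      using h l by (intro has_integral_mult_right exp_rev_has_integral) auto
    then show ?thesis using h by (subst sd_sq[OF _ i1]) auto
  qed
  have e1: "exp (lam i * r) = E * exp (- lam i * (a + h - r))" for r
    by (simp add: E_def exp_add[symmetric] algebra_simps)
  have e2: "exp (- lam i * (a + h - r)) * exp (- lam i * (a + h - r)) = exp (- (2 * lam i) * (a + h - r))" for r
    by (simp add: exp_add[symmetric] algebra_simps)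
  have qq: "sqrt (q i) * (c * (sqrt (q i) * w)) = c * (q i * w)" for c w
  proof -
    have "sqrt (q i) * (c * (sqrt (q i) * w)) = (sqrt (q i) * sqrt (q i)) * (c * w)" by (simp only: mult_ac)
    also have "sqrt (q i) * sqrt (q i) = q i" using qpos[OF i1] by simp
    finally show ?thesis by (simp only: mult_ac)
  qed
  have "((\<lambda>r. E * (exp (- lam i * (a + h - r)) * f + \<zeta> / sd h i * (q i * exp (- (2 * lam i) * (a + h - r))))) has_integral
      E * ((1 - exp (- lam i * h)) / lam i * f + \<zeta> / sd h i * (sd h i)\<^sup>2)) {a..a + h}"
    by (intro has_integral_mult_right has_integral_add has_integral_mult_left I1 I2)
  moreover have "E * (exp (- lam i * (a + h - r)) * f + \<zeta> / sd h i * (q i * exp (- (2 * lam i) * (a + h - r)))) =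
      exp (lam i * r) * (f + sqrt (q i) * (\<zeta> / sd h i * (sqrt (q i) * exp (- lam i * (a + h - r)))))" for r
    unfolding e1 e2[symmetric] qq by (simp only: distrib_left mult_ac)
  moreover have "E * ((1 - exp (- lam i * h)) / lam i * f + \<zeta> / sd h i * (sd h i)\<^sup>2) =
      exp (lam i * (a + h)) * (exp (- lam i * h) * x + (1 - exp (- lam i * h)) / lam i * f + sd h i * \<zeta>) - exp (lam i * a) * x"
  proof -
    have "exp (lam i * a) = E * exp (- lam i * h)" by (simp add: E_def exp_add[symmetric] algebra_simps)
    then show ?thesis unfolding E_def[symmetric] using sd0 by (simp add: power2_eq_square algebra_simps)
  qed
  ultimately show "((\<lambda>r. exp (lam i * r) * (f + sqrt (q i) * (\<zeta> / sd h i * (sqrt (q i) * exp (- lam i * (a + h - r)))))) has_integral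
     (exp (lam i * (a + h)) * (exp (- lam i * h) * x + (1 - exp (- lam i * h)) / lam i * f + sd h i * \<zeta>) - exp (lam i * a) * x)) {a..a + h}"
    by (simp only:)
  have "((\<lambda>r. (\<zeta> / sd h i)\<^sup>2 * (q i * exp (- (2 * lam i) * (a + h - r)))) has_integral (\<zeta> / sd h i)\<^sup>2 * (sd h i)\<^sup>2) {a..a + h}"
    by (intro has_integral_mult_right I2)
  moreover have "(\<zeta> / sd h i)\<^sup>2 * (sd h i)\<^sup>2 = \<zeta>\<^sup>2" using sd0 by (simp add: power_divide)
  moreover have "(\<zeta> / sd h i)\<^sup>2 * (q i * exp (- (2 * lam i) * (a + h - r))) = (\<zeta> / sd h i * (sqrt (q i) * exp (- lam i * (a + h - r))))\<^sup>2" for r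
  proof -
    have "(sqrt (q i))\<^sup>2 = q i" using qpos[OF i1] by simp
    then show ?thesis unfolding e2[symmetric] power_mult_distrib[of "\<zeta> / sd h i"] power_mult_distrib[of "sqrt (q i)"]
      by (simp only: power2_eq_square[of "exp _"])
  qed
  ultimately show "((\<lambda>r. (\<zeta> / sd h i * (sqrt (q i) * exp (- lam i * (a + h - r))))\<^sup>2) has_integral \<zeta>\<^sup>2) {a..a + h}"
    by (simp only:)
qed

lemma blocks_has_integral:
  fixes g :: "real \<Rightarrow> real"
  assumes s: "0 < s" "s \<le> \<tau>"
    and b: "\<And>k. k \<le> m \<Longrightarrow> (g has_integral (G (Suc k) - G k)) {real k * \<tau>..real k * \<tau> + (if k < m then \<tau> else s)}"
  shows "k \<le> m \<Longrightarrow> (g has_integral (G k - G 0)) {0..real k * \<tau>}"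
    "(g has_integral (G (Suc m) - G 0)) {0..real m * \<tau> + s}"
proof -
  show *: "(g has_integral (G k - G 0)) {0..real k * \<tau>}" if "k \<le> m" for k
    using that
  proof (induction k)
    case 0 then show ?case using has_integral_null_real[of 0 0 g] by simp
  next
    case (Suc k)
    have 1: "(g has_integral (G k - G 0)) {0..real k * \<tau>}" using Suc by simp
    have 2: "(g has_integral (G (Suc k) - G k)) {real k * \<tau>..real (Suc k) * \<tau>}"
      using b[of k] Suc by (simp add: algebra_simps)
    have "(g has_integral ((G k - G 0) + (G (Suc k) - G k))) {0..real (Suc k) * \<tau>}"
      by (rule has_integral_combine[OF _ _ 1 2]) (use tau in auto)
    then show ?case by simp
  qed
  have 2: "(g has_integral (G (Suc m) - G m)) {real m * \<tau>..real m * \<tau> + s}"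
    using b[of m] by simp
  have "(g has_integral ((G m - G 0) + (G (Suc m) - G m))) {0..real m * \<tau> + s}"
    by (rule has_integral_combine[OF _ _ *[OF order_refl] 2]) (use tau s in auto)
  then show "(g has_integral (G (Suc m) - G 0)) {0..real m * \<tau> + s}" by simp
qed

text \<open>Equality is attained in the estimate of \<open>skeleton_step\<close>, so the energy of
  the control is exactly twice the cost and the two minimisations have the same infimum.\<close>

lemma control_exists:
  fixes m :: nat
  assumes s: "0 < s" "s \<le> \<tau>"
  defines "T \<equiv> real m * \<tau> + s"
  obtains \<phi> z where "\<phi> \<in> L2_controls n T" "skeleton_mild F Qh n \<tau> T 0 \<phi> z" "z 0 = 0" "z T = endpt 0 m s \<zeta>"
    "integral\<^sup>L (lebesgue_on {0<..<T}) (\<lambda>r. (norm (\<phi> r))\<^sup>2) = 2 * cost m \<zeta>"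
proof -
  have T: "0 < T" using s tau by (simp add: T_def add_nonneg_pos)
  define X where "X k = (if k \<le> m then chain 0 \<zeta> k else endpt 0 m s \<zeta>)" for k
  define h where "h k = (if k < m then \<tau> else s)" for k
  have hp: "0 < h k" "h k \<le> \<tau>" for k using tau s by (auto simp: h_def)
  define t where "t k = real k * \<tau>" for k
  have Xs: "X (Suc k) = stepmap (h k) (X k) + kick (h k) (\<zeta> k)" if "k \<le> m" for k
    using that by (cases "k = m") (auto simp: X_def h_def endpt_def)
  define c where "c i r = opt_control m s \<zeta> r i" for i r
  define \<phi> where "\<phi> r = (\<Sum>i=1..n. c i r *\<^sub>R eb i)" for r
  \<comment> \<open>The drift is written with the prescribed grid values \<open>X\<close> instead of
    the unknown path. This breaks the circularity: the path is defined from \<open>g\<close>, and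
    \<open>z_grid\<close> shows afterwards that it passes through \<open>X\<close>.\<close>
  define g where "g i r = inner (F (X (nat \<lfloor>r / \<tau>\<rfloor>))) (eb i) + sqrt (q i) * c i r" for i r
  have ceq: "c i r = \<zeta> k i / sd (h k) i * (sqrt (q i) * exp (- lam i * (t k + h k - r)))"
    and geq: "g i r = inner (F (X k)) (eb i) + sqrt (q i) * (\<zeta> k i / sd (h k) i * (sqrt (q i) * exp (- lam i * (t k + h k - r))))"
    if "r \<in> {t k..t k + h k} - {t k + h k}" for k i r
  proof -
    have "real k * \<tau> \<le> r" "r < real (Suc k) * \<tau>"
      using that hp(2)[of k] by (auto simp: t_def distrib_right)
    then have "nat \<lfloor>r / \<tau>\<rfloor> = k" by (rule grid_eq(2)[OF tau])
    then show "c i r = \<zeta> k i / sd (h k) i * (sqrt (q i) * exp (- lam i * (t k + h k - r)))"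
      "g i r = inner (F (X k)) (eb i) + sqrt (q i) * (\<zeta> k i / sd (h k) i * (sqrt (q i) * exp (- lam i * (t k + h k - r))))"
      by (simp_all add: g_def c_def opt_control_def h_def t_def Let_def)
  qed
  \<comment> \<open>The last node is \<open>T\<close> itself, since \<open>t (Suc m)\<close> may lie
    beyond it.\<close>
  define e where "e k = (if k \<le> m then t k else T)" for k
  have e: "e (Suc k) = t k + h k" "e k = t k" if "k \<le> m" for k
    using that by (auto simp: e_def t_def h_def T_def algebra_simps)
  have gI: "((\<lambda>r. exp (lam i * r) * g i r) has_integral
      (exp (lam i * e (Suc k)) * inner (X (Suc k)) (eb i) - exp (lam i * e k) * inner (X k) (eb i))) {real k * \<tau>..real k * \<tau> + (if k < m then \<tau> else s)}"
    if i: "i \<in> {1..n}" and k: "k \<le> m" for i k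
  proof -
    have "((\<lambda>r. exp (lam i * r) * g i r) has_integral
      (exp (lam i * (t k + h k)) * (exp (- lam i * h k) * inner (X k) (eb i) + (1 - exp (- lam i * h k)) / lam i * inner (F (X k)) (eb i) + sd (h k) i * \<zeta> k i) - exp (lam i * t k) * inner (X k) (eb i))) {t k..t k + h k}"
      by (rule has_integral_spike[OF _ _ block_integral(1)[OF i hp(1)[of k], of "inner (F (X k)) (eb i)" "\<zeta> k i" "t k" "inner (X k) (eb i)"], of "{t k + h k}"])
         (use geq in auto)
    moreover have "inner (X (Suc k)) (eb i) = exp (- lam i * h k) * inner (X k) (eb i) + (1 - exp (- lam i * h k)) / lam i * inner (F (X k)) (eb i) + sd (h k) i * \<zeta> k i"
      by (simp only: Xs[OF k] inner_add_left stepmap_coord[OF i] kick_coord[OF i])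
    ultimately show ?thesis
      by (simp only: e[OF k] t_def[symmetric] h_def[symmetric])
  qed
  have cI: "((\<lambda>r. (c i r)\<^sup>2) has_integral ((\<Sum>j<Suc k. (\<zeta> j i)\<^sup>2) - (\<Sum>j<k. (\<zeta> j i)\<^sup>2))) {real k * \<tau>..real k * \<tau> + (if k < m then \<tau> else s)}"
    if i: "i \<in> {1..n}" and k: "k \<le> m" for i k
  proof -
    have "((\<lambda>r. (c i r)\<^sup>2) has_integral (\<zeta> k i)\<^sup>2) {t k..t k + h k}"
      by (rule has_integral_spike[OF _ _ block_integral(2)[OF i hp(1)[of k], of "\<zeta> k i" "t k"], of "{t k + h k}"])
         (use ceq in auto)
    then show ?thesis by (simp add: t_def h_def)
  qed
  define z where "z r = (\<Sum>i=1..n. (exp (- lam i * r) * integral {0..r} (\<lambda>r. exp (lam i * r) * g i r)) *\<^sub>R eb i)" for r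
  have X0: "X 0 = 0" by (simp add: X_def)
  have zH: "z r \<in> Hn n" for r unfolding z_def by (rule eb_sum_in_Hn)
  have XH: "X k \<in> Hn n" for k by (auto simp: X_def chain_in_Hn endpt_in_Hn)
  have zX: "z (e k) = X k" if k: "k \<le> Suc m" for k
  proof -
    have "((\<lambda>r. exp (lam i * r) * g i r) has_integral (exp (lam i * e k) * inner (X k) (eb i) - exp (lam i * e 0) * inner (X 0) (eb i))) {0..e k}"
      if i: "i \<in> {1..n}" for i
    proof (cases "k \<le> m")
      case True
      then have "e k = real k * \<tau>" by (simp add: e_def t_def)
      then show ?thesis
        using blocks_has_integral(1)[OF s gI[OF i] True] by simp
    next
      case False
      then have k: "k = Suc m" using k by simp
      have "e k = real m * \<tau> + s" using False by (simp add: e_def T_def)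
      then show ?thesis
        using blocks_has_integral(2)[OF s gI[OF i]] unfolding k by simp
    qed
    then have "integral {0..e k} (\<lambda>r. exp (lam i * r) * g i r) = exp (lam i * e k) * inner (X k) (eb i)"
      if "i \<in> {1..n}" for i
      using that X0 by (auto dest: integral_unique)
    then have "inner (z (e k)) (eb i) = inner (X k) (eb i)" if "i \<in> {1..n}" for i
      unfolding z_def inner_eb_sum[OF that] using that
      by (simp add: mult.assoc[symmetric] exp_add[symmetric])
    then show ?thesis by (rule Hn_eqI[OF zH XH])
  qed
  have z_grid: "z (grid \<tau> r) = X (nat \<lfloor>r / \<tau>\<rfloor>)" if r: "r \<in> {0..<T}" for r
  proof -
    define k where "k = nat \<lfloor>r / \<tau>\<rfloor>"
    have k: "grid \<tau> r = real k * \<tau>" "real k * \<tau> \<le> r"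
      using r tau by (auto simp: grid_def k_def) (simp add: pos_le_divide_eq[symmetric])
    then have "real k * \<tau> < (real m + 1) * \<tau>" using r s by (auto simp: T_def algebra_simps)
    then have "k \<le> m" using tau by simp
    then show ?thesis using zX[of k] k by (simp add: e_def t_def k_def)
  qed
  have gint: "(\<lambda>r. exp (lam i * r) * g i r) integrable_on {0..T}" if "i \<in> {1..n}" for i
    using has_integral_integrable[OF blocks_has_integral(2)[OF s gI[OF that]]] by (simp add: T_def)
  have sk: "skeleton_mild F Qh n \<tau> T 0 \<phi> z"
    unfolding skeleton_mild_def
  proof (intro conjI ballI)
    show "continuous_on {0..T} z"
      unfolding z_def by (intro continuous_intros indefinite_integral_continuous_1 gint)
    show "z ` {0..T} \<subseteq> Hn n" using zH by auto
    fix r assume r: "r \<in> {0..T}"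
    have "((\<lambda>u. exp (- lam i * (r - u)) * (inner (F (z (grid \<tau> u))) (eb i) + sqrt (q i) * inner (\<phi> u) (eb i)))
           has_integral inner (z r) (eb i)) {0..r}" if i: "i \<in> {1..n}" for i
    proof -
      have "((\<lambda>u. exp (lam i * u) * g i u) has_integral integral {0..r} (\<lambda>u. exp (lam i * u) * g i u)) {0..r}"
        by (rule integrable_integral, rule integrable_subinterval_real[OF gint[OF i]]) (use r in auto)
      then have "((\<lambda>u. exp (- lam i * r) * (exp (lam i * u) * g i u)) has_integral inner (z r) (eb i)) {0..r}"
        unfolding z_def inner_eb_sum[OF i] by (rule has_integral_mult_right)
      then show ?thesis
      proof (rule has_integral_spike[rotated 2])
        fix u assume u: "u \<in> {0..r} - {T}"
        have eE: "exp (- lam i * (r - u)) = exp (- lam i * r) * exp (lam i * u)"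
          by (simp add: exp_add[symmetric] algebra_simps)
        have "inner (\<phi> u) (eb i) = c i u" unfolding \<phi>_def by (rule inner_eb_sum[OF i])
        moreover have "z (grid \<tau> u) = X (nat \<lfloor>u / \<tau>\<rfloor>)" using u r by (intro z_grid) auto
        ultimately show "exp (- lam i * (r - u)) * (inner (F (z (grid \<tau> u))) (eb i) + sqrt (q i) * inner (\<phi> u) (eb i))
            = exp (- lam i * r) * (exp (lam i * u) * g i u)"
          using eE by (simp only: g_def mult.assoc)
      qed simp
    qed
    then show "((\<lambda>u. Sn n (r - u) (Pn n (F (z (grid \<tau> u))) + Pn n (Qh (\<phi> u)))) has_integral z r - Sn n r 0) {0..r}"
      using skeleton_integral_iff[where z = z and \<phi> = \<phi>, OF zH] by blast
  qed
  have nphi: "(norm (\<phi> r))\<^sup>2 = (\<Sum>i=1..n. (c i r)\<^sup>2)" for r unfolding \<phi>_def by (rule norm_eb_sum)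
  have "((\<lambda>r. (norm (\<phi> r))\<^sup>2) has_integral (\<Sum>i=1..n. (\<Sum>j<Suc m. (\<zeta> j i)\<^sup>2) - (\<Sum>j<0. (\<zeta> j i)\<^sup>2))) {0..T}"
    unfolding nphi
  proof (intro has_integral_sum finite_atLeastAtMost)
    fix i assume i: "i \<in> {1..n}"
    show "((\<lambda>r. (c i r)\<^sup>2) has_integral ((\<Sum>j<Suc m. (\<zeta> j i)\<^sup>2) - (\<Sum>j<0. (\<zeta> j i)\<^sup>2))) {0..T}"
      unfolding T_def by (rule blocks_has_integral(2)[where G = "\<lambda>k. \<Sum>j<k. (\<zeta> j i)\<^sup>2", OF s cI[OF i]])
  qed
  moreover have "(\<Sum>i=1..n. (\<Sum>j<Suc m. (\<zeta> j i)\<^sup>2) - (\<Sum>j<0. (\<zeta> j i)\<^sup>2)) = 2 * cost m \<zeta>"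
    unfolding cost_def sqsum_def lessThan_Suc_atMost by (subst sum.swap) simp
  ultimately have I: "((\<lambda>r. (norm (\<phi> r))\<^sup>2) has_integral 2 * cost m \<zeta>) {0..T}" by simp
  have cm: "c i \<in> borel_measurable borel" for i
  proof -
    have k: "(\<lambda>r. nat \<lfloor>r / \<tau>\<rfloor>) \<in> measurable borel (count_space UNIV)" by measurable
    have "(\<lambda>r. \<zeta> (nat \<lfloor>r / \<tau>\<rfloor>) i / sd (h (nat \<lfloor>r / \<tau>\<rfloor>)) i) \<in> borel_measurable borel"
      by (rule measurable_compose[OF k, of "\<lambda>k. \<zeta> k i / sd (h k) i" borel]) simp
    moreover have "(\<lambda>r. real (nat \<lfloor>r / \<tau>\<rfloor>) * \<tau> + h (nat \<lfloor>r / \<tau>\<rfloor>)) \<in> borel_measurable borel"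
      by (rule measurable_compose[OF k, of "\<lambda>k. real k * \<tau> + h k" borel]) simp
    ultimately show ?thesis
      unfolding c_def opt_control_def Let_def h_def[symmetric] by measurable
  qed
  have "\<phi> \<in> L2_controls n T"
    unfolding L2_controls_def
  proof (intro CollectI conjI)
    show "\<phi> \<in> measurable (lebesgue_on {0<..<T}) (restrict_space borel (Hn n))"
      unfolding \<phi>_def by (intro measurable_eb_sum measurable_restrict_space1 measurable_completion) (simp add: cm)
    show "integrable (lebesgue_on {0<..<T}) (\<lambda>r. (norm (\<phi> r))\<^sup>2)"
      by (rule nonneg_has_integral_lebesgue_on(1)[OF I]) simp
  qed
  moreover have "z 0 = 0" using zX[of 0] X0 by (simp add: e_def t_def)
  moreover have "z T = endpt 0 m s \<zeta>" using zX[of "Suc m"] by (simp add: e_def X_def)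
  moreover have "integral\<^sup>L (lebesgue_on {0<..<T}) (\<lambda>r. (norm (\<phi> r))\<^sup>2) = 2 * cost m \<zeta>"
    by (rule nonneg_has_integral_lebesgue_on(2)[OF I]) simp
  ultimately show ?thesis using that sk by blast
qed

theorem quasi_potential_eq_qpot: "quasi_potential F Qh n \<tau> u = qpot u"
proof (rule antisym)
  show "quasi_potential F Qh n \<tau> u \<le> qpot u"
    unfolding qpot_def
  proof (rule Inf_greatest, clarify)
    fix m s \<zeta> assume s: "0 < s" "s \<le> \<tau>" and u: "u = endpt 0 m s \<zeta>"
    define T where "T = real m * \<tau> + s"
    have T: "0 < T" using s tau by (simp add: T_def add_nonneg_pos)
    obtain \<phi> z where z: "\<phi> \<in> L2_controls n T" "skeleton_mild F Qh n \<tau> T 0 \<phi> z" "z 0 = 0" "z T = endpt 0 m s \<zeta>"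
      and I: "integral\<^sup>L (lebesgue_on {0<..<T}) (\<lambda>r. (norm (\<phi> r))\<^sup>2) = 2 * cost m \<zeta>"
      unfolding T_def by (rule control_exists[OF s])
    have "quasi_potential F Qh n \<tau> (endpt 0 m s \<zeta>) \<le> action F Qh n \<tau> T 0 z"
      unfolding quasi_potential_def using z T
      by (intro Inf_lower CollectI exI[of _ T] exI[of _ z]) (auto simp: skeleton_mild_def)
    also have "\<dots> \<le> ereal (1/2) * ereal (integral\<^sup>L (lebesgue_on {0<..<T}) (\<lambda>r. (norm (\<phi> r))\<^sup>2))"
      unfolding action_def using z by (intro ereal_mult_left_mono INF_lower) auto
    also have "\<dots> = ereal (cost m \<zeta>)" using I by simp
    finally show "quasi_potential F Qh n \<tau> (endpt 0 m s \<zeta>) \<le> ereal (cost m \<zeta>)" .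
  qed
  show "qpot u \<le> quasi_potential F Qh n \<tau> u"
    unfolding quasi_potential_def
  proof (rule Inf_greatest, clarify)
    fix T :: real and z assume z: "0 < T" "continuous_on {0..T} z" "z ` {0..T} \<subseteq> Hn n" "z 0 = 0" "u = z T"
    \<comment> \<open>Doubling \<open>qpot\<close> lets each control be compared separately under
      the infimum; the factor 1/2 is restored afterwards.\<close>
    have "ereal 2 * qpot (z T) \<le> (INF \<phi> \<in> {\<phi> \<in> L2_controls n T. skeleton_mild F Qh n \<tau> T 0 \<phi> z}.
       ereal (integral\<^sup>L (lebesgue_on {0<..<T}) (\<lambda>t. (norm (\<phi> t))\<^sup>2)))"
    proof (rule INF_greatest, clarify)
      fix \<phi> assume "\<phi> \<in> L2_controls n T" "skeleton_mild F Qh n \<tau> T 0 \<phi> z"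
      from qpot_le_control[OF z(1) this z(4)]
      have "ereal 2 * qpot (z T) \<le> ereal 2 * ereal (integral\<^sup>L (lebesgue_on {0<..<T}) (\<lambda>r. (norm (\<phi> r))\<^sup>2) / 2)"
        by (rule ereal_mult_left_mono) simp
      then show "ereal 2 * qpot (z T) \<le> ereal (integral\<^sup>L (lebesgue_on {0<..<T}) (\<lambda>t. (norm (\<phi> t))\<^sup>2))" by simp
    qed
    then have "ereal (1/2) * (ereal 2 * qpot (z T)) \<le> action F Qh n \<tau> T 0 z"
      unfolding action_def by (rule ereal_mult_left_mono) simp
    moreover have "ereal (1/2) * (ereal 2 * qpot (z T)) = qpot (z T)"
      by (cases "qpot (z T)") auto
    ultimately show "qpot (z T) \<le> action F Qh n \<tau> T 0 z" by simp
  qed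
qed

end

section \<open>Limits of independent Gaussian variables\<close>

context prob_space
begin

text \<open>The law of the limit is never identified: Fatou's lemma transfers upper bounds for exponential
  moments and lower bounds for closed boxes from the approximating independent families.\<close>

definition gauss_limit :: "'i set \<Rightarrow> ('i \<Rightarrow> 'a \<Rightarrow> real) \<Rightarrow> bool" where
  "gauss_limit J \<zeta> \<longleftrightarrow> finite J \<and> (\<forall>j\<in>J. \<zeta> j \<in> borel_measurable M) \<and>
     (\<exists>g. (\<forall>N::nat. indep_vars (\<lambda>_. borel) (g N) J \<and> (\<forall>j\<in>J. distributed M lborel (g N j) std_normal_density)) \<and>
        (AE \<omega> in M. \<forall>j\<in>J. (\<lambda>N. g N j \<omega>) \<longlonglongrightarrow> \<zeta> j \<omega>))"

lemma gauss_limit_subset: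
  assumes "gauss_limit J \<zeta>" "K \<subseteq> J"
  shows "gauss_limit K \<zeta>"
proof -
  from assms(1) obtain g where g: "finite J" "\<And>j. j \<in> J \<Longrightarrow> \<zeta> j \<in> borel_measurable M"
    "\<And>N::nat. indep_vars (\<lambda>_. borel) (g N) J" "\<And>N j. j \<in> J \<Longrightarrow> distributed M lborel (g N j) std_normal_density"
    and ae: "AE \<omega> in M. \<forall>j\<in>J. (\<lambda>N. g N j \<omega>) \<longlonglongrightarrow> \<zeta> j \<omega>"
    unfolding gauss_limit_def by blast
  have "AE \<omega> in M. \<forall>j\<in>K. (\<lambda>N. g N j \<omega>) \<longlonglongrightarrow> \<zeta> j \<omega>"
    using ae by eventually_elim (use assms(2) in blast)
  then show ?thesis
    unfolding gauss_limit_def using g assms(2) indep_vars_subset[OF g(3) assms(2)] finite_subset[OF assms(2)]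
    by (intro conjI exI[of _ g]) auto
qed

section \<open>Exponential moments and box probabilities\<close>

lemma nn_integral_exp_square_std_normal:
  assumes X: "distributed M lborel X std_normal_density" and b: "b < 1 / 2"
  shows "(\<integral>\<^sup>+\<omega>. ennreal (exp (b * (X \<omega>)\<^sup>2)) \<partial>M) = ennreal (1 / sqrt (1 - 2 * b))"
proof -
  define s where "s = 1 / sqrt (1 - 2 * b)"
  have s: "0 < s" "s\<^sup>2 = 1 / (1 - 2 * b)" using b by (simp_all add: s_def power_divide)
  \<comment> \<open>The tilted density is, up to the factor \<open>s\<close>, again a normal
    density, with variance \<open>1 / (1 - 2 * b)\<close>.\<close>
  have eq: "std_normal_density x * exp (b * x\<^sup>2) = s * normal_density 0 s x" for x
  proof -
    have "- x\<^sup>2 / 2 + b * x\<^sup>2 = - x\<^sup>2 / (2 * s\<^sup>2)"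
      using b by (simp add: s(2) field_simps)
    then have e: "exp (- x\<^sup>2 / 2) * exp (b * x\<^sup>2) = exp (- x\<^sup>2 / (2 * s\<^sup>2))"
      by (simp only: exp_add[symmetric])
    have "sqrt (2 * pi * s\<^sup>2) = sqrt (2 * pi) * s" unfolding real_sqrt_mult using s(1) by simp
    then show ?thesis using s(1) e by (simp add: normal_density_def)
  qed
  have "(\<integral>\<^sup>+\<omega>. ennreal (exp (b * (X \<omega>)\<^sup>2)) \<partial>M) = (\<integral>\<^sup>+x. ennreal (std_normal_density x) * ennreal (exp (b * x\<^sup>2)) \<partial>lborel)"
    by (rule distributed_nn_integral[OF X, symmetric]) simp
  also have "\<dots> = (\<integral>\<^sup>+x. ennreal s * ennreal (normal_density 0 s x) \<partial>lborel)"
    using s(1) eq by (intro nn_integral_cong) (simp add: ennreal_mult[symmetric])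
  also have "\<dots> = ennreal s * (\<integral>\<^sup>+x. ennreal (normal_density 0 s x) \<partial>lborel)"
    by (rule nn_integral_cmult) simp
  also have "(\<integral>\<^sup>+x. ennreal (normal_density 0 s x) \<partial>lborel) = 1"
  proof -
    have "emeasure (density lborel (normal_density 0 s)) UNIV = 1"
      using prob_space.emeasure_space_1[OF prob_space_normal_density[OF s(1)]] by simp
    then show ?thesis by (subst (asm) emeasure_density) simp_all
  qed
  finally show ?thesis by (simp add: s_def)
qed

lemma gauss_limit_exp_moment:
  assumes G: "gauss_limit J \<zeta>" and b: "\<And>j. j \<in> J \<Longrightarrow> b j < 1 / 2"
  shows "(\<integral>\<^sup>+\<omega>. ennreal (exp (\<Sum>j\<in>J. b j * (\<zeta> j \<omega>)\<^sup>2)) \<partial>M) \<le> ennreal (\<Prod>j\<in>J. 1 / sqrt (1 - 2 * b j))"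
proof -
  from G obtain g where g: "finite J" "\<And>j. j \<in> J \<Longrightarrow> \<zeta> j \<in> borel_measurable M"
    "\<And>N::nat. indep_vars (\<lambda>_. borel) (g N) J" "\<And>N j. j \<in> J \<Longrightarrow> distributed M lborel (g N j) std_normal_density"
    and ae: "AE \<omega> in M. \<forall>j\<in>J. (\<lambda>N. g N j \<omega>) \<longlonglongrightarrow> \<zeta> j \<omega>"
    unfolding gauss_limit_def by blast
  have gm: "g N j \<in> borel_measurable M" if "j \<in> J" for N j
    using distributed_measurable[OF g(4)[OF that]] by simp
  have N: "(\<integral>\<^sup>+\<omega>. ennreal (exp (\<Sum>j\<in>J. b j * (g N j \<omega>)\<^sup>2)) \<partial>M) = ennreal (\<Prod>j\<in>J. 1 / sqrt (1 - 2 * b j))" for N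
  proof -
    have "(\<integral>\<^sup>+\<omega>. ennreal (exp (\<Sum>j\<in>J. b j * (g N j \<omega>)\<^sup>2)) \<partial>M)
        = (\<integral>\<^sup>+\<omega>. (\<Prod>j\<in>J. ennreal (exp (b j * (g N j \<omega>)\<^sup>2))) \<partial>M)"
      by (simp add: exp_sum g(1) prod_ennreal)
    also have "\<dots> = (\<Prod>j\<in>J. \<integral>\<^sup>+\<omega>. ennreal (exp (b j * (g N j \<omega>)\<^sup>2)) \<partial>M)"
      by (intro indep_vars_nn_integral g(1) indep_vars_compose2[OF g(3), where Y = "\<lambda>j x. ennreal (exp (b j * x\<^sup>2))"]) auto
    also have "\<dots> = (\<Prod>j\<in>J. ennreal (1 / sqrt (1 - 2 * b j)))"
      using g(4) b by (intro prod.cong nn_integral_exp_square_std_normal) auto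
    also have "\<dots> = ennreal (\<Prod>j\<in>J. 1 / sqrt (1 - 2 * b j))"
    proof (rule prod_ennreal)
      fix j assume "j \<in> J"
      then show "0 \<le> 1 / sqrt (1 - 2 * b j)" using b[of j] by simp
    qed
    finally show ?thesis .
  qed
  have "(\<integral>\<^sup>+\<omega>. ennreal (exp (\<Sum>j\<in>J. b j * (\<zeta> j \<omega>)\<^sup>2)) \<partial>M)
      = (\<integral>\<^sup>+\<omega>. liminf (\<lambda>N. ennreal (exp (\<Sum>j\<in>J. b j * (g N j \<omega>)\<^sup>2))) \<partial>M)"
  proof (rule nn_integral_cong_AE)
    show "AE \<omega> in M. ennreal (exp (\<Sum>j\<in>J. b j * (\<zeta> j \<omega>)\<^sup>2)) = liminf (\<lambda>N. ennreal (exp (\<Sum>j\<in>J. b j * (g N j \<omega>)\<^sup>2)))"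
      using ae
    proof eventually_elim
      case (elim \<omega>)
      have "(\<lambda>N. ennreal (exp (\<Sum>j\<in>J. b j * (g N j \<omega>)\<^sup>2))) \<longlonglongrightarrow> ennreal (exp (\<Sum>j\<in>J. b j * (\<zeta> j \<omega>)\<^sup>2))"
        using elim by (intro tendsto_ennrealI tendsto_intros) auto
      then show ?case by (rule lim_imp_Liminf[OF sequentially_bot, symmetric])
    qed
  qed
  also have "\<dots> \<le> liminf (\<lambda>N. \<integral>\<^sup>+\<omega>. ennreal (exp (\<Sum>j\<in>J. b j * (g N j \<omega>)\<^sup>2)) \<partial>M)"
    using gm by (intro nn_integral_liminf) simp
  also have "\<dots> = ennreal (\<Prod>j\<in>J. 1 / sqrt (1 - 2 * b j))"
    unfolding N by (simp add: Liminf_const)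
  finally show ?thesis .
qed

lemma std_normal_interval_lower:
  assumes X: "distributed M lborel X std_normal_density" and r: "0 \<le> r"
  shows "2 * r / sqrt (2 * pi) * exp (- (\<bar>z\<bar> + r)\<^sup>2 / 2) \<le> prob {\<omega> \<in> space M. \<bar>X \<omega> - z\<bar> \<le> r}"
proof -
  let ?c = "exp (- (\<bar>z\<bar> + r)\<^sup>2 / 2) / sqrt (2 * pi)"
  have eq: "{\<omega> \<in> space M. \<bar>X \<omega> - z\<bar> \<le> r} = X -` {z - r..z + r} \<inter> space M" by auto
  have "ennreal (2 * r / sqrt (2 * pi) * exp (- (\<bar>z\<bar> + r)\<^sup>2 / 2)) = ennreal ?c * ennreal (2 * r)"
    using r by (simp add: ennreal_mult[symmetric] mult.commute)
  also have "\<dots> = ennreal ?c * emeasure lborel {z - r..z + r}"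
    using r by simp
  also have "\<dots> = (\<integral>\<^sup>+x. ennreal ?c * indicator {z - r..z + r} x \<partial>lborel)"
    by (rule nn_integral_cmult_indicator[symmetric]) simp
  also have "\<dots> \<le> (\<integral>\<^sup>+x. ennreal (std_normal_density x) * indicator {z - r..z + r} x \<partial>lborel)"
  proof (intro nn_integral_mono)
    fix x
    have "?c \<le> std_normal_density x" if "x \<in> {z - r..z + r}"
    proof -
      have "\<bar>x\<bar> \<le> \<bar>z\<bar> + r" using that by auto
      then have "\<bar>x\<bar>\<^sup>2 \<le> (\<bar>z\<bar> + r)\<^sup>2" by (intro power_mono) auto
      then show ?thesis by (simp add: std_normal_density_def divide_right_mono)
    qed
    then show "ennreal ?c * indicator {z - r..z + r} x \<le> ennreal (std_normal_density x) * indicator {z - r..z + r} x"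
      by (auto split: split_indicator intro: ennreal_leI)
  qed
  also have "\<dots> = emeasure M {\<omega> \<in> space M. \<bar>X \<omega> - z\<bar> \<le> r}"
    unfolding eq by (rule distributed_emeasure[OF X, symmetric]) simp
  finally show ?thesis by (simp add: emeasure_eq_measure)
qed

text \<open>Fatou's lemma is applied to the complement: if the limit lies outside the closed box, so
  do the approximations eventually. Their boxes have the stated probability at least, by
  independence.\<close>

lemma gauss_limit_box_lower:
  assumes G: "gauss_limit J \<zeta>" and J: "J \<noteq> {}" and r: "0 \<le> r"
  shows "(\<Prod>j\<in>J. 2 * r / sqrt (2 * pi) * exp (- (\<bar>z j\<bar> + r)\<^sup>2 / 2)) \<le> prob {\<omega> \<in> space M. \<forall>j\<in>J. \<bar>\<zeta> j \<omega> - z j\<bar> \<le> r}"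
proof -
  let ?p = "\<Prod>j\<in>J. 2 * r / sqrt (2 * pi) * exp (- (\<bar>z j\<bar> + r)\<^sup>2 / 2)"
  from G obtain g where g: "finite J" "\<And>j. j \<in> J \<Longrightarrow> \<zeta> j \<in> borel_measurable M"
    "\<And>N::nat. indep_vars (\<lambda>_. borel) (g N) J" "\<And>N j. j \<in> J \<Longrightarrow> distributed M lborel (g N j) std_normal_density"
    and ae: "AE \<omega> in M. \<forall>j\<in>J. (\<lambda>N. g N j \<omega>) \<longlonglongrightarrow> \<zeta> j \<omega>"
    unfolding gauss_limit_def by blast
  have gm: "g N j \<in> borel_measurable M" if "j \<in> J" for N j
    using distributed_measurable[OF g(4)[OF that]] by simp
  define A where "A N = {\<omega> \<in> space M. \<forall>j\<in>J. \<bar>g N j \<omega> - z j\<bar> \<le> r}" for N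
  define B where "B = {\<omega> \<in> space M. \<forall>j\<in>J. \<bar>\<zeta> j \<omega> - z j\<bar> \<le> r}"
  have Am: "A N \<in> events" for N
    unfolding A_def using gm g(1) by (intro sets.sets_Collect_finite_All' ) (auto intro!: borel_measurable_le borel_measurable_abs borel_measurable_diff simp: J)
  have Bm: "B \<in> events"
    unfolding B_def using g(1,2) by (intro sets.sets_Collect_finite_All') (auto intro!: borel_measurable_le borel_measurable_abs borel_measurable_diff simp: J)
  have A: "?p \<le> prob (A N)" for N
  proof -
    have "prob (A N) = prob (\<Inter>j\<in>J. g N j -` {z j - r..z j + r} \<inter> space M)"
      using J by (intro arg_cong[where f = prob]) (auto simp: A_def abs_le_iff algebra_simps)
    also have "\<dots> = (\<Prod>j\<in>J. prob (g N j -` {z j - r..z j + r} \<inter> space M))"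
      by (rule indep_varsD_finite[OF g(3) J g(1)]) simp
    also have "\<dots> = (\<Prod>j\<in>J. prob {\<omega> \<in> space M. \<bar>g N j \<omega> - z j\<bar> \<le> r})"
      by (intro prod.cong refl arg_cong[where f = prob]) auto
    also have "\<dots> \<ge> ?p"
      using g(4) r by (intro prod_mono conjI std_normal_interval_lower) auto
    finally show ?thesis .
  qed
  have "emeasure M (space M - B) = (\<integral>\<^sup>+\<omega>. indicator (space M - B) \<omega> \<partial>M)"
    using Bm by simp
  also have "\<dots> \<le> (\<integral>\<^sup>+\<omega>. liminf (\<lambda>N. indicator (space M - A N) \<omega>) \<partial>M)"
  proof (rule nn_integral_mono_AE)
    show "AE \<omega> in M. (indicator (space M - B) \<omega> :: ennreal) \<le> liminf (\<lambda>N. indicator (space M - A N) \<omega>)"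
      using ae
    proof eventually_elim
      case (elim \<omega>)
      show ?case
      proof (cases "\<omega> \<in> space M - B")
        case True
        then obtain j where j: "j \<in> J" "r < \<bar>\<zeta> j \<omega> - z j\<bar>" by (auto simp: B_def not_le)
        have "(\<lambda>N. \<bar>g N j \<omega> - z j\<bar>) \<longlonglongrightarrow> \<bar>\<zeta> j \<omega> - z j\<bar>"
          using elim j by (intro tendsto_intros) auto
        from order_tendstoD(1)[OF this j(2)]
        have "\<forall>\<^sub>F N in sequentially. (1::ennreal) \<le> indicator (space M - A N) \<omega>"
          by (rule eventually_mono) (use True j in \<open>auto simp: A_def indicator_def not_le\<close>)
        from Liminf_bounded[OF this] show ?thesis using True by simp
      qed simp
    qed
  qed
  also have "\<dots> \<le> liminf (\<lambda>N. \<integral>\<^sup>+\<omega>. indicator (space M - A N) \<omega> \<partial>M)"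
    using Am by (intro nn_integral_liminf) simp
  also have "\<dots> \<le> liminf (\<lambda>N::nat. ennreal (1 - ?p))"
  proof (intro Liminf_mono always_eventually allI)
    fix N
    have "(\<integral>\<^sup>+\<omega>. indicator (space M - A N) \<omega> \<partial>M) = ennreal (prob (space M - A N))"
      using Am by (simp add: emeasure_eq_measure)
    also have "\<dots> \<le> ennreal (1 - ?p)" using prob_compl[OF Am, of N] A[of N] by (intro ennreal_leI) simp
    finally show "(\<integral>\<^sup>+\<omega>. indicator (space M - A N) \<omega> \<partial>M) \<le> ennreal (1 - ?p)" .
  qed
  also have "\<dots> = ennreal (1 - ?p)" by (simp add: Liminf_const)
  finally have "ennreal (prob (space M - B)) \<le> ennreal (1 - ?p)" by (simp add: emeasure_eq_measure)
  moreover have "0 \<le> 1 - ?p" using A[of 0] prob_le_1[of "A 0"] by linarith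
  ultimately have "prob (space M - B) \<le> 1 - ?p" by simp
  then show ?thesis using prob_compl[OF Bm] by (simp add: B_def)
qed

lemma exp_markov:
  assumes X: "X \<in> borel_measurable M" and K: "0 \<le> K" "(\<integral>\<^sup>+\<omega>. ennreal (exp (X \<omega>)) \<partial>M) \<le> ennreal K"
  shows "prob {\<omega> \<in> space M. c \<le> X \<omega>} \<le> K * exp (- c)"
proof -
  have "emeasure M {\<omega> \<in> space M. 1 \<le> ennreal (exp (- c)) * ennreal (exp (X \<omega>))}
     \<le> ennreal (exp (- c)) * (\<integral>\<^sup>+\<omega>. ennreal (exp (X \<omega>)) * indicator (space M) \<omega> \<partial>M)"
    using X by (intro nn_integral_Markov_inequality) auto
  also have "(\<integral>\<^sup>+\<omega>. ennreal (exp (X \<omega>)) * indicator (space M) \<omega> \<partial>M) = (\<integral>\<^sup>+\<omega>. ennreal (exp (X \<omega>)) \<partial>M)"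
    by (intro nn_integral_cong) simp
  also have "ennreal (exp (- c)) * \<dots> \<le> ennreal (exp (- c)) * ennreal K"
    using K by (intro mult_left_mono) auto
  also have "\<dots> = ennreal (K * exp (- c))" using K by (simp add: ennreal_mult[symmetric] mult.commute)
  also have "{\<omega> \<in> space M. 1 \<le> ennreal (exp (- c)) * ennreal (exp (X \<omega>))} = {\<omega> \<in> space M. c \<le> X \<omega>}"
    by (auto simp: ennreal_mult[symmetric] exp_add[symmetric] simp flip: ennreal_1)
  finally show ?thesis using K by (simp add: emeasure_eq_measure)
qed

text \<open>Combines independence of the paths \<open>P i\<close> with independence, inside each
  path, of the functionals \<open>H i k\<close>.\<close>

lemma indep_vars_pairs:
  assumes P: "indep_vars N P I" and I: "finite I" "I \<noteq> {}" and K: "finite K" "K \<noteq> {}"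
    and H: "\<And>i k. i \<in> I \<Longrightarrow> k \<in> K \<Longrightarrow> H i k \<in> borel_measurable (N i)"
    and g: "\<And>i. i \<in> I \<Longrightarrow> indep_vars (\<lambda>_. borel) (\<lambda>k \<omega>. H i k (P i \<omega>) :: real) K"
  shows "indep_vars (\<lambda>_. borel) (\<lambda>p \<omega>. H (snd p) (fst p) (P (snd p) \<omega>)) (K \<times> I)"
proof -
  have Pm: "P i \<in> measurable M (N i)" if "i \<in> I" for i
    using P that by (auto simp: indep_vars_def2)
  have rv: "(\<lambda>\<omega>. H (snd p) (fst p) (P (snd p) \<omega>)) \<in> borel_measurable M" if "p \<in> K \<times> I" for p
    using that measurable_compose[OF Pm H] by auto
  let ?F = "\<lambda>p. {(\<lambda>\<omega>. H (snd p) (fst p) (P (snd p) \<omega>)) -` A \<inter> space M | A. A \<in> sets borel}"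
  have "indep_sets ?F (K \<times> I)"
  proof (subst indep_sets_finite)
    show "?F p \<subseteq> events" if "p \<in> K \<times> I" for p using rv[OF that] by (auto intro: measurable_sets)
    show "space M \<in> ?F p" if "p \<in> K \<times> I" for p by (auto intro!: exI[of _ UNIV])
    show "\<forall>A\<in>Pi (K \<times> I) ?F. prob (\<Inter>j\<in>K \<times> I. A j) = (\<Prod>j\<in>K \<times> I. prob (A j))"
    proof
      fix A assume A: "A \<in> Pi (K \<times> I) ?F"
      have "\<forall>p\<in>K \<times> I. \<exists>B. B \<in> sets borel \<and> A p = (\<lambda>\<omega>. H (snd p) (fst p) (P (snd p) \<omega>)) -` B \<inter> space M"
      proof
        fix p assume "p \<in> K \<times> I"
        with A have "A p \<in> ?F p" by (rule Pi_mem)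
        then show "\<exists>B. B \<in> sets borel \<and> A p = (\<lambda>\<omega>. H (snd p) (fst p) (P (snd p) \<omega>)) -` B \<inter> space M" by blast
      qed
      then obtain B where B: "\<And>p. p \<in> K \<times> I \<Longrightarrow> B p \<in> sets borel"
        "\<And>p. p \<in> K \<times> I \<Longrightarrow> A p = (\<lambda>\<omega>. H (snd p) (fst p) (P (snd p) \<omega>)) -` B p \<inter> space M"
        by metis
      \<comment> \<open>For fixed \<open>i\<close> all conditions are collected into one event of
        the path \<open>P i\<close>, so that independence of the paths factors the probability first
        and independence within a path afterwards.\<close>
      define C where "C i = {x \<in> space (N i). \<forall>k\<in>K. H i k x \<in> B (k, i)}" for i
      have C: "C i \<in> sets (N i)" if "i \<in> I" for i
      proof -
        have "C i = (\<Inter>k\<in>K. H i k -` B (k, i) \<inter> space (N i))" using K by (auto simp: C_def)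
        then show ?thesis using that H B(1) K by (auto intro!: sets.finite_INT measurable_sets)
      qed
      have PC: "P i -` C i \<inter> space M = (\<Inter>k\<in>K. A (k, i))" if "i \<in> I" for i
        using that K B(2) measurable_space[OF Pm[OF that]] by (auto simp: C_def)
      have "(\<Inter>j\<in>K \<times> I. A j) = (\<Inter>i\<in>I. P i -` C i \<inter> space M)"
        using PC I by auto
      then have "prob (\<Inter>j\<in>K \<times> I. A j) = (\<Prod>i\<in>I. prob (P i -` C i \<inter> space M))"
        using indep_varsD_finite[OF P I(2,1) C] by simp
      also have "\<dots> = (\<Prod>i\<in>I. \<Prod>k\<in>K. prob (A (k, i)))"
      proof (rule prod.cong[OF refl])
        fix i assume i: "i \<in> I"
        have "prob (P i -` C i \<inter> space M) = prob (\<Inter>k\<in>K. (\<lambda>\<omega>. H i k (P i \<omega>)) -` B (k, i) \<inter> space M)"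
          unfolding PC[OF i] using i B(2) by simp
        also have "\<dots> = (\<Prod>k\<in>K. prob ((\<lambda>\<omega>. H i k (P i \<omega>)) -` B (k, i) \<inter> space M))"
          using i B(1) by (intro indep_varsD_finite[OF g[OF i] K(2,1)]) auto
        finally show "prob (P i -` C i \<inter> space M) = (\<Prod>k\<in>K. prob (A (k, i)))" using i B(2) by simp
      qed
      also have "\<dots> = (\<Prod>k\<in>K. \<Prod>i\<in>I. prob (A (k, i)))" by (rule prod.swap)
      also have "\<dots> = (\<Prod>j\<in>K \<times> I. prob (A j))" by (simp add: prod.cartesian_product)
      finally show "prob (\<Inter>j\<in>K \<times> I. A j) = (\<Prod>j\<in>K \<times> I. prob (A j))" .
    qed
  qed (use I K in auto)
  then show ?thesis using rv by (auto simp: indep_vars_def2)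
qed

end

text \<open>The stochastic convolution as a pathwise limit of Riemann-type sums: summation by parts turns
  the sums over increments of \<open>b\<close> into integrals of the continuous path \<open>y\<close>.\<close>

lemma convolution_sum_limit:
  fixes y b :: "real \<Rightarrow> real"
  assumes l: "0 < l" and h: "0 < h" and cy: "continuous_on {a..a + h} y"
    and I: "\<And>r. r \<in> {a..a + h} \<Longrightarrow> ((\<lambda>u. f - l * y u) has_integral (y r - y a - c * (b r - b a))) {a..r}"
  shows "(\<lambda>N. \<Sum>j<Suc N. exp (- l * (h - real j * (h / real (Suc N)))) *
      (c * (b (a + real (Suc j) * (h / real (Suc N))) - b (a + real j * (h / real (Suc N))))))
    \<longlonglongrightarrow> y (a + h) - exp (- l * h) * y a - (1 - exp (- l * h)) / l * f"
    (is "?S \<longlonglongrightarrow> ?D")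
proof (rule LIMSEQ_I)
  fix e :: real assume e: "0 < e"
  define E where "E u = exp (- l * (a + h - u))" for u
  \<comment> \<open>For smooth \<open>b\<close> the equation gives
    \<open>c * b' = y' - f + l * y\<close>, and then \<open>R' = E * (c * b')\<close>. So
    \<open>R\<close> plays the role of a primitive, defined without differentiating
    \<open>b\<close>.\<close>
  define R where "R u = E u * y u - f * E u / l" for u
  have D: "?D = R (a + h) - R a"
    using l by (simp add: R_def E_def field_simps)
  have "bounded (y ` {a..a + h})"
    by (intro compact_imp_bounded compact_continuous_image cy) simp
  then obtain B where B: "0 < B" "\<And>u. u \<in> {a..a + h} \<Longrightarrow> \<bar>y u\<bar> \<le> B"
    unfolding bounded_pos by auto
  define C where "C = l * (1 + B) + \<bar>f\<bar>"
  have C: "0 < C" unfolding C_def using l B by (intro add_pos_nonneg mult_pos_pos) auto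
  \<comment> \<open>The total error is at most \<open>\<eta> * C * h\<close>, which this choice
    makes \<open>e / 2\<close>.\<close>
  define \<eta> where "\<eta> = e / (2 * h * C)"
  have \<eta>: "0 < \<eta>" using e h C by (simp add: \<eta>_def)
  have cE: "continuous_on {a..a + h} E" unfolding E_def by (intro continuous_intros)
  have "uniformly_continuous_on {a..a + h} y" "uniformly_continuous_on {a..a + h} E"
    by (intro compact_uniformly_continuous cy cE; simp)+
  then obtain \<delta>1 \<delta>2 where d12: "0 < \<delta>1" "0 < \<delta>2"
    "\<And>u v. u \<in> {a..a + h} \<Longrightarrow> v \<in> {a..a + h} \<Longrightarrow> dist v u < \<delta>1 \<Longrightarrow> dist (y v) (y u) < \<eta>"
    "\<And>u v. u \<in> {a..a + h} \<Longrightarrow> v \<in> {a..a + h} \<Longrightarrow> dist v u < \<delta>2 \<Longrightarrow> dist (E v) (E u) < \<eta>"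
    unfolding uniformly_continuous_on_def using \<eta> by metis
  define \<delta> where "\<delta> = min \<delta>1 \<delta>2"
  have \<delta>: "0 < \<delta>" using d12 by (simp add: \<delta>_def)
  obtain N0 :: nat where N0: "h / \<delta> < real N0" using reals_Archimedean2 by blast
  have "norm (?S N - ?D) < e" if N: "N0 \<le> N" for N
  proof -
    define d where "d = h / real (Suc N)"
    have d: "0 < d" "real (Suc N) * d = h" using h by (simp_all add: d_def)
    have "h / \<delta> < real (Suc N)" using N0 N by linarith
    then have dd: "d < \<delta>" using \<delta> h by (simp add: d_def field_simps)
    define t where "t j = a + real j * d" for j
    have t: "t 0 = a" "t (Suc N) = a + h" "t (Suc j) = t j + d" for j
      using d by (simp_all add: t_def algebra_simps)
    have tle: "a \<le> t j" "t j + d \<le> a + h" if "j < Suc N" for j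
    proof -
      show "a \<le> t j" using d by (simp add: t_def)
      have "real (Suc j) * d \<le> real (Suc N) * d" using that d(1) by (intro mult_right_mono) auto
      then show "t j + d \<le> a + h" unfolding d(2) by (simp add: t_def algebra_simps)
    qed
    have err: "\<bar>R (t (Suc j)) - R (t j) - E (t j) * (c * (b (t (Suc j)) - b (t j)))\<bar> \<le> \<eta> * C * d" if j: "j < Suc N" for j
    proof -
      let ?u = "t j" and ?v = "t (Suc j)"
      have uv: "a \<le> ?u" "?u \<le> ?v" "?v \<le> a + h" "?v - ?u = d" using tle[OF j] d t(3)[of j] by auto
      have Iv: "((\<lambda>u. f - l * y u) has_integral (y ?v - y a - c * (b ?v - b a))) {a..?v}"
        using I[of ?v] uv by simp
      have Iu: "((\<lambda>u. f - l * y u) has_integral (y ?u - y a - c * (b ?u - b a))) {a..?u}"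
        using I[of ?u] uv by simp
      have "(\<lambda>u. f - l * y u) integrable_on {?u..?v}"
        by (rule integrable_subinterval_real[OF has_integral_integrable[OF Iv]]) (use uv in auto)
      then obtain J where J: "((\<lambda>u. f - l * y u) has_integral J) {?u..?v}" by blast
      have "y ?v - y a - c * (b ?v - b a) = (y ?u - y a - c * (b ?u - b a)) + J"
        by (rule has_integral_unique[OF Iv has_integral_combine[OF _ _ Iu J]]) (use uv in auto)
      then have Jeq: "c * (b ?v - b ?u) = y ?v - y ?u - J" by (simp add: algebra_simps)
      have EI: "((\<lambda>u. l * E u) has_integral (E ?v - E ?u)) {?u..?v}"
        using uv unfolding E_def by (intro fundamental_theorem_of_calculus)
          (auto intro!: derivative_eq_intros simp: has_real_derivative_iff_has_vector_derivative[symmetric])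
      \<comment> \<open>The error of one Riemann term is itself an integral over the cell.\<close>
      have "((\<lambda>u. (l * E u) * (y ?v - f / l) + E ?u * (f - l * y u)) has_integral ((E ?v - E ?u) * (y ?v - f / l) + E ?u * J)) {?u..?v}"
        by (intro has_integral_add has_integral_mult_left has_integral_mult_right EI J)
      also have "(E ?v - E ?u) * (y ?v - f / l) + E ?u * J = R ?v - R ?u - E ?u * (c * (b ?v - b ?u))"
        unfolding Jeq R_def by (simp add: algebra_simps diff_divide_distrib)
      finally have H: "((\<lambda>u. (l * E u) * (y ?v - f / l) + E ?u * (f - l * y u)) has_integral (R ?v - R ?u - E ?u * (c * (b ?v - b ?u)))) (cbox ?u ?v)"
        by simp
      have "norm (R ?v - R ?u - E ?u * (c * (b ?v - b ?u))) \<le> \<eta> * C * Henstock_Kurzweil_Integration.content (cbox ?u ?v)"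
      proof (rule has_integral_bound[OF _ H])
        show "0 \<le> \<eta> * C" using \<eta> C by simp
        fix u assume "u \<in> cbox ?u ?v"
        then have u: "?u \<le> u" "u \<le> ?v" by auto
        have in3: "u \<in> {a..a + h}" "?u \<in> {a..a + h}" "?v \<in> {a..a + h}" using u uv by auto
        have y1: "\<bar>y ?v - y u\<bar> \<le> \<eta>" using d12(3)[OF in3(1,3)] u uv dd by (auto simp: dist_real_def \<delta>_def)
        have E1: "\<bar>E u - E ?u\<bar> \<le> \<eta>" using d12(4)[OF in3(2,1)] u uv dd by (auto simp: dist_real_def \<delta>_def)
        have E2: "\<bar>E u\<bar> \<le> 1" using in3 l by (simp add: E_def)
        \<comment> \<open>In this form every summand contains an oscillation of \<open>y\<close> or
          of \<open>E\<close> over the cell, hence is of order \<eta>.\<close>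
        have eq: "(l * E u) * (y ?v - f / l) + E ?u * (f - l * y u)
            = l * (E u * (y ?v - y u) + (E u - E ?u) * y u) - f * (E u - E ?u)"
          using l by (simp add: algebra_simps)
        have "\<bar>E u * (y ?v - y u)\<bar> \<le> 1 * \<eta>" unfolding abs_mult using y1 E2 by (intro mult_mono) auto
        moreover have "\<bar>(E u - E ?u) * y u\<bar> \<le> \<eta> * B" unfolding abs_mult using E1 B(2)[OF in3(1)] \<eta> by (intro mult_mono) auto
        ultimately have "\<bar>E u * (y ?v - y u) + (E u - E ?u) * y u\<bar> \<le> \<eta> * (1 + B)"
          by (simp add: algebra_simps)
        then have "\<bar>l * (E u * (y ?v - y u) + (E u - E ?u) * y u)\<bar> \<le> l * (\<eta> * (1 + B))"
          unfolding abs_mult[of l] using l by (simp add: mult_left_mono)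
        moreover have "\<bar>f * (E u - E ?u)\<bar> \<le> \<bar>f\<bar> * \<eta>" unfolding abs_mult using E1 by (intro mult_left_mono) auto
        moreover have "l * (\<eta> * (1 + B)) + \<bar>f\<bar> * \<eta> = \<eta> * C" by (simp add: C_def algebra_simps)
        ultimately show "norm ((l * E u) * (y ?v - f / l) + E ?u * (f - l * y u)) \<le> \<eta> * C"
          unfolding eq real_norm_def by linarith
      qed
      then show ?thesis using uv by simp
    qed
    have "?S N = (\<Sum>j<Suc N. E (t j) * (c * (b (t (Suc j)) - b (t j))))"
      by (intro sum.cong refl) (simp add: E_def t_def d_def)
    moreover have "R (a + h) - R a = (\<Sum>j<Suc N. R (t (Suc j)) - R (t j))"
      by (simp only: sum_lessThan_telescope[of "\<lambda>j. R (t j)"] t(1,2))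
    ultimately have "?D - ?S N = (\<Sum>j<Suc N. R (t (Suc j)) - R (t j) - E (t j) * (c * (b (t (Suc j)) - b (t j))))"
      unfolding D by (simp only: sum_subtractf)
    then have "\<bar>?D - ?S N\<bar> \<le> (\<Sum>j<Suc N. \<eta> * C * d)"
      using err by (simp only:) (intro order_trans[OF sum_abs] sum_mono, auto)
    also have "\<dots> = \<eta> * C * h" using d by (simp add: mult.assoc mult.left_commute)
    also have "\<dots> = e / 2" using h C by (simp add: \<eta>_def)
    also have "\<dots> < e" using e by simp
    finally show ?thesis by (simp only: real_norm_def abs_minus_commute)
  qed
  then show "\<exists>no. \<forall>N\<ge>no. norm (?S N - ?D) < e" by blast
qed

text \<open>The preceding lemma with the deterministic driver \<open>b u = u\<close>, rate
  \<open>2 * l\<close> and \<open>f = 0\<close>; the solution \<open>y\<close> of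
  \<open>y' = 1 - 2 l y\<close> is the variance function.\<close>

lemma convolution_variance_limit:
  fixes l h :: real
  assumes l: "0 < l" and h: "0 < h"
  shows "(\<lambda>N. \<Sum>j<Suc N. (exp (- l * (h - real j * (h / real (Suc N)))))\<^sup>2 * (h / real (Suc N)))
    \<longlonglongrightarrow> (1 - exp (- 2 * l * h)) / (2 * l)"
proof -
  define y where "y u = (1 - exp (- (2 * l) * u)) / (2 * l)" for u
  have I: "((\<lambda>u. 0 - 2 * l * y u) has_integral (y r - y 0 - 1 * (r - 0))) {0..r}" if "r \<in> {0..0 + h}" for r
  proof -
    have "((\<lambda>u. 0 - 2 * l * y u) has_integral ((y r - r) - (y 0 - 0))) {0..r}"
      using that l unfolding y_def by (intro fundamental_theorem_of_calculus)
        (auto intro!: derivative_eq_intros simp: has_real_derivative_iff_has_vector_derivative[symmetric])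
    moreover have "(y r - r) - (y 0 - 0) = y r - y 0 - 1 * (r - 0)" by simp
    ultimately show ?thesis by (simp only:)
  qed
  have "continuous_on {0..0 + h} y" unfolding y_def by (intro continuous_intros) (use l in auto)
  from convolution_sum_limit[OF _ h this I] l
  have "(\<lambda>N. \<Sum>j<Suc N. exp (- (2 * l) * (h - real j * (h / real (Suc N)))) *
      (1 * ((0 + real (Suc j) * (h / real (Suc N))) - (0 + real j * (h / real (Suc N)))))) \<longlonglongrightarrow> y (0 + h) - exp (- (2 * l) * h) * y 0 - (1 - exp (- (2 * l) * h)) / (2 * l) * 0"
    by simp
  moreover have "exp (- (2 * l) * x) * (1 * ((0 + real (Suc j) * d) - (0 + real j * d))) = (exp (- l * x))\<^sup>2 * d" for j d x
    by (simp add: algebra_simps exp_double[symmetric])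
  moreover have "y (0 + h) - exp (- (2 * l) * h) * y 0 - (1 - exp (- (2 * l) * h)) / (2 * l) * 0 = (1 - exp (- 2 * l * h)) / (2 * l)"
    by (simp add: y_def)
  ultimately show ?thesis by (simp only:)
qed

text \<open>Increments over one common refinement are independent, and different blocks use disjoint
  sets of them. The condition on \<alpha> normalises each weighted sum to variance 1.\<close>

lemma (in prob_space) BM_blocks:
  fixes h :: "nat \<Rightarrow> real" and N :: nat
  assumes BM: "standard_BM M X" and h: "\<And>k. 0 < h k" and N: "0 < N"
    and \<alpha>: "\<And>k j. 0 < \<alpha> k j" "\<And>k. (\<Sum>j<N. (\<alpha> k j)\<^sup>2 * (h k / real N)) = 1"
  defines "a \<equiv> \<lambda>k. \<Sum>i<k. h i"
  defines "g \<equiv> \<lambda>k \<omega>. \<Sum>j<N. \<alpha> k j * (X (a k + real (Suc j) * (h k / real N)) \<omega> - X (a k + real j * (h k / real N)) \<omega>)"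
  shows "indep_vars (\<lambda>_. borel) g {..K}" "distributed M lborel (g k) std_normal_density"
proof -
  \<comment> \<open>The blocks, each cut into \<open>N\<close> equal cells, are numbered
    consecutively: index \<open>k * N + j\<close> is node \<open>j\<close> of block
    \<open>k\<close>. The block lengths need not agree.\<close>
  define T where "T l = (\<Sum>i<l. h (i div N) / real N)" for l
  have Tj: "T (k * N + j) = T (k * N) + real j * (h k / real N)" if "j \<le> N" for k j
    using that
  proof (induction j)
    case (Suc j)
    then have "(k * N + j) div N = k" using N by (simp add: div_nat_eqI)
    with Suc show ?case by (simp add: T_def algebra_simps add_divide_distrib)
  qed simp
  have Ta: "T (k * N) = a k" for k
  proof (induction k)
    case (Suc k)
    have "T (Suc k * N) = T (k * N + N)" by (simp add: add.commute)
    also have "\<dots> = a k + h k" using Tj[of N k] Suc N by simp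
    finally show ?case by (simp add: a_def)
  qed (simp add: T_def a_def)
  have T: "T (k * N + j) = a k + real j * (h k / real N)" if "j \<le> N" for k j
    using Tj[OF that] Ta by simp
  have T0: "0 \<le> T 0" by (simp add: T_def)
  have Tm: "0 \<le> T l" "T l < T (Suc l)" "T (Suc l) - T l = h (l div N) / real N" for l
  proof -
    have "0 \<le> h i / real N" for i using h[of i] by simp
    then show "0 \<le> T l" by (simp add: T_def sum_nonneg)
    show "T (Suc l) - T l = h (l div N) / real N" by (simp add: T_def)
    then show "T l < T (Suc l)" using divide_pos_pos[OF h[of "l div N"], of "real N"] N by simp
  qed
  define D where "D l \<omega> = X (T (Suc l)) \<omega> - X (T l) \<omega>" for l \<omega>
  have ind: "indep_vars (\<lambda>_. borel) D {..<L}" for L :: nat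
    using BM T0 Tm unfolding standard_BM_def D_def by blast
  have Dn: "distributed M lborel (D l) (normal_density 0 (sqrt (h (l div N) / real N)))" for l
    using BM Tm(1,2)[of l] unfolding standard_BM_def D_def[abs_def] Tm(3)[symmetric] by blast
  define blk where "blk k = {k * N..<k * N + N}" for k
  have blk_div: "l div N = k" "k * N + (l - k * N) = l" "l - k * N < N" if "l \<in> blk k" for l k
    using that N by (auto simp: blk_def mult.commute intro!: div_nat_eqI)
  have geq: "g k \<omega> = (\<Sum>l\<in>blk k. \<alpha> k (l - k * N) * D l \<omega>)" for k \<omega>
  proof -
    have "g k \<omega> = (\<Sum>j<N. \<alpha> k j * D (k * N + j) \<omega>)"
      unfolding g_def D_def using T[of _ k] by (intro sum.cong refl) (simp add: T[of "Suc _", simplified])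
    also have "\<dots> = (\<Sum>l\<in>blk k. \<alpha> k (l - k * N) * D l \<omega>)"
      by (intro sum.reindex_bij_witness[of _ "\<lambda>l. l - k * N" "\<lambda>j. k * N + j"]) (auto simp: blk_def)
    finally show ?thesis .
  qed
  have blk_sub: "blk k \<subseteq> {..<Suc K * N}" if "k \<le> K" for k K
  proof
    fix l assume "l \<in> blk k"
    then have "l < k * N + N" by (simp add: blk_def)
    also have "\<dots> \<le> K * N + N" using that by simp
    finally show "l \<in> {..<Suc K * N}" by (simp add: add.commute)
  qed
  have "disjoint_family_on blk {..K}"
    unfolding disjoint_family_on_def using blk_div(1) by blast
  from indep_vars_restrict[OF ind[of "Suc K * N"] _ this]
  have "indep_vars (\<lambda>k. PiM (blk k) (\<lambda>_. borel)) (\<lambda>k \<omega>. restrict (\<lambda>l. D l \<omega>) (blk k)) {..K}"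
    using blk_sub by auto
  then have "indep_vars (\<lambda>_. borel) (\<lambda>k \<omega>. \<Sum>l\<in>blk k. \<alpha> k (l - k * N) * restrict (\<lambda>l. D l \<omega>) (blk k) l) {..K}"
    by (rule indep_vars_compose2[where Y = "\<lambda>k x. \<Sum>l\<in>blk k. \<alpha> k (l - k * N) * x l"])
       (auto intro!: borel_measurable_sum borel_measurable_times measurable_component_singleton)
  then show "indep_vars (\<lambda>_. borel) g {..K}"
    by (rule indep_vars_cong[THEN iffD1, rotated 3]) (auto simp: geq)
  have bne: "finite (blk k)" "blk k \<noteq> {}" using N by (auto simp: blk_def)
  have sc: "distributed M lborel (\<lambda>\<omega>. \<alpha> k (l - k * N) * D l \<omega>) (normal_density 0 (\<alpha> k (l - k * N) * sqrt (h k / real N)))"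
    if "l \<in> blk k" for l
    using normal_density_affine[OF Dn[of l], of "\<alpha> k (l - k * N)" 0] \<alpha>(1)[of k "l - k * N"] h N blk_div(1)[OF that] by simp
  have "distributed M lborel (\<lambda>\<omega>. \<Sum>l\<in>blk k. \<alpha> k (l - k * N) * D l \<omega>)
     (normal_density (\<Sum>l\<in>blk k. 0) (sqrt (\<Sum>l\<in>blk k. (\<alpha> k (l - k * N) * sqrt (h k / real N))\<^sup>2)))"
  proof (rule sum_indep_normal[OF bne])
    show "indep_vars (\<lambda>_. borel) (\<lambda>l \<omega>. \<alpha> k (l - k * N) * D l \<omega>) (blk k)"
      by (rule indep_vars_compose2[OF indep_vars_subset[OF ind blk_sub[OF order_refl]]]) simp
    show "0 < \<alpha> k (l - k * N) * sqrt (h k / real N)" for l using \<alpha>(1) h N by simp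
  qed (rule sc)
  moreover have "(\<Sum>l\<in>blk k. (\<alpha> k (l - k * N) * sqrt (h k / real N))\<^sup>2) = 1"
  proof -
    have "(\<Sum>l\<in>blk k. (\<alpha> k (l - k * N) * sqrt (h k / real N))\<^sup>2) = (\<Sum>j<N. (\<alpha> k j)\<^sup>2 * (h k / real N))"
      using h[of k] N
      by (intro sum.reindex_bij_witness[of _ "\<lambda>j. k * N + j" "\<lambda>l. l - k * N"]) (auto simp: blk_def power_mult_distrib)
    then show ?thesis using \<alpha>(2) by simp
  qed
  ultimately show "distributed M lborel (g k) std_normal_density"
    unfolding geq[abs_def] by simp
qed

section \<open>Probability bounds uniform in time\<close>

context aee_noise
begin

section \<open>The solution as a chain with Gaussian noise\<close>

lemma AEE_coord:
  fixes M :: "'w measure" and \<beta> :: "nat \<Rightarrow> real \<Rightarrow> 'w \<Rightarrow> real" and Y :: "real \<Rightarrow> 'w \<Rightarrow> L2"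
  assumes S: "AEE_solution M \<beta> F Qh n \<tau> \<epsilon> 0 Y"
  shows "AE \<omega> in M. \<forall>i\<in>{1..n}. \<forall>t\<ge>0.
    ((\<lambda>u. inner (F (Y (grid \<tau> u) \<omega>)) (eb i) - lam i * inner (Y u \<omega>) (eb i)) has_integral
      (inner (Y t \<omega>) (eb i) - \<epsilon> * sqrt (q i) * \<beta> i t \<omega>)) {0..t}"
proof -
  have Y: "Y t \<in> measurable M (restrict_space borel (Hn n))" if "0 \<le> t" for t
    using S that by (auto simp: AEE_solution_def)
  have "AE \<omega> in M. \<forall>t\<ge>0.
        ((\<lambda>s. Pn n (A_op (Y s \<omega>)) + Pn n (F (Y (grid \<tau> s) \<omega>))) has_integral
           (Y t \<omega> - 0 - \<epsilon> *\<^sub>R Pn n (Qh (Wn n \<beta> t \<omega>)))) {0..t}"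
    using S by (auto simp: AEE_solution_def)
  with AE_space show ?thesis
  proof eventually_elim
    case (elim \<omega>)
    have YH: "Y t \<omega> \<in> Hn n" if "0 \<le> t" for t
      using measurable_space[OF Y[OF that] elim(1)] by (simp add: space_restrict_space)
    show ?case
    proof (intro ballI allI impI)
      fix i t assume i: "i \<in> {1..n}" and t: "0 \<le> (t::real)"
      have A: "inner (Pn n (A_op (Y s \<omega>))) (eb i) = - lam i * inner (Y s \<omega>) (eb i)" if "0 \<le> s" for s
      proof -
        have "A_op (Y s \<omega>) = (\<Sum>i=1..n. (- lam i * inner (Y s \<omega>) (eb i)) *\<^sub>R eb i)"
          by (subst Hn_expand[OF YH[OF that]]) (rule A_op_eb_sum)
        then show ?thesis using i by (simp only: inner_Pn inner_eb_sum)
      qed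
      have W: "inner (Pn n (Qh (Wn n \<beta> t \<omega>))) (eb i) = sqrt (q i) * \<beta> i t \<omega>"
        using i by (simp only: inner_Pn) (simp add: inner_Qh Wn_def inner_eb_sum)
      have "((\<lambda>s. inner (Pn n (A_op (Y s \<omega>)) + Pn n (F (Y (grid \<tau> s) \<omega>))) (eb i)) has_integral
           inner (Y t \<omega> - 0 - \<epsilon> *\<^sub>R Pn n (Qh (Wn n \<beta> t \<omega>))) (eb i)) {0..t}"
        using has_integral_linear[OF elim(2)[rule_format, OF t] bounded_linear_inner_left[of "eb i"]]
        by (simp only: o_def)
      then have "((\<lambda>s. inner (Pn n (A_op (Y s \<omega>)) + Pn n (F (Y (grid \<tau> s) \<omega>))) (eb i)) has_integral
           (inner (Y t \<omega>) (eb i) - \<epsilon> * sqrt (q i) * \<beta> i t \<omega>)) {0..t}"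
        by (simp only: inner_diff_left inner_scaleR_left W diff_zero mult.assoc)
      then show "((\<lambda>u. inner (F (Y (grid \<tau> u) \<omega>)) (eb i) - lam i * inner (Y u \<omega>) (eb i)) has_integral
        (inner (Y t \<omega>) (eb i) - \<epsilon> * sqrt (q i) * \<beta> i t \<omega>)) {0..t}"
        by (rule has_integral_eq[rotated]) (use A i in \<open>simp add: inner_add_left inner_Pn\<close>)
    qed
  qed
qed

text \<open>The noise is defined as the normalised residual of each step, so the chain identity is
  algebra. The substance is that the residuals are limits of independent standard Gaussian families,
  jointly over steps and modes.\<close>

lemma AEE_representation:
  fixes M :: "'w measure" and \<beta> :: "nat \<Rightarrow> real \<Rightarrow> 'w \<Rightarrow> real" and Y :: "real \<Rightarrow> 'w \<Rightarrow> L2"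
  assumes M: "prob_space M" and W: "cylindrical_wiener M \<beta>"
    and S: "AEE_solution M \<beta> F Qh n \<tau> \<epsilon> 0 Y" and eps: "0 < \<epsilon>" and s: "0 < s" "s \<le> \<tau>"
  obtains \<zeta> where "prob_space.gauss_limit M ({..K} \<times> {1..n}) \<zeta>"
    "AE \<omega> in M. Y (real K * \<tau> + s) \<omega> = endpt 0 K s (\<lambda>k i. \<epsilon> * \<zeta> (k, i) \<omega>)"
proof -
  interpret prob_space M by (rule M)
  define h where "h k = (if k < K then \<tau> else s)" for k
  have hp: "0 < h k" "h k \<le> \<tau>" for k using tau s by (auto simp: h_def)
  define \<zeta> where "\<zeta> p \<omega> = inner (Y (real (fst p) * \<tau> + h (fst p)) \<omega> - stepmap (h (fst p)) (Y (real (fst p) * \<tau>) \<omega>)) (eb (snd p))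
      / (\<epsilon> * sd (h (fst p)) (snd p))" for p \<omega>
  have Y: "Y t \<in> measurable M (restrict_space borel (Hn n))" if "0 \<le> t" for t
    using S that by (auto simp: AEE_solution_def)
  have Yb: "Y t \<in> measurable M borel" if "0 \<le> t" for t
    using Y[OF that] by (simp add: measurable_restrict_space2_iff)
  have t0: "0 \<le> real k * \<tau>" "0 \<le> real k * \<tau> + h k" for k using tau hp(1)[of k] by simp_all
  have cI: "continuous_on UNIV (\<lambda>x::L2. inner x (eb i))" "continuous_on UNIV (\<lambda>x. inner (stepmap r x) (eb i))" for i r
  proof -
    show "continuous_on UNIV (\<lambda>x::L2. inner x (eb i))" by (intro continuous_intros)
    have "continuous_on UNIV (stepmap r)"
      unfolding continuous_on_def by (auto intro!: tendsto_stepmap)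
    then show "continuous_on UNIV (\<lambda>x. inner (stepmap r x) (eb i))" by (intro continuous_intros)
  qed
  have zm: "\<zeta> p \<in> borel_measurable M" for p
    unfolding \<zeta>_def inner_diff_left
    by (intro borel_measurable_divide borel_measurable_diff borel_measurable_const
        measurable_compose[OF Yb borel_measurable_continuous_onI[OF cI(1)]]
        measurable_compose[OF Yb borel_measurable_continuous_onI[OF cI(2)]] t0)
  define E where "E N k i j = exp (- lam i * (h k - real j * (h k / real (Suc N))))" for N k i j
  define v where "v N k i = (\<Sum>j<Suc N. (E N k i j)\<^sup>2 * (h k / real (Suc N)))" for N k i
  have v: "0 < v N k i" for N k i
    unfolding v_def E_def using hp(1)[of k] by (intro sum_pos) auto
  \<comment> \<open>Each approximating sum is divided by its own standard deviation, so it is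
    exactly standard normal for every \<open>N\<close>; \<open>vlim\<close> shows that the
    normalisation converges to the one in \<open>\<zeta>\<close>.\<close>
  define \<alpha> where "\<alpha> N k i j = E N k i j / sqrt (v N k i)" for N k i j
  have \<alpha>: "0 < \<alpha> N k i j" "(\<Sum>j<Suc N. (\<alpha> N k i j)\<^sup>2 * (h k / real (Suc N))) = 1" for N k i j
  proof -
    show "0 < \<alpha> N k i j" using v[of N k i] by (simp add: \<alpha>_def E_def)
    have "(\<Sum>j<Suc N. (\<alpha> N k i j)\<^sup>2 * (h k / real (Suc N))) = (\<Sum>j<Suc N. ((E N k i j)\<^sup>2 * (h k / real (Suc N))) / v N k i)"
      using v[of N k i] by (intro sum.cong refl) (simp add: \<alpha>_def power_divide)
    also have "\<dots> = 1" unfolding sum_divide_distrib[symmetric] v_def[symmetric] using v[of N k i] by simp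
    finally show "(\<Sum>j<Suc N. (\<alpha> N k i j)\<^sup>2 * (h k / real (Suc N))) = 1" .
  qed
  define a where "a k = (\<Sum>i<k. h i)" for k
  have a: "a k = real k * \<tau>" if "k \<le> K" for k
    using that by (induction k) (auto simp: a_def h_def algebra_simps)
  have a0: "0 \<le> a k" for k unfolding a_def using hp(1) by (intro sum_nonneg) (simp add: less_imp_le)
  define u where "u N k j = a k + real j * (h k / real (Suc N))" for N k j
  have u0: "0 \<le> u N k j" for N k j using a0[of k] hp(1)[of k] by (simp add: u_def)
  \<comment> \<open>Independence of the modes is given for whole paths, so each weighted sum is
    expressed as a functional \<open>H\<close> of a path.\<close>
  define P where "P i \<omega> = (\<lambda>t\<in>{0..}. \<beta> i t \<omega>)" for i \<omega>
  define H where "H N i k x = (\<Sum>j<Suc N. \<alpha> N k i j * (x (u N k (Suc j)) - x (u N k j)))"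
    for N i k and x :: "real \<Rightarrow> real"
  define g where "g N p \<omega> = H N (snd p) (fst p) (P (snd p) \<omega>)" for N p \<omega>
  have HP: "H N i k (P i \<omega>) = (\<Sum>j<Suc N. \<alpha> N k i j * (\<beta> i (a k + real (Suc j) * (h k / real (Suc N))) \<omega> - \<beta> i (a k + real j * (h k / real (Suc N))) \<omega>))" for N i k \<omega>
    unfolding H_def P_def using u0 by (simp only: restrict_def u_def atLeast_iff if_True)
  have BM: "standard_BM M (\<beta> i)" if "i \<in> {1..n}" for i
    using W that by (auto simp: cylindrical_wiener_def)
  have ind1: "indep_vars (\<lambda>_. borel) (\<lambda>k \<omega>. H N i k (P i \<omega>)) {..K}"
    and dist1: "distributed M lborel (\<lambda>\<omega>. H N i k (P i \<omega>)) std_normal_density" if "i \<in> {1..n}" for N i k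
  proof -
    note B = BM_blocks[OF BM[OF that], of h "Suc N" "\<lambda>k j. \<alpha> N k i j"]
    have pre: "\<And>k. 0 < h k" "0 < Suc N" "\<And>k j. 0 < \<alpha> N k i j"
      "\<And>k. (\<Sum>j<Suc N. (\<alpha> N k i j)\<^sup>2 * (h k / real (Suc N))) = 1"
      using hp(1) \<alpha> by auto
    show "indep_vars (\<lambda>_. borel) (\<lambda>k \<omega>. H N i k (P i \<omega>)) {..K}"
      unfolding HP a_def by (rule B(1)[OF pre])
    show "distributed M lborel (\<lambda>\<omega>. H N i k (P i \<omega>)) std_normal_density"
      unfolding HP a_def by (rule B(2)[OF pre])
  qed
  have "indep_vars (\<lambda>_. PiM {0..} (\<lambda>_. borel)) P {1..n}"
    unfolding P_def[abs_def]
    by (rule indep_vars_subset[of _ _ "{1..}"]) (use W in \<open>auto simp: cylindrical_wiener_def\<close>)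
  then have ind: "indep_vars (\<lambda>_. borel) (g N) ({..K} \<times> {1..n})" for N
    unfolding g_def
  proof (rule indep_vars_pairs)
    fix i k
    show "H N i k \<in> borel_measurable (PiM {0..} (\<lambda>_. borel))"
      unfolding H_def using u0
      by (intro borel_measurable_sum borel_measurable_times borel_measurable_diff borel_measurable_const
          measurable_component_singleton) auto
  qed (use n1 ind1 in auto)
  have dist: "distributed M lborel (g N p) std_normal_density" if "p \<in> {..K} \<times> {1..n}" for N p
    unfolding g_def using dist1 that by auto
  have vlim: "(\<lambda>N. sqrt (q i) * sqrt (v N k i)) \<longlonglongrightarrow> sd (h k) i" if "i \<in> {1..n}" for i k
  proof -
    have "(\<lambda>N. v N k i) \<longlonglongrightarrow> (1 - exp (- 2 * lam i * h k)) / (2 * lam i)"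
      unfolding v_def E_def using convolution_variance_limit[OF lam_pos hp(1)] that by auto
    then have "(\<lambda>N. sqrt (q i) * sqrt (v N k i)) \<longlonglongrightarrow> sqrt (q i) * sqrt ((1 - exp (- 2 * lam i * h k)) / (2 * lam i))"
      by (intro tendsto_intros)
    then show ?thesis by (simp only: sd_def real_sqrt_mult)
  qed
  have cY: "AE \<omega> in M. continuous_on {0..} (\<lambda>t. Y t \<omega>)" using S by (auto simp: AEE_solution_def)
  have conv: "AE \<omega> in M. \<forall>p\<in>{..K} \<times> {1..n}. (\<lambda>N. g N p \<omega>) \<longlonglongrightarrow> \<zeta> p \<omega>"
    using AEE_coord[OF S] cY
  proof eventually_elim
    case (elim \<omega>)
    show ?case
    proof safe
      fix k i assume k: "k \<le> K" and i: "i \<in> {1..n}"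
      have i1: "i \<ge> 1" using i by simp
      define y where "y t = inner (Y t \<omega>) (eb i)" for t
      define f where "f = inner (F (Y (a k) \<omega>)) (eb i)"
      have ak: "a k = real k * \<tau>" by (rule a[OF k])
      have cy: "continuous_on {a k..a k + h k} y"
        unfolding y_def by (intro continuous_intros continuous_on_subset[OF elim(2)]) (use a0[of k] in auto)
      have I: "((\<lambda>u. f - lam i * y u) has_integral (y r - y (a k) - \<epsilon> * sqrt (q i) * (\<beta> i r \<omega> - \<beta> i (a k) \<omega>))) {a k..r}"
        if r: "r \<in> {a k..a k + h k}" for r
      proof -
        let ?G = "\<lambda>u. inner (F (Y (grid \<tau> u) \<omega>)) (eb i) - lam i * inner (Y u \<omega>) (eb i)"
        have Ir: "(?G has_integral (inner (Y r \<omega>) (eb i) - \<epsilon> * sqrt (q i) * \<beta> i r \<omega>)) {0..r}"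
          and Ia: "(?G has_integral (inner (Y (a k) \<omega>) (eb i) - \<epsilon> * sqrt (q i) * \<beta> i (a k) \<omega>)) {0..a k}"
          using elim(1) i r a0[of k] by auto
        have "?G integrable_on {a k..r}"
          by (rule integrable_subinterval_real[OF has_integral_integrable[OF Ir]]) (use r a0[of k] in auto)
        then obtain J where J: "(?G has_integral J) {a k..r}" by blast
        have "inner (Y r \<omega>) (eb i) - \<epsilon> * sqrt (q i) * \<beta> i r \<omega> = (inner (Y (a k) \<omega>) (eb i) - \<epsilon> * sqrt (q i) * \<beta> i (a k) \<omega>) + J"
          by (rule has_integral_unique[OF Ir has_integral_combine[OF _ _ Ia J]]) (use r a0[of k] in auto)
        then have Jeq: "J = y r - y (a k) - \<epsilon> * sqrt (q i) * (\<beta> i r \<omega> - \<beta> i (a k) \<omega>)"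
          by (simp add: y_def algebra_simps)
        show ?thesis
        proof (rule has_integral_spike[OF _ _ J[unfolded Jeq], of "{a k + h k}"])
          fix u assume u: "u \<in> {a k..r} - {a k + h k}"
          then have "real k * \<tau> \<le> u" "u < real (Suc k) * \<tau>"
            using r hp(2)[of k] ak by (auto simp: distrib_right)
          then have "grid \<tau> u = a k" using grid_eq(1)[OF tau] ak by simp
          then show "f - lam i * y u = ?G u" by (simp add: f_def y_def)
        qed simp
      qed
      have "(\<lambda>N. \<Sum>j<Suc N. exp (- lam i * (h k - real j * (h k / real (Suc N)))) *
          (\<epsilon> * sqrt (q i) * (\<beta> i (a k + real (Suc j) * (h k / real (Suc N))) \<omega> - \<beta> i (a k + real j * (h k / real (Suc N))) \<omega>)))
        \<longlonglongrightarrow> y (a k + h k) - exp (- lam i * h k) * y (a k) - (1 - exp (- lam i * h k)) / lam i * f"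
        by (rule convolution_sum_limit[OF lam_pos[OF i1] hp(1) cy I])
      moreover have "y (a k + h k) - exp (- lam i * h k) * y (a k) - (1 - exp (- lam i * h k)) / lam i * f = \<epsilon> * sd (h k) i * \<zeta> (k, i) \<omega>"
        using eps sd_pos[OF hp(1) i1, of k] i
        by (simp add: \<zeta>_def ak y_def f_def inner_diff_left stepmap_coord)
      moreover have "(\<Sum>j<Suc N. exp (- lam i * (h k - real j * (h k / real (Suc N)))) *
          (\<epsilon> * sqrt (q i) * (\<beta> i (a k + real (Suc j) * (h k / real (Suc N))) \<omega> - \<beta> i (a k + real j * (h k / real (Suc N))) \<omega>)))
        = \<epsilon> * (sqrt (q i) * sqrt (v N k i)) * g N (k, i) \<omega>" for N
      proof -
        have "\<epsilon> * (sqrt (q i) * sqrt (v N k i)) * g N (k, i) \<omega> = (\<Sum>j<Suc N. \<epsilon> * (sqrt (q i) * sqrt (v N k i)) *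
          (\<alpha> N k i j * (\<beta> i (a k + real (Suc j) * (h k / real (Suc N))) \<omega> - \<beta> i (a k + real j * (h k / real (Suc N))) \<omega>)))"
          by (simp only: g_def fst_conv snd_conv HP sum_distrib_left)
        also have "\<dots> = (\<Sum>j<Suc N. E N k i j *
          (\<epsilon> * sqrt (q i) * (\<beta> i (a k + real (Suc j) * (h k / real (Suc N))) \<omega> - \<beta> i (a k + real j * (h k / real (Suc N))) \<omega>)))"
          using v[of N k i] by (intro sum.cong refl) (simp add: \<alpha>_def)
        finally show ?thesis by (simp only: E_def)
      qed
      ultimately have L: "(\<lambda>N. \<epsilon> * (sqrt (q i) * sqrt (v N k i)) * g N (k, i) \<omega>) \<longlonglongrightarrow> \<epsilon> * sd (h k) i * \<zeta> (k, i) \<omega>"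
        by (simp only:)
      have "(\<lambda>N. (\<epsilon> * (sqrt (q i) * sqrt (v N k i)) * g N (k, i) \<omega>) / (\<epsilon> * (sqrt (q i) * sqrt (v N k i))))
          \<longlonglongrightarrow> (\<epsilon> * sd (h k) i * \<zeta> (k, i) \<omega>) / (\<epsilon> * sd (h k) i)"
        using eps sd_pos[OF hp(1) i1, of k] by (intro tendsto_divide L tendsto_mult_left vlim i) auto
      moreover have "(\<epsilon> * (sqrt (q i) * sqrt (v N k i)) * g N (k, i) \<omega>) / (\<epsilon> * (sqrt (q i) * sqrt (v N k i))) = g N (k, i) \<omega>" for N
        using eps v[of N k i] qpos[OF i1] by simp
      moreover have "(\<epsilon> * sd (h k) i * \<zeta> (k, i) \<omega>) / (\<epsilon> * sd (h k) i) = \<zeta> (k, i) \<omega>"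
        using eps sd_pos[OF hp(1) i1, of k] by simp
      ultimately show "(\<lambda>N. g N (k, i) \<omega>) \<longlonglongrightarrow> \<zeta> (k, i) \<omega>" by simp
    qed
  qed
  \<comment> \<open>The Brownian motions start at 0 only almost surely; together with the equation
    at time 0 this gives the initial value of the chain.\<close>
  have b0: "AE \<omega> in M. \<forall>i\<in>{1..n}. \<beta> i 0 \<omega> = 0"
    using BM by (intro AE_finite_allI) (auto simp: standard_BM_def)
  have "gauss_limit ({..K} \<times> {1..n}) \<zeta>"
    unfolding gauss_limit_def using ind dist conv zm by (intro conjI exI[of _ g]) auto
  moreover have "AE \<omega> in M. Y (real K * \<tau> + s) \<omega> = endpt 0 K s (\<lambda>k i. \<epsilon> * \<zeta> (k, i) \<omega>)"
    using AEE_coord[OF S] AE_space b0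
  proof eventually_elim
    case (elim \<omega>)
    have YH: "Y t \<omega> \<in> Hn n" if "0 \<le> t" for t
      using measurable_space[OF Y[OF that] elim(2)] by (simp add: space_restrict_space)
    let ?z = "\<lambda>k i. \<epsilon> * \<zeta> (k, i) \<omega>"
    have step: "Y (real k * \<tau> + h k) \<omega> = stepmap (h k) (Y (real k * \<tau>) \<omega>) + kick (h k) (?z k)" for k
    proof (rule Hn_eqI[OF YH[OF t0(2)] add_in_Hn[OF stepmap_in_Hn kick_in_Hn]])
      fix i assume i: "i \<in> {1..n}"
      then show "inner (Y (real k * \<tau> + h k) \<omega>) (eb i) = inner (stepmap (h k) (Y (real k * \<tau>) \<omega>) + kick (h k) (?z k)) (eb i)"
        using eps sd_pos[OF hp(1), of i k] by (simp add: inner_add_left kick_coord \<zeta>_def inner_diff_left)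
    qed
    have Y0: "Y 0 \<omega> = 0"
    proof (rule Hn_eqI[OF YH zero_in_Hn])
      fix i assume i: "i \<in> {1..n}"
      have "((\<lambda>u. inner (F (Y (grid \<tau> u) \<omega>)) (eb i) - lam i * inner (Y u \<omega>) (eb i)) has_integral
          (inner (Y 0 \<omega>) (eb i) - \<epsilon> * sqrt (q i) * \<beta> i 0 \<omega>)) {0..0}"
        using elim(1) i by blast
      then have "inner (Y 0 \<omega>) (eb i) - \<epsilon> * sqrt (q i) * \<beta> i 0 \<omega> = 0"
        by (rule has_integral_unique) (simp add: has_integral_refl)
      then show "inner (Y 0 \<omega>) (eb i) = inner 0 (eb i)" using elim(3) i by simp
    qed simp
    have "Y (real k * \<tau>) \<omega> = chain 0 ?z k" if "k \<le> K" for k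
      using that
    proof (induction k)
      case 0 show ?case using Y0 by simp
    next
      case (Suc k)
      then show ?case using step[of k] by (simp add: h_def algebra_simps)
    qed
    then show ?case using step[of K] by (simp add: endpt_def h_def)
  qed
  ultimately show ?thesis using that by blast
qed

end

section \<open>Estimates at a fixed late time\<close>

lemma inv_sqrt_le_exp:
  fixes y :: real
  assumes "0 \<le> y" "y \<le> 1 / 2"
  shows "1 / sqrt (1 - y) \<le> exp y"
proof -
  \<comment> \<open>The product is \<open>1 + y * (1 - 2 * y)\<close>, which explains the
    restriction to \<open>y \<le> 1 / 2\<close>.\<close>
  have "1 \<le> (1 - y) * (1 + 2 * y)" using assms mult_nonneg_nonneg[of y "1 - 2 * y"] by (simp add: algebra_simps)
  also have "\<dots> \<le> (1 - y) * exp (2 * y)" using assms exp_ge_add_one_self[of "2 * y"] by (intro mult_left_mono) auto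
  also have "\<dots> = (sqrt (1 - y) * exp y)\<^sup>2" using assms by (simp add: power_mult_distrib exp_double)
  finally have "1 \<le> sqrt (1 - y) * exp y" using assms by (intro power2_le_imp_le[of 1]) auto
  then show ?thesis using assms by (simp add: field_simps)
qed

context aee_noise
begin

text \<open>The prefactor bounds an exponential moment of geometrically weighted noise. In the rate,
  4 undoes the scaling of the weights in \<open>tail_event\<close>, and the summand 1 gives a
  strictly positive denominator from \<open>noise_bd_nonneg\<close>.\<close>

definition tail :: "real \<Rightarrow> real \<Rightarrow> real" where
  "tail R \<epsilon> = exp (real n / (2 * (1 - \<rho>))) * exp (- (R\<^sup>2 / (4 * (noise_bd + 1))) / \<epsilon>\<^sup>2)"

lemma geometric_sum_le: "(\<Sum>j<k. \<rho> ^ (k - Suc j)) \<le> 1 / (1 - \<rho>)"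
proof -
  have "(\<Sum>j<k. \<rho> ^ (k - Suc j)) = (\<Sum>j<k. \<rho> ^ j)"
    by (rule sum.nat_diff_reindex)
  also have "\<dots> \<le> 1 / (1 - \<rho>)"
    using rho by (simp add: sum_gp_strict divide_right_mono)
  finally show ?thesis .
qed

text \<open>The result is an event rather than a bare probability bound, because the callers unite
  it with a second event in an almost sure inclusion.\<close>

lemma tail_event:
  assumes M: "prob_space M" and G: "prob_space.gauss_limit M ({..K} \<times> {1..n}) \<zeta>" and k: "k \<le> K"
    and eps: "0 < \<epsilon>" and R: "0 \<le> R"
  obtains T where "T \<in> sets M" "measure M T \<le> tail R \<epsilon>"
    "\<And>\<omega>. \<omega> \<in> space M - T \<Longrightarrow> norm (chain 0 (\<lambda>k i. \<epsilon> * \<zeta> (k, i) \<omega>) k) < R"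
proof -
  interpret prob_space M by (rule M)
  let ?J = "{..<k} \<times> {1..n}"
  \<comment> \<open>The weights of \<open>chain_sq_bound\<close>, divided by 4 so that
    \<open>2 * w p\<close> stays in the range of \<open>inv_sqrt_le_exp\<close>. Their geometric
    decay bounds the moment independently of \<open>k\<close>.\<close>
  define w where "w p = \<rho> ^ (k - Suc (fst p)) / 4" for p :: "nat \<times> nat"
  have w: "0 \<le> w p" "w p \<le> 1 / 4" for p
    using rho by (auto simp: w_def power_le_one)
  have GJ: "gauss_limit ?J \<zeta>" by (rule gauss_limit_subset[OF G]) (use k in auto)
  define X where "X \<omega> = (\<Sum>p\<in>?J. w p * (\<zeta> p \<omega>)\<^sup>2)" for \<omega>
  have Xm: "X \<in> borel_measurable M"
    unfolding X_def using GJ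
    by (intro borel_measurable_sum borel_measurable_times borel_measurable_const borel_measurable_power) (auto simp: gauss_limit_def)
  have "(\<Prod>p\<in>?J. 1 / sqrt (1 - 2 * w p)) \<le> (\<Prod>p\<in>?J. exp (2 * w p))"
  proof (intro prod_mono conjI)
    fix p
    have "2 * w p \<le> 1 / 2" "0 \<le> 2 * w p" using w[of p] by auto
    then show "1 / sqrt (1 - 2 * w p) \<le> exp (2 * w p)" "0 \<le> 1 / sqrt (1 - 2 * w p)"
      by (auto intro: inv_sqrt_le_exp)
  qed
  also have "\<dots> = exp (\<Sum>p\<in>?J. 2 * w p)" by (simp add: exp_sum)
  also have "(\<Sum>p\<in>?J. 2 * w p) = real n * (\<Sum>j<k. \<rho> ^ (k - Suc j)) / 2"
    by (simp add: w_def sum.cartesian_product[symmetric, of "\<lambda>j i. 2 * w (j, i)", simplified] sum_distrib_left sum_divide_distrib)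
       (simp add: sum.cartesian_product' sum_distrib_left sum_divide_distrib)
  also have "exp \<dots> \<le> exp (real n / (2 * (1 - \<rho>)))"
    using mult_left_mono[OF geometric_sum_le[of k], of "real n / 2"] rho by simp
  finally have pr: "(\<Prod>p\<in>?J. 1 / sqrt (1 - 2 * w p)) \<le> exp (real n / (2 * (1 - \<rho>)))" .
  have "(\<integral>\<^sup>+\<omega>. ennreal (exp (X \<omega>)) \<partial>M) \<le> ennreal (\<Prod>p\<in>?J. 1 / sqrt (1 - 2 * w p))"
    unfolding X_def
  proof (rule gauss_limit_exp_moment[OF GJ])
    fix p show "w p < 1 / 2" using w(2)[of p] by linarith
  qed
  also have "\<dots> \<le> ennreal (exp (real n / (2 * (1 - \<rho>))))" by (rule ennreal_leI[OF pr])
  finally have I: "(\<integral>\<^sup>+\<omega>. ennreal (exp (X \<omega>)) \<partial>M) \<le> ennreal (exp (real n / (2 * (1 - \<rho>))))" .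
  define c where "c = R\<^sup>2 / (4 * (noise_bd + 1)) / \<epsilon>\<^sup>2"
  define T where "T = {\<omega> \<in> space M. c \<le> X \<omega>}"
  have "T \<in> events" unfolding T_def using Xm by measurable
  moreover have "prob T \<le> tail R \<epsilon>"
    using exp_markov[OF Xm _ I, of c] by (simp add: T_def tail_def c_def)
  moreover have "norm (chain 0 (\<lambda>k i. \<epsilon> * \<zeta> (k, i) \<omega>) k) < R" if om: "\<omega> \<in> space M - T" for \<omega>
  proof -
    have "X \<omega> < c" using om by (auto simp: T_def)
    have X0: "0 \<le> X \<omega>" unfolding X_def using w by (intro sum_nonneg mult_nonneg_nonneg) auto
    have nb: "0 < noise_bd + 1" using noise_bd_nonneg by simp
    have "(norm (chain 0 (\<lambda>k i. \<epsilon> * \<zeta> (k, i) \<omega>) k))\<^sup>2 \<le> noise_bd * (\<Sum>j<k. \<rho> ^ (k - Suc j) * sqsum n (\<lambda>i. \<epsilon> * \<zeta> (j, i) \<omega>))"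
      by (rule chain_sq_bound)
    also have "(\<Sum>j<k. \<rho> ^ (k - Suc j) * sqsum n (\<lambda>i. \<epsilon> * \<zeta> (j, i) \<omega>)) = 4 * \<epsilon>\<^sup>2 * X \<omega>"
      by (simp add: X_def w_def sqsum_def power_mult_distrib sum_distrib_left sum.cartesian_product mult_ac split_def)
    also have "noise_bd * (4 * \<epsilon>\<^sup>2 * X \<omega>) \<le> (noise_bd + 1) * (4 * \<epsilon>\<^sup>2 * X \<omega>)"
      using X0 by (intro mult_right_mono) auto
    also have "\<dots> < (noise_bd + 1) * (4 * \<epsilon>\<^sup>2 * c)"
      using \<open>X \<omega> < c\<close> nb eps by simp
    also have "\<dots> = R\<^sup>2"
    proof -
      have "x * (4 * \<epsilon>\<^sup>2 * (R\<^sup>2 / (4 * x) / \<epsilon>\<^sup>2)) = R\<^sup>2" if "0 < x" for x using that eps by simp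
      from this[OF nb] show ?thesis by (simp only: c_def)
    qed
    finally show ?thesis using R by (rule power2_less_imp_less)
  qed
  ultimately show ?thesis using that by blast
qed

lemma endpt_restart:
  assumes s: "0 \<le> s" and m: "m \<le> K" and R: "norm (chain 0 z (K - m)) \<le> R"
  shows "norm (endpt 0 K s z - endpt 0 m s (\<lambda>k. z (K - m + k))) \<le> \<rho> ^ m * R"
proof -
  have "endpt 0 K s z = endpt (chain 0 z (K - m)) m s (\<lambda>k. z (K - m + k))"
    using endpt_shift[of 0 "K - m" m s z] m by simp
  then have "norm (endpt 0 K s z - endpt 0 m s (\<lambda>k. z (K - m + k))) \<le> \<rho> ^ m * norm (chain 0 z (K - m) - 0)"
    using endpt_contract[OF s, of "chain 0 z (K - m)" m "\<lambda>k. z (K - m + k)" 0] by simp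
  also have "\<dots> \<le> \<rho> ^ m * R" using R rho by (intro mult_left_mono) auto
  finally show ?thesis .
qed

text \<open>Off the tail event, a visit to \<open>D\<close> forces the last \<open>m + 1\<close>
  noise vectors to cost at least \<open>a\<close>. Markov's inequality applies to the exponential of
  \<theta> times their Gaussian energy, which is integrable since
  \<open>\<theta> < 1\<close>.\<close>

lemma prob_upper_bound:
  fixes M :: "'w measure"
  assumes M: "prob_space M" and W: "cylindrical_wiener M \<beta>"
    and S: "AEE_solution M \<beta> F Qh n \<tau> \<epsilon> 0 Y" and eps: "0 < \<epsilon>" and s: "0 < s" "s \<le> \<tau>"
    and m: "m \<le> K" and \<theta>: "0 < \<theta>" "\<theta> < 1" and R: "0 \<le> R"
    and D: "\<And>z v. v \<in> D \<Longrightarrow> norm (v - endpt 0 m s z) \<le> \<rho> ^ m * R \<Longrightarrow> a \<le> cost m z"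
  shows "measure M {\<omega> \<in> space M. Y (real K * \<tau> + s) \<omega> \<in> D}
    \<le> (1 / sqrt (1 - \<theta>)) ^ (Suc m * n) * exp (- \<theta> * a / \<epsilon>\<^sup>2) + tail R \<epsilon>"
proof -
  interpret prob_space M by (rule M)
  obtain \<zeta> where G: "gauss_limit ({..K} \<times> {1..n}) \<zeta>"
    and Y: "AE \<omega> in M. Y (real K * \<tau> + s) \<omega> = endpt 0 K s (\<lambda>k i. \<epsilon> * \<zeta> (k, i) \<omega>)"
    by (rule AEE_representation[OF M W S eps s])
  obtain T where T: "T \<in> events" "prob T \<le> tail R \<epsilon>"
    "\<And>\<omega>. \<omega> \<in> space M - T \<Longrightarrow> norm (chain 0 (\<lambda>k i. \<epsilon> * \<zeta> (k, i) \<omega>) (K - m)) < R"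
    using tail_event[OF M G _ eps R, of "K - m"] by auto
  let ?J = "(\<lambda>(k, i). (K - m + k, i)) ` ({..m} \<times> {1..n})"
  have inj: "inj_on (\<lambda>(k, i). (K - m + k, i)) ({..m} \<times> {1..n})" by (auto simp: inj_on_def)
  have GJ: "gauss_limit ?J \<zeta>" by (rule gauss_limit_subset[OF G]) (use m in auto)
  have card: "card ?J = Suc m * n" using inj by (simp add: card_image card_cartesian_product)
  define X where "X \<omega> = (\<Sum>p\<in>?J. (\<theta> / 2) * (\<zeta> p \<omega>)\<^sup>2)" for \<omega>
  have Xm: "X \<in> borel_measurable M"
    unfolding X_def using GJ
    by (intro borel_measurable_sum borel_measurable_times borel_measurable_const borel_measurable_power) (auto simp: gauss_limit_def)
  have "(\<integral>\<^sup>+\<omega>. ennreal (exp (X \<omega>)) \<partial>M) \<le> ennreal (\<Prod>p\<in>?J. 1 / sqrt (1 - 2 * (\<theta> / 2)))"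
    unfolding X_def by (rule gauss_limit_exp_moment[OF GJ]) (use \<theta> in auto)
  also have "(\<Prod>p\<in>?J. 1 / sqrt (1 - 2 * (\<theta> / 2))) = (1 / sqrt (1 - \<theta>)) ^ (Suc m * n)"
    using card by simp
  finally have I: "(\<integral>\<^sup>+\<omega>. ennreal (exp (X \<omega>)) \<partial>M) \<le> ennreal ((1 / sqrt (1 - \<theta>)) ^ (Suc m * n))" .
  define B where "B = {\<omega> \<in> space M. \<theta> * a / \<epsilon>\<^sup>2 \<le> X \<omega>}"
  have Bm: "B \<in> events" unfolding B_def using Xm by measurable
  have PB: "prob B \<le> (1 / sqrt (1 - \<theta>)) ^ (Suc m * n) * exp (- \<theta> * a / \<epsilon>\<^sup>2)"
    using exp_markov[OF Xm _ I, of "\<theta> * a / \<epsilon>\<^sup>2"] \<theta> by (simp add: B_def)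
  have "prob {\<omega> \<in> space M. Y (real K * \<tau> + s) \<omega> \<in> D} \<le> prob (B \<union> T)"
  proof (rule finite_measure_mono_AE)
    show "AE \<omega> in M. \<omega> \<in> {\<omega> \<in> space M. Y (real K * \<tau> + s) \<omega> \<in> D} \<longrightarrow> \<omega> \<in> B \<union> T"
      using Y
    proof eventually_elim
      case (elim \<omega>)
      show ?case
      proof (intro impI)
        assume om: "\<omega> \<in> {\<omega> \<in> space M. Y (real K * \<tau> + s) \<omega> \<in> D}"
        show "\<omega> \<in> B \<union> T"
        proof (rule ccontr)
          assume nBT: "\<omega> \<notin> B \<union> T"
          let ?z = "\<lambda>k i. \<epsilon> * \<zeta> (k, i) \<omega>"
          have "norm (chain 0 ?z (K - m)) \<le> R" using T(3)[of \<omega>] om nBT by auto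
          from endpt_restart[OF _ m this, of s]
          have "norm (Y (real K * \<tau> + s) \<omega> - endpt 0 m s (\<lambda>k. ?z (K - m + k))) \<le> \<rho> ^ m * R"
            using elim s by simp
          then have "a \<le> cost m (\<lambda>k. ?z (K - m + k))" using D om by blast
          also have "\<dots> = \<epsilon>\<^sup>2 / \<theta> * X \<omega>"
            unfolding X_def sum.reindex[OF inj] cost_def sqsum_def using \<theta>
            by (simp add: power_mult_distrib sum_distrib_left sum_divide_distrib sum.cartesian_product split_def)
          finally have "a * \<theta> \<le> \<epsilon>\<^sup>2 * X \<omega>" using \<theta> by (simp add: field_simps)
          then have "\<theta> * a / \<epsilon>\<^sup>2 \<le> X \<omega>" using eps by (simp add: field_simps)
          then show False using nBT om by (simp add: B_def)
        qed
      qed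
    qed
  qed (use Bm T in auto)
  also have "\<dots> \<le> prob B + prob T" using Bm T(1) by (rule measure_Un_le)
  finally show ?thesis using PB T(2) by linarith
qed

text \<open>If the last \<open>m + 1\<close> noise vectors lie in a box around \<open>z0\<close> and
  the tail event does not occur, the solution is close to \<open>u\<close>. The box has size
  \<open>r / \<epsilon>\<close> in terms of the unscaled noise.\<close>

lemma prob_lower_bound:
  fixes M :: "'w measure"
  assumes M: "prob_space M" and W: "cylindrical_wiener M \<beta>"
    and S: "AEE_solution M \<beta> F Qh n \<tau> \<epsilon> 0 Y" and eps: "0 < \<epsilon>" and s: "0 < s" "s \<le> \<tau>"
    and m: "m \<le> K" and R: "0 \<le> R" and r: "0 < r" "\<epsilon> \<le> 2 * r / sqrt (2 * pi)"
    and D: "\<And>z. (\<And>k i. k \<le> m \<Longrightarrow> i \<in> {1..n} \<Longrightarrow> \<bar>z k i - z0 k i\<bar> \<le> r) \<Longrightarrow> norm (endpt 0 m s z - u) + \<rho> ^ m * R \<le> \<delta>"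
  shows "exp (- ((\<Sum>k\<le>m. \<Sum>i=1..n. (\<bar>z0 k i\<bar> + r)\<^sup>2) / 2) / \<epsilon>\<^sup>2) - tail R \<epsilon>
    \<le> measure M {\<omega> \<in> space M. norm (Y (real K * \<tau> + s) \<omega> - u) \<le> \<delta>}"
proof -
  interpret prob_space M by (rule M)
  obtain \<zeta> where G: "gauss_limit ({..K} \<times> {1..n}) \<zeta>"
    and Y: "AE \<omega> in M. Y (real K * \<tau> + s) \<omega> = endpt 0 K s (\<lambda>k i. \<epsilon> * \<zeta> (k, i) \<omega>)"
    by (rule AEE_representation[OF M W S eps s])
  obtain T where T: "T \<in> events" "prob T \<le> tail R \<epsilon>"
    "\<And>\<omega>. \<omega> \<in> space M - T \<Longrightarrow> norm (chain 0 (\<lambda>k i. \<epsilon> * \<zeta> (k, i) \<omega>) (K - m)) < R"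
    using tail_event[OF M G _ eps R, of "K - m"] by auto
  let ?\<iota> = "\<lambda>(k, i). (K - m + k, i)"
  let ?J = "?\<iota> ` ({..m} \<times> {1..n})"
  have inj: "inj_on ?\<iota> ({..m} \<times> {1..n})" by (auto simp: inj_on_def)
  have GJ: "gauss_limit ?J \<zeta>" by (rule gauss_limit_subset[OF G]) (use m in auto)
  define x where "x p = z0 (fst p - (K - m)) (snd p) / \<epsilon>" for p :: "nat \<times> nat"
  define A where "A = {\<omega> \<in> space M. \<forall>p\<in>?J. \<bar>\<zeta> p \<omega> - x p\<bar> \<le> r / \<epsilon>}"
  have Am: "A \<in> events"
    unfolding A_def using GJ
    by (intro sets.sets_Collect_finite_All') (use n1 in \<open>auto simp: gauss_limit_def intro!: borel_measurable_le borel_measurable_abs borel_measurable_diff\<close>)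
  have "exp (- ((\<Sum>k\<le>m. \<Sum>i=1..n. (\<bar>z0 k i\<bar> + r)\<^sup>2) / 2) / \<epsilon>\<^sup>2)
      = (\<Prod>p\<in>{..m} \<times> {1..n}. exp (- ((\<bar>z0 (fst p) (snd p)\<bar> + r)\<^sup>2 / 2) / \<epsilon>\<^sup>2))"
    by (simp add: exp_sum[symmetric] sum_negf sum_divide_distrib sum.cartesian_product split_def)
  also have "\<dots> \<le> (\<Prod>p\<in>{..m} \<times> {1..n}. 2 * (r / \<epsilon>) / sqrt (2 * pi) * exp (- (\<bar>x (?\<iota> p)\<bar> + r / \<epsilon>)\<^sup>2 / 2))"
  proof (intro prod_mono conjI)
    fix p assume "p \<in> {..m} \<times> {1..n}"
    have "\<bar>x (?\<iota> p)\<bar> + r / \<epsilon> = (\<bar>z0 (fst p) (snd p)\<bar> + r) / \<epsilon>"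
      using eps by (simp add: x_def split_def add_divide_distrib)
    then have e: "- (\<bar>x (?\<iota> p)\<bar> + r / \<epsilon>)\<^sup>2 / 2 = - ((\<bar>z0 (fst p) (snd p)\<bar> + r)\<^sup>2 / 2) / \<epsilon>\<^sup>2"
      by (simp only: power_divide) simp
    have "1 \<le> 2 * (r / \<epsilon>) / sqrt (2 * pi)" using r(2) eps by (simp add: field_simps)
    then show "exp (- ((\<bar>z0 (fst p) (snd p)\<bar> + r)\<^sup>2 / 2) / \<epsilon>\<^sup>2) \<le> 2 * (r / \<epsilon>) / sqrt (2 * pi) * exp (- (\<bar>x (?\<iota> p)\<bar> + r / \<epsilon>)\<^sup>2 / 2)"
      unfolding e by (metis exp_ge_zero mult_1 mult_right_mono)
  qed simp
  also have "\<dots> = (\<Prod>p\<in>?J. 2 * (r / \<epsilon>) / sqrt (2 * pi) * exp (- (\<bar>x p\<bar> + r / \<epsilon>)\<^sup>2 / 2))"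
    unfolding prod.reindex[OF inj] by (simp add: o_def)
  also have "\<dots> \<le> prob A"
    unfolding A_def by (rule gauss_limit_box_lower[OF GJ]) (use n1 r eps in auto)
  finally have PA: "exp (- ((\<Sum>k\<le>m. \<Sum>i=1..n. (\<bar>z0 k i\<bar> + r)\<^sup>2) / 2) / \<epsilon>\<^sup>2) \<le> prob A" .
  have "Y (real K * \<tau> + s) \<in> measurable M (restrict_space borel (Hn n))"
    using S s tau by (auto simp: AEE_solution_def)
  then have Ym: "Y (real K * \<tau> + s) \<in> measurable M borel" by (simp add: measurable_restrict_space2_iff)
  have "continuous_on UNIV (\<lambda>v::L2. norm (v - u))" by (intro continuous_intros)
  from measurable_compose[OF Ym borel_measurable_continuous_onI[OF this]]
  have Em: "{\<omega> \<in> space M. norm (Y (real K * \<tau> + s) \<omega> - u) \<le> \<delta>} \<in> events" by measurable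
  have "prob A \<le> prob ({\<omega> \<in> space M. norm (Y (real K * \<tau> + s) \<omega> - u) \<le> \<delta>} \<union> T)"
  proof (rule finite_measure_mono_AE)
    show "AE \<omega> in M. \<omega> \<in> A \<longrightarrow> \<omega> \<in> {\<omega> \<in> space M. norm (Y (real K * \<tau> + s) \<omega> - u) \<le> \<delta>} \<union> T"
      using Y
    proof eventually_elim
      case (elim \<omega>)
      show ?case
      proof (intro impI)
        assume om: "\<omega> \<in> A"
        show "\<omega> \<in> {\<omega> \<in> space M. norm (Y (real K * \<tau> + s) \<omega> - u) \<le> \<delta>} \<union> T"
        proof (rule ccontr)
          assume nT: "\<not> ?thesis"
          let ?z = "\<lambda>k i. \<epsilon> * \<zeta> (k, i) \<omega>"
          let ?z' = "\<lambda>k. ?z (K - m + k)"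
          have "norm (chain 0 ?z (K - m)) \<le> R" using T(3)[of \<omega>] om nT by (auto simp: A_def)
          from endpt_restart[OF _ m this, of s]
          have 1: "norm (Y (real K * \<tau> + s) \<omega> - endpt 0 m s ?z') \<le> \<rho> ^ m * R"
            using elim s by simp
          have "norm (endpt 0 m s ?z' - u) + \<rho> ^ m * R \<le> \<delta>"
          proof (rule D)
            fix k i assume ki: "k \<le> m" "i \<in> {1..n}"
            then have "(K - m + k, i) \<in> ?J" by force
            then have "\<bar>\<zeta> (K - m + k, i) \<omega> - x (K - m + k, i)\<bar> \<le> r / \<epsilon>" using om by (auto simp: A_def)
            then have "\<epsilon> * \<bar>\<zeta> (K - m + k, i) \<omega> - x (K - m + k, i)\<bar> \<le> r" using eps by (simp add: pos_le_divide_eq mult.commute)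
            moreover have "\<epsilon> * \<bar>\<zeta> (K - m + k, i) \<omega> - x (K - m + k, i)\<bar> = \<bar>\<epsilon> * (\<zeta> (K - m + k, i) \<omega> - x (K - m + k, i))\<bar>"
              using eps by (simp add: abs_mult)
            moreover have "\<epsilon> * (\<zeta> (K - m + k, i) \<omega> - x (K - m + k, i)) = ?z' k i - z0 k i"
              using eps by (simp add: x_def right_diff_distrib)
            ultimately show "\<bar>?z' k i - z0 k i\<bar> \<le> r" by simp
          qed
          with 1 have "norm (Y (real K * \<tau> + s) \<omega> - u) \<le> \<delta>"
            using norm_triangle_ineq[of "Y (real K * \<tau> + s) \<omega> - endpt 0 m s ?z'" "endpt 0 m s ?z' - u"] by simp
          then show False using nT om by (simp add: A_def)
        qed
      qed
    qed
  qed (use Em T in auto)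
  also have "\<dots> \<le> prob {\<omega> \<in> space M. norm (Y (real K * \<tau> + s) \<omega> - u) \<le> \<delta>} + prob T"
    using Em T(1) by (rule measure_Un_le)
  finally show ?thesis using PA T(2) by linarith
qed

end

section \<open>Time averages and their weak limits\<close>

lemma time_average_emeasure:
  assumes M: "prob_space M" and Y: "\<And>t. 0 \<le> t \<Longrightarrow> Y t \<in> measurable M (restrict_space borel (Hn n))"
    and t: "0 < t" and nz: "emeasure (time_average M n Y t) (Hn n) \<noteq> 0"
  shows "prob_space (time_average M n Y t)"
    "B \<in> sets (restrict_space borel (Hn n)) \<Longrightarrow> emeasure (time_average M n Y t) B =
       (\<integral>\<^sup>+ s\<in>{0..t}. emeasure M {\<omega> \<in> space M. Y s \<omega> \<in> B} \<partial>lborel) / ennreal t"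
proof -
  interpret prob_space M by (rule M)
  let ?\<mu> = "\<lambda>B. (\<integral>\<^sup>+ s\<in>{0..t}. emeasure M {\<omega> \<in> space M. Y s \<omega> \<in> B} \<partial>lborel) / ennreal t"
  let ?A = "sets (restrict_space borel (Hn n))"
  have sp: "space (restrict_space borel (Hn n)) = Hn n" by (simp add: space_restrict_space)
  have sig: "sigma_sets (Hn n) ?A = ?A"
    using sets.sigma_sets_eq[of "restrict_space borel (Hn n)"] by (simp add: sp)
  have sub: "?A \<subseteq> Pow (Hn n)" using sets.space_closed[of "restrict_space borel (Hn n)"] by (simp add: sp)
  have conv: "emeasure (time_average M n Y t) X = (if X \<in> ?A \<and> measure_space (Hn n) ?A ?\<mu> then ?\<mu> X else 0)" for X
    unfolding time_average_def by (subst emeasure_measure_of_conv) (use sub in \<open>simp add: sig\<close>)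
  \<comment> \<open>The nonzero value excludes the default branch of
    \<open>measure_of\<close>.\<close>
  have ms: "measure_space (Hn n) ?A ?\<mu>"
    using nz unfolding conv by (auto split: if_splits)
  show e: "emeasure (time_average M n Y t) B = ?\<mu> B" if "B \<in> ?A" for B
    using that ms by (simp add: conv)
  have "emeasure M {\<omega> \<in> space M. Y s \<omega> \<in> Hn n} * indicator {0..t} s = indicator {0..t} s" for s
  proof (cases "0 \<le> s")
    case True
    have "{\<omega> \<in> space M. Y s \<omega> \<in> Hn n} = space M"
      using measurable_space[OF Y[OF True]] by (auto simp: sp)
    then show ?thesis by (simp add: emeasure_space_1)
  qed simp
  then have "(\<integral>\<^sup>+ s\<in>{0..t}. emeasure M {\<omega> \<in> space M. Y s \<omega> \<in> Hn n} \<partial>lborel) = ennreal t"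
    using t by simp
  moreover have "Hn n \<in> ?A" using sets.top[of "restrict_space borel (Hn n)"] by (simp add: sp)
  ultimately have "emeasure (time_average M n Y t) (Hn n) = 1"
    using e t by (simp add: ennreal_divide_self)
  moreover have "space (time_average M n Y t) = Hn n"
    unfolding time_average_def by (rule space_measure_of[OF sub])
  ultimately show "prob_space (time_average M n Y t)" by (intro prob_spaceI) simp
qed

lemma sets_time_average: "sets (time_average M n Y t) = sets (restrict_space borel (Hn n))"
proof -
  have sp: "space (restrict_space borel (Hn n)) = Hn n" by (simp add: space_restrict_space)
  have "sets (time_average M n Y t) = sigma_sets (Hn n) (sets (restrict_space borel (Hn n)))"
    unfolding time_average_def
    using sets.space_closed[of "restrict_space borel (Hn n)"] by (intro sets_measure_of) (simp add: sp)
  then show ?thesis using sets.sigma_sets_eq[of "restrict_space borel (Hn n)"] by (simp add: sp)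
qed

definition averaging_times :: "'w measure \<Rightarrow> nat \<Rightarrow> (real \<Rightarrow> 'w \<Rightarrow> L2) \<Rightarrow> L2 measure \<Rightarrow> (nat \<Rightarrow> real) \<Rightarrow> bool" where
  "averaging_times M n Y N t \<longleftrightarrow> filterlim t at_top sequentially \<and> (\<forall>k. 0 < t k) \<and>
     (\<forall>f :: L2 \<Rightarrow> real. continuous_on (Hn n) f \<longrightarrow> bounded (f ` Hn n) \<longrightarrow>
       (\<lambda>k. integral\<^sup>L (time_average M n Y (t k)) f) \<longlonglongrightarrow> integral\<^sup>L N f) \<and>
     (\<forall>\<^sub>F k in sequentially. prob_space (time_average M n Y (t k)) \<and> (\<forall>B\<in>sets (restrict_space borel (Hn n)).
       emeasure (time_average M n Y (t k)) B =
         (\<integral>\<^sup>+ s\<in>{0..t k}. emeasure M {\<omega> \<in> space M. Y s \<omega> \<in> B} \<partial>lborel) / ennreal (t k)))"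

text \<open>Measurability of \<open>s \<mapsto> P(Y(s) \<in> B)\<close> is never needed: if the set function of a time average were not
  a measure, \<open>measure_of\<close> would yield the null measure, which is excluded along the sequence because the
  total masses converge to 1.\<close>

lemma averaging_times_exist:
  assumes M: "prob_space M" and Y: "\<And>t. 0 \<le> t \<Longrightarrow> Y t \<in> measurable M (restrict_space borel (Hn n))"
    and L: "time_average_limit M n Y N"
  shows "\<exists>t. averaging_times M n Y N t"
proof -
  from L obtain t where t: "filterlim t at_top sequentially" "\<And>k. 0 < t k"
    "weak_limit (Hn n) (\<lambda>k. time_average M n Y (t k)) N"
    unfolding time_average_limit_def by blast
  from t(3) have N: "borel_prob (Hn n) N" and lim: "\<And>f :: L2 \<Rightarrow> real. continuous_on (Hn n) f \<Longrightarrow> bounded (f ` Hn n) \<Longrightarrow>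
       (\<lambda>k. integral\<^sup>L (time_average M n Y (t k)) f) \<longlonglongrightarrow> integral\<^sup>L N f"
    unfolding weak_limit_def by blast+
  interpret N: prob_space N using N by (simp add: borel_prob_def)
  have "(\<lambda>k. integral\<^sup>L (time_average M n Y (t k)) (\<lambda>_. 1)) \<longlonglongrightarrow> integral\<^sup>L N (\<lambda>_. 1::real)"
    by (intro lim) (auto simp: bounded_iff intro!: exI[of _ 1])
  then have "(\<lambda>k. integral\<^sup>L (time_average M n Y (t k)) (\<lambda>_. 1::real)) \<longlonglongrightarrow> 1"
    by (simp add: N.prob_space)
  from order_tendstoD(1)[OF this zero_less_one]
  have ev: "\<forall>\<^sub>F k in sequentially. 0 < measure (time_average M n Y (t k)) (space (time_average M n Y (t k)))"
    by simp
  have "\<forall>\<^sub>F k in sequentially. prob_space (time_average M n Y (t k)) \<and> (\<forall>B\<in>sets (restrict_space borel (Hn n)).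
       emeasure (time_average M n Y (t k)) B =
         (\<integral>\<^sup>+ s\<in>{0..t k}. emeasure M {\<omega> \<in> space M. Y s \<omega> \<in> B} \<partial>lborel) / ennreal (t k))"
    using ev
  proof eventually_elim
    case (elim k)
    have "space (time_average M n Y (t k)) = Hn n"
      using sets_eq_imp_space_eq[OF sets_time_average] by (simp add: space_restrict_space)
    then have "emeasure (time_average M n Y (t k)) (Hn n) \<noteq> 0"
      using elim by (auto simp: measure_def)
    from time_average_emeasure[OF M Y t(2) this] show ?case by blast
  qed
  with t lim have "averaging_times M n Y N t" unfolding averaging_times_def by blast
  then show ?thesis by blast
qed

lemma integrable_bounded_Hn:
  fixes f :: "L2 \<Rightarrow> real"
  assumes N: "prob_space N" "sets N = sets (restrict_space borel (Hn n))" and f: "continuous_on (Hn n) f"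
    and b: "\<And>x. x \<in> Hn n \<Longrightarrow> 0 \<le> f x \<and> f x \<le> 1"
  shows "integrable N f"
proof -
  interpret prob_space N by (rule N)
  have sp: "space N = Hn n" using sets_eq_imp_space_eq[OF N(2)] by (simp add: space_restrict_space)
  have "f \<in> borel_measurable (restrict_space borel (Hn n))"
    by (rule borel_measurable_continuous_on_restrict[OF f])
  then have "f \<in> borel_measurable N" using measurable_cong_sets[OF N(2) refl] by blast
  then show ?thesis by (rule integrable_const_bound[rotated, of _ 1]) (use b sp in auto)
qed

text \<open>A continuous function below the indicator of \<open>D\<close> passes to the weak limit,
  where the measure of \<open>D\<close> itself might not. The initial time up to \<open>T0\<close>
  contributes at most \<open>T0 / t k\<close>, which tends to 0.\<close>

lemma time_average_limit_upper:
  fixes f :: "L2 \<Rightarrow> real"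
  assumes M: "prob_space M" and Y: "\<And>t. 0 \<le> t \<Longrightarrow> Y t \<in> measurable M (restrict_space borel (Hn n))"
    and L: "time_average_limit M n Y N" and T0: "0 \<le> T0" and p: "0 \<le> p"
    and D: "D \<in> sets (restrict_space borel (Hn n))" "\<And>t. T0 < t \<Longrightarrow> measure M {\<omega> \<in> space M. Y t \<omega> \<in> D} \<le> p"
    and f: "continuous_on (Hn n) f" "\<And>x. x \<in> Hn n \<Longrightarrow> 0 \<le> f x \<and> f x \<le> 1" "\<And>x. x \<in> Hn n \<Longrightarrow> x \<notin> D \<Longrightarrow> f x = 0"
  shows "integral\<^sup>L N f \<le> p"
proof -
  interpret prob_space M by (rule M)
  obtain t where T: "averaging_times M n Y N t" using averaging_times_exist[OF M Y L] by blast
  then have t: "filterlim t at_top sequentially" "\<And>k. 0 < t k"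
    and lim: "\<And>f :: L2 \<Rightarrow> real. continuous_on (Hn n) f \<Longrightarrow> bounded (f ` Hn n) \<Longrightarrow>
       (\<lambda>k. integral\<^sup>L (time_average M n Y (t k)) f) \<longlonglongrightarrow> integral\<^sup>L N f"
    and ev: "\<forall>\<^sub>F k in sequentially. prob_space (time_average M n Y (t k)) \<and> (\<forall>B\<in>sets (restrict_space borel (Hn n)).
       emeasure (time_average M n Y (t k)) B =
         (\<integral>\<^sup>+ s\<in>{0..t k}. emeasure M {\<omega> \<in> space M. Y s \<omega> \<in> B} \<partial>lborel) / ennreal (t k))"
    unfolding averaging_times_def by blast+
  have fl: "(\<lambda>k. integral\<^sup>L (time_average M n Y (t k)) f) \<longlonglongrightarrow> integral\<^sup>L N f"
    using f by (intro lim) (auto simp: bounded_iff intro!: exI[of _ 1])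
  have "\<forall>\<^sub>F k in sequentially. integral\<^sup>L (time_average M n Y (t k)) f \<le> T0 / t k + p"
    using ev
  proof eventually_elim
    case (elim k)
    let ?\<nu> = "time_average M n Y (t k)"
    interpret \<nu>: prob_space ?\<nu> using elim by blast
    have sp: "space ?\<nu> = Hn n"
      using sets_eq_imp_space_eq[OF sets_time_average] by (simp add: space_restrict_space)
    have Dm: "D \<in> sets ?\<nu>" using D(1) by (simp add: sets_time_average)
    have "integral\<^sup>L ?\<nu> f \<le> integral\<^sup>L ?\<nu> (indicator D)"
    proof (rule integral_mono)
      show "integrable ?\<nu> f" by (rule integrable_bounded_Hn[OF \<nu>.prob_space_axioms sets_time_average f(1,2)])
      show "integrable ?\<nu> (indicator D :: L2 \<Rightarrow> real)" using Dm by (simp add: \<nu>.emeasure_eq_measure)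
      fix x assume "x \<in> space ?\<nu>"
      then show "f x \<le> indicator D x" using f(2,3)[of x] sp by (auto simp: indicator_def)
    qed
    also have "\<dots> = measure ?\<nu> D" using Dm sets.sets_into_space[OF Dm] by (simp add: Int_absorb2)
    also have "ennreal (measure ?\<nu> D) \<le> ennreal (T0 / t k + p)"
    proof -
      have "ennreal (measure ?\<nu> D) = (\<integral>\<^sup>+ s\<in>{0..t k}. emeasure M {\<omega> \<in> space M. Y s \<omega> \<in> D} \<partial>lborel) / ennreal (t k)"
        using elim D(1) by (simp add: \<nu>.emeasure_eq_measure[symmetric])
      also have "\<dots> \<le> (ennreal T0 + ennreal p * ennreal (t k)) / ennreal (t k)"
      proof (rule divide_right_mono_ennreal)
        have "(\<integral>\<^sup>+ s\<in>{0..t k}. emeasure M {\<omega> \<in> space M. Y s \<omega> \<in> D} \<partial>lborel)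
          \<le> (\<integral>\<^sup>+ s. indicator {0..T0} s + ennreal p * indicator {0..t k} s \<partial>lborel)"
        proof (rule nn_integral_mono)
          fix s :: real
          show "emeasure M {\<omega> \<in> space M. Y s \<omega> \<in> D} * indicator {0..t k} s \<le> indicator {0..T0} s + ennreal p * indicator {0..t k} s"
          proof (cases "T0 < s")
            case True
            then show ?thesis using D(2)[OF True] by (auto simp: emeasure_eq_measure indicator_def ennreal_leI)
          next
            case False
            have "emeasure M {\<omega> \<in> space M. Y s \<omega> \<in> D} \<le> 1" by (simp add: emeasure_eq_measure)
            then show ?thesis using False by (auto simp: indicator_def intro: order_trans)
          qed
        qed
        also have "\<dots> = ennreal T0 + ennreal p * ennreal (t k)"
          using T0 t(2)[of k] by (simp add: nn_integral_add nn_integral_cmult)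
        finally show "(\<integral>\<^sup>+ s\<in>{0..t k}. emeasure M {\<omega> \<in> space M. Y s \<omega> \<in> D} \<partial>lborel) \<le> ennreal T0 + ennreal p * ennreal (t k)" .
      qed
      also have "\<dots> = ennreal (T0 / t k + p)"
        using T0 p t(2)[of k] by (simp add: ennreal_mult[symmetric] ennreal_plus[symmetric] divide_ennreal add_divide_distrib del: ennreal_plus)
      finally show ?thesis .
    qed
    then have "measure ?\<nu> D \<le> T0 / t k + p"
      using T0 p t(2)[of k] by (subst (asm) ennreal_le_iff) auto
    finally show ?case .
  qed
  moreover have "(\<lambda>k. T0 / t k + p) \<longlonglongrightarrow> 0 + p"
    by (intro tendsto_add tendsto_const tendsto_divide_0[OF tendsto_const] filterlim_at_top_imp_at_infinity t)
  ultimately show ?thesis using tendsto_le[OF sequentially_bot _ fl] by auto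
qed

text \<open>Only phases between \<open>s1\<close> and \<open>s2\<close> are controlled in each
  period from index \<open>m\<close> on; these windows fill the fraction
  \<open>(s2 - s1) / \<tau>\<close> of a long time interval.\<close>

lemma time_average_limit_lower:
  fixes f :: "L2 \<Rightarrow> real"
  assumes M: "prob_space M" and Y: "\<And>t. 0 \<le> t \<Longrightarrow> Y t \<in> measurable M (restrict_space borel (Hn n))"
    and L: "time_average_limit M n Y N" and s: "0 \<le> s1" "s1 < s2" "s2 \<le> \<tau>" and p: "0 \<le> p"
    and D: "D \<in> sets (restrict_space borel (Hn n))"
      "\<And>K s. m \<le> K \<Longrightarrow> s1 < s \<Longrightarrow> s \<le> s2 \<Longrightarrow> p \<le> measure M {\<omega> \<in> space M. Y (real K * \<tau> + s) \<omega> \<in> D}"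
    and f: "continuous_on (Hn n) f" "\<And>x. x \<in> Hn n \<Longrightarrow> 0 \<le> f x \<and> f x \<le> 1" "\<And>x. x \<in> D \<Longrightarrow> f x = 1"
  shows "p * ((s2 - s1) / \<tau>) \<le> integral\<^sup>L N f"
proof -
  interpret prob_space M by (rule M)
  have tau: "0 < \<tau>" using s by simp
  obtain t where T: "averaging_times M n Y N t" using averaging_times_exist[OF M Y L] by blast
  then have t: "filterlim t at_top sequentially" "\<And>k. 0 < t k"
    and lim: "\<And>f :: L2 \<Rightarrow> real. continuous_on (Hn n) f \<Longrightarrow> bounded (f ` Hn n) \<Longrightarrow>
       (\<lambda>k. integral\<^sup>L (time_average M n Y (t k)) f) \<longlonglongrightarrow> integral\<^sup>L N f"
    and ev: "\<forall>\<^sub>F k in sequentially. prob_space (time_average M n Y (t k)) \<and> (\<forall>B\<in>sets (restrict_space borel (Hn n)).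
       emeasure (time_average M n Y (t k)) B =
         (\<integral>\<^sup>+ s\<in>{0..t k}. emeasure M {\<omega> \<in> space M. Y s \<omega> \<in> B} \<partial>lborel) / ennreal (t k))"
    unfolding averaging_times_def by blast+
  have fl: "(\<lambda>k. integral\<^sup>L (time_average M n Y (t k)) f) \<longlonglongrightarrow> integral\<^sup>L N f"
    using f by (intro lim) (auto simp: bounded_iff intro!: exI[of _ 1])
  \<comment> \<open>The loss \<open>(1 + real m) / t k\<close> accounts for the first
    \<open>m\<close> periods and an incomplete last one.\<close>
  have "\<forall>\<^sub>F k in sequentially. p * (s2 - s1) * (1 / \<tau> - (1 + real m) / t k) \<le> integral\<^sup>L (time_average M n Y (t k)) f"
    using ev
  proof eventually_elim
    case (elim k)
    let ?\<nu> = "time_average M n Y (t k)"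
    interpret \<nu>: prob_space ?\<nu> using elim by blast
    have sp: "space ?\<nu> = Hn n"
      using sets_eq_imp_space_eq[OF sets_time_average] by (simp add: space_restrict_space)
    have Dm: "D \<in> sets ?\<nu>" using D(1) by (simp add: sets_time_average)
    define Kt where "Kt = nat \<lfloor>t k / \<tau>\<rfloor>"
    have Kt: "real Kt * \<tau> \<le> t k" "t k / \<tau> - 1 \<le> real Kt"
    proof -
      have "0 \<le> t k / \<tau>" using t(2)[of k] tau by simp
      then have "real Kt = of_int \<lfloor>t k / \<tau>\<rfloor>" by (simp add: Kt_def)
      then have "real Kt \<le> t k / \<tau>" "t k / \<tau> - 1 \<le> real Kt" by linarith+
      then show "real Kt * \<tau> \<le> t k" "t k / \<tau> - 1 \<le> real Kt" using tau by (simp_all add: pos_le_divide_eq)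
    qed
    define I where "I K = {real K * \<tau> + s1<..real K * \<tau> + s2}" for K
    define U where "U = (\<Union>K\<in>{m..<Kt}. I K)"
    have disj: "disjoint_family_on I {m..<Kt}"
      unfolding disjoint_family_on_def
    proof (intro ballI impI)
      fix K K' :: nat assume "K \<noteq> K'"
      have "I K \<inter> I K' = {}" if "K < K'" for K K'
      proof -
        have "real (Suc K) * \<tau> \<le> real K' * \<tau>" using that tau by (intro mult_right_mono) auto
        then show ?thesis using s by (auto simp: I_def distrib_right)
      qed
      then show "I K \<inter> I K' = {}" using \<open>K \<noteq> K'\<close> by (metis inf_commute linorder_neqE_nat)
    qed
    have Usub: "U \<subseteq> {0..t k}"
    proof
      fix x assume "x \<in> U"
      then obtain K where K: "m \<le> K" "K < Kt" "real K * \<tau> + s1 < x" "x \<le> real K * \<tau> + s2" by (auto simp: U_def I_def)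
      have "real (Suc K) * \<tau> \<le> real Kt * \<tau>" using K tau by (intro mult_right_mono) auto
      then have "x \<le> t k" using K s Kt by (simp add: distrib_right)
      moreover have "0 \<le> real K * \<tau>" using tau by simp
      then have "0 \<le> x" using K s by linarith
      ultimately show "x \<in> {0..t k}" by simp
    qed
    have Im: "I K \<in> sets lborel" for K by (simp add: I_def)
    have Um: "U \<in> sets lborel" unfolding U_def using Im by (intro sets.finite_UN) auto
    have "emeasure lborel U = (\<Sum>K\<in>{m..<Kt}. emeasure lborel (I K))"
      unfolding U_def using Im disj by (intro sum_emeasure[symmetric]) auto
    also have "\<dots> = (\<Sum>K\<in>{m..<Kt}. ennreal (s2 - s1))" using s by (intro sum.cong) (auto simp: I_def)
    also have "\<dots> = ennreal (real (Kt - m) * (s2 - s1))"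
      using s by (simp add: ennreal_mult ennreal_of_nat_eq_real_of_nat)
    finally have eU: "emeasure lborel U = ennreal (real (Kt - m) * (s2 - s1))" .
    have "ennreal (p * (real (Kt - m) * (s2 - s1)) / t k) = (\<integral>\<^sup>+ x. ennreal p * indicator U x \<partial>lborel) / ennreal (t k)"
      using Um eU p s t(2)[of k] by (simp add: nn_integral_cmult_indicator ennreal_mult[symmetric] divide_ennreal)
    also have "\<dots> \<le> (\<integral>\<^sup>+ x\<in>{0..t k}. emeasure M {\<omega> \<in> space M. Y x \<omega> \<in> D} \<partial>lborel) / ennreal (t k)"
    proof (intro divide_right_mono_ennreal nn_integral_mono)
      fix x :: real
      show "ennreal p * indicator U x \<le> emeasure M {\<omega> \<in> space M. Y x \<omega> \<in> D} * indicator {0..t k} x"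
      proof (cases "x \<in> U")
        case True
        then obtain K where K: "m \<le> K" "real K * \<tau> + s1 < x" "x \<le> real K * \<tau> + s2" by (auto simp: U_def I_def)
        have "p \<le> prob {\<omega> \<in> space M. Y x \<omega> \<in> D}"
          using D(2)[OF K(1), of "x - real K * \<tau>"] K by simp
        then show ?thesis using True Usub by (auto simp: emeasure_eq_measure ennreal_leI)
      qed simp
    qed
    also have "\<dots> = ennreal (measure ?\<nu> D)"
      using elim D(1) by (simp add: \<nu>.emeasure_eq_measure[symmetric])
    finally have le: "p * (real (Kt - m) * (s2 - s1)) / t k \<le> measure ?\<nu> D" by simp
    have "p * (s2 - s1) * (1 / \<tau> - (1 + real m) / t k) = p * ((t k / \<tau> - 1 - real m) * (s2 - s1)) / t k"
      using t(2)[of k] tau by (simp add: field_simps)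
    also have "\<dots> \<le> p * (real (Kt - m) * (s2 - s1)) / t k"
      using t(2)[of k] p s Kt(2) by (intro divide_right_mono mult_left_mono mult_right_mono) auto
    also note le
    also have "measure ?\<nu> D = integral\<^sup>L ?\<nu> (indicator D)" using Dm sets.sets_into_space[OF Dm] by (simp add: Int_absorb2)
    also have "\<dots> \<le> integral\<^sup>L ?\<nu> f"
    proof (rule integral_mono)
      show "integrable ?\<nu> f" by (rule integrable_bounded_Hn[OF \<nu>.prob_space_axioms sets_time_average f(1,2)])
      show "integrable ?\<nu> (indicator D :: L2 \<Rightarrow> real)" using Dm by (simp add: \<nu>.emeasure_eq_measure)
      fix x assume "x \<in> space ?\<nu>"
      then show "indicator D x \<le> f x" using f(2,3)[of x] sp by (auto simp: indicator_def)
    qed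
    finally show ?case .
  qed
  moreover have "(\<lambda>k. p * (s2 - s1) * (1 / \<tau> - (1 + real m) / t k)) \<longlonglongrightarrow> p * (s2 - s1) * (1 / \<tau> - 0)"
    by (intro tendsto_mult tendsto_diff tendsto_const tendsto_divide_0[OF tendsto_const] filterlim_at_top_imp_at_infinity t)
  ultimately have "p * (s2 - s1) * (1 / \<tau> - 0) \<le> integral\<^sup>L N f"
    using tendsto_le[OF sequentially_bot fl] by auto
  then show ?thesis by simp
qed

section \<open>The large deviations principle\<close>

lemma eventually_inverse_square_ge: "\<forall>\<^sub>F \<epsilon> in at_right (0::real). 0 < \<epsilon> \<and> X \<le> 1 / \<epsilon>\<^sup>2"
proof -
  define b where "b = 1 / (1 + \<bar>X\<bar>)"
  have b: "0 < b" "b \<le> 1" by (simp_all add: b_def)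
  have "\<forall>\<^sub>F \<epsilon> in at_right (0::real). \<epsilon> \<in> {0<..<b}" using b by (rule_tac eventually_at_right_real) simp
  then show ?thesis
  proof eventually_elim
    case (elim \<epsilon>)
    have "\<epsilon>\<^sup>2 \<le> b"
      using elim b mult_mono[of \<epsilon> b \<epsilon> 1] by (simp add: power2_eq_square)
    then have "(1 + \<bar>X\<bar>) * \<epsilon>\<^sup>2 \<le> 1" by (simp add: b_def field_simps)
    moreover have "X \<le> 1 + \<bar>X\<bar>" by simp
    from mult_right_mono[OF this, of "\<epsilon>\<^sup>2"] have "X * \<epsilon>\<^sup>2 \<le> (1 + \<bar>X\<bar>) * \<epsilon>\<^sup>2" by simp
    ultimately have "X * \<epsilon>\<^sup>2 \<le> 1" by linarith
    then show ?case using elim by (simp add: field_simps)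
  qed
qed

locale aee_ldp = aee_noise +
  fixes M :: "'w measure" and \<beta> :: "nat \<Rightarrow> real \<Rightarrow> 'w \<Rightarrow> real"
    and Y :: "real \<Rightarrow> real \<Rightarrow> 'w \<Rightarrow> L2" and \<mu> :: "real \<Rightarrow> L2 measure"
  assumes M: "prob_space M" and W: "cylindrical_wiener M \<beta>"
    and S: "\<And>\<epsilon>. 0 < \<epsilon> \<Longrightarrow> AEE_solution M \<beta> F Qh n \<tau> \<epsilon> 0 (Y \<epsilon>)"
    and L: "\<And>\<epsilon>. 0 < \<epsilon> \<Longrightarrow> time_average_limit M n (Y \<epsilon>) (\<mu> \<epsilon>)"
begin

lemma Y_measurable: "0 < \<epsilon> \<Longrightarrow> 0 \<le> t \<Longrightarrow> Y \<epsilon> t \<in> measurable M (restrict_space borel (Hn n))"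
  using S by (auto simp: AEE_solution_def)

lemma mu_borel_prob: "0 < \<epsilon> \<Longrightarrow> borel_prob (Hn n) (\<mu> \<epsilon>)"
  using L by (auto simp: time_average_limit_def weak_limit_def)

lemma mu_prob: "0 < \<epsilon> \<Longrightarrow> prob_space (\<mu> \<epsilon>)"
  and mu_sets: "0 < \<epsilon> \<Longrightarrow> sets (\<mu> \<epsilon>) = sets (restrict_space borel (Hn n))"
  using mu_borel_prob by (auto simp: borel_prob_def)

lemma mu_space: "0 < \<epsilon> \<Longrightarrow> space (\<mu> \<epsilon>) = Hn n"
  using sets_eq_imp_space_eq[OF mu_sets] by (simp add: space_restrict_space)

lemma closed_Int_Hn_sets: "closed C \<Longrightarrow> C \<inter> Hn n \<in> sets (restrict_space borel (Hn n))"
  by (auto simp: sets_restrict_space)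

lemma power_small:
  assumes "0 \<le> R" "0 < d"
  obtains m where "\<And>k. m \<le> k \<Longrightarrow> \<rho> ^ k * R \<le> d"
proof -
  obtain m where m: "\<rho> ^ m < d / (R + 1)"
    using real_arch_pow_inv[of "d / (R + 1)" \<rho>] assms rho by auto
  have "\<rho> ^ k * R \<le> d" if "m \<le> k" for k
  proof -
    have "\<rho> ^ k \<le> \<rho> ^ m" using that rho by (intro power_decreasing) auto
    then have "\<rho> ^ k * R \<le> \<rho> ^ m * R" using assms by (intro mult_right_mono) auto
    also have "\<dots> \<le> \<rho> ^ m * (R + 1)" using rho by (intro mult_left_mono) auto
    also have "\<dots> \<le> d" using m assms by (simp add: field_simps)
    finally show ?thesis .
  qed
  then show ?thesis using that by blast
qed

text \<open>Choosing the level this way prescribes the exponential rate \<open>a\<close> of the tail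
  event.\<close>

lemma tail_sqrt:
  assumes "0 \<le> a"
  shows "tail (sqrt (4 * (noise_bd + 1) * a)) \<epsilon> = exp (real n / (2 * (1 - \<rho>))) * exp (- a / \<epsilon>\<^sup>2)"
proof -
  have nb: "0 < noise_bd + 1" using noise_bd_nonneg by simp
  have "4 * (noise_bd + 1) * a / (4 * (noise_bd + 1)) = a"
    by (rule nonzero_mult_div_cancel_left) (use nb in simp)
  moreover have "(sqrt (4 * (noise_bd + 1) * a))\<^sup>2 = 4 * (noise_bd + 1) * a"
    using nb assms by (intro real_sqrt_pow2 mult_nonneg_nonneg) auto
  ultimately show ?thesis by (simp only: tail_def)
qed

text \<open>A compact sublevel set disjoint from the closed set \<open>C\<close> has a positive
  distance from it. An approximate visit to \<open>C\<close> is therefore impossible for a path of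
  smaller cost, once the restart error is below that distance.\<close>

lemma mu_upper:
  assumes C: "closed C" "C \<subseteq> Hn n" and a: "ereal a < (INF x\<in>C. qpot x)"
  shows "\<forall>\<^sub>F \<epsilon> in at_right 0. measure (\<mu> \<epsilon>) C \<le> exp (- a / \<epsilon>\<^sup>2)"
proof -
  have Cs: "C \<in> sets (restrict_space borel (Hn n))"
    using closed_Int_Hn_sets[OF C(1)] C(2) by (simp add: Int_absorb2)
  \<comment> \<open>\<open>infdist\<close> to the empty set has the default value 0, and
    \<open>compact_sublevel\<close> requires a nonnegative level; in these cases the bound is
    trivial.\<close>
  consider "C = {}" | "a < 0" | "C \<noteq> {}" "0 \<le> a" by linarith
  then show ?thesis
  proof cases
    case 1 then show ?thesis by simp
  next
    case 2
    show ?thesis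
      using eventually_inverse_square_ge[of 0]
    proof eventually_elim
      case (elim \<epsilon>)
      interpret N: prob_space "\<mu> \<epsilon>" using mu_prob elim by blast
      have "0 \<le> - a / \<epsilon>\<^sup>2" using 2 elim by (intro divide_nonneg_pos) auto
      then have "1 \<le> exp (- a / \<epsilon>\<^sup>2)" by simp
      then show ?case using N.prob_le_1[of C] by linarith
    qed
  next
    case 3
    obtain a1 where a1: "a < a1" "ereal a1 < (INF x\<in>C. qpot x)"
      using ereal_dense2[OF a] by auto
    \<comment> \<open>The midpoint between \<open>a / a1\<close> and 1: below 1 for integrability,
      yet \<open>\<theta> * a1\<close> still exceeds \<open>a\<close>.\<close>
    define \<theta> where "\<theta> = (1 + a / a1) / 2"
    have a1p: "0 < a1" using 3 a1 by simp
    have \<theta>: "0 < \<theta>" "\<theta> < 1" "a < \<theta> * a1"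
    proof -
      have "0 \<le> a / a1" "a / a1 < 1" using 3 a1 by simp_all
      then show "0 < \<theta>" "\<theta> < 1" by (simp_all add: \<theta>_def)
      show "a < \<theta> * a1" using a1 a1p by (simp add: \<theta>_def field_simps)
    qed
    let ?S = "{u. qpot u \<le> ereal a1}"
    have CS: "x \<notin> C" if "x \<in> ?S" for x
    proof
      assume "x \<in> C"
      then have "(INF x\<in>C. qpot x) \<le> qpot x" by (rule INF_lower)
      then show False using a1(2) that by simp
    qed
    obtain d where d: "0 < d" "\<And>x. x \<in> ?S \<Longrightarrow> d \<le> infdist x C"
    proof (cases "?S = {}")
      case True then show ?thesis using that[of 1] by auto
    next
      case False
      have "continuous_on ?S (\<lambda>x. infdist x C)" by (intro continuous_on_infdist continuous_on_id)
      from continuous_attains_inf[OF compact_sublevel[OF less_imp_le[OF a1p]] False this]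
      obtain x0 where x0: "x0 \<in> ?S" "\<And>x. x \<in> ?S \<Longrightarrow> infdist x0 C \<le> infdist x C"
        by blast
      have "0 < infdist x0 C"
        using CS[OF x0(1)] C(1) 3(1) by (intro infdist_pos_not_in_closed) auto
      then show ?thesis using that x0(2) by blast
    qed
    define R where "R = sqrt (4 * (noise_bd + 1) * a1)"
    have R: "0 \<le> R" using noise_bd_nonneg a1p by (simp add: R_def)
    obtain m where m: "\<And>k. m \<le> k \<Longrightarrow> \<rho> ^ k * R \<le> d / 3"
      by (rule power_small[OF R, of "d / 3"]) (use d in auto)
    define D where "D = {v. infdist v C \<le> d / 3} \<inter> Hn n"
    have Ds: "D \<in> sets (restrict_space borel (Hn n))"
      unfolding D_def by (intro closed_Int_Hn_sets closed_Collect_le continuous_intros)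
    \<comment> \<open>One third of \<open>d\<close> is spent on the enlargement \<open>D\<close> of
      \<open>C\<close>, one third on the restart error; the remaining third gives the
      contradiction.\<close>
    have cost: "a1 \<le> cost m z" if v: "v \<in> D" "norm (v - endpt 0 m s z) \<le> \<rho> ^ m * R" and s: "0 < s" "s \<le> \<tau>" for s z v
    proof (rule ccontr)
      assume "\<not> a1 \<le> cost m z"
      then have "qpot (endpt 0 m s z) \<le> ereal a1"
        using qpot_endpt_le[of s m z] s by (simp add: order_trans[of _ "ereal (cost m z)"])
      then have "d \<le> infdist (endpt 0 m s z) C" using d(2) by simp
      also have "\<dots> \<le> infdist v C + dist (endpt 0 m s z) v" by (rule infdist_triangle)
      also have "\<dots> \<le> d / 3 + d / 3"
        using v m[of m] by (intro add_mono) (auto simp: D_def dist_norm norm_minus_commute)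
      finally show False using d(1) by simp
    qed
    define c1 where "c1 = (1 / sqrt (1 - \<theta>)) ^ (Suc m * n)"
    define c2 where "c2 = exp (real n / (2 * (1 - \<rho>)))"
    have c: "0 < c1" "0 < c2" using \<theta> by (simp_all add: c1_def c2_def)
    define f where "f v = max 0 (1 - 3 * infdist v C / d)" for v
    have fc: "continuous_on (Hn n) f" unfolding f_def by (intro continuous_intros) (use d in auto)
    have f01: "0 \<le> f v \<and> f v \<le> 1" for v using d by (simp add: f_def infdist_nonneg)
    have f0: "f v = 0" if "v \<in> Hn n" "v \<notin> D" for v
      using that d by (auto simp: f_def D_def field_simps max_def)
    have f1: "f v = 1" if "v \<in> C" for v using that by (simp add: f_def)
    \<comment> \<open>The excess rate \<open>\<theta> * a1 - a\<close> absorbs the prefactors once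
      \<open>1 / \<epsilon>^2\<close> exceeds this value.\<close>
    define X where "X = ln (c1 + c2) / (\<theta> * a1 - a)"
    show ?thesis
      using eventually_inverse_square_ge[of X]
    proof eventually_elim
      case (elim \<epsilon>)
      then have eps: "0 < \<epsilon>" and x: "X \<le> 1 / \<epsilon>\<^sup>2" by auto
      interpret N: prob_space "\<mu> \<epsilon>" by (rule mu_prob[OF eps])
      define p where "p = c1 * exp (- \<theta> * a1 / \<epsilon>\<^sup>2) + c2 * exp (- a1 / \<epsilon>\<^sup>2)"
      have "measure M {\<omega> \<in> space M. Y \<epsilon> t \<omega> \<in> D} \<le> p" if t: "real (Suc m) * \<tau> < t" for t
      proof -
        have "0 \<le> real (Suc m) * \<tau>" using tau by simp
        with t have t0: "0 < t" by linarith
        obtain K s where K: "0 < s" "s \<le> \<tau>" "t = real K * \<tau> + s" by (rule horizon_cases[OF tau t0])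
        have "real (Suc m) * \<tau> = real m * \<tau> + \<tau>" by (simp add: distrib_right)
        with t K have "real m * \<tau> < real K * \<tau>" by linarith
        then have mK: "m \<le> K" using tau by simp
        have "measure M {\<omega> \<in> space M. Y \<epsilon> (real K * \<tau> + s) \<omega> \<in> D}
            \<le> (1 / sqrt (1 - \<theta>)) ^ (Suc m * n) * exp (- \<theta> * a1 / \<epsilon>\<^sup>2) + tail R \<epsilon>"
          by (rule prob_upper_bound[OF M W S[OF eps] eps K(1,2) mK \<theta>(1,2) R]) (rule cost[OF _ _ K(1,2)])
        then show ?thesis
          unfolding K(3) p_def c1_def c2_def R_def tail_sqrt[OF less_imp_le[OF a1p]] .
      qed
      then have "integral\<^sup>L (\<mu> \<epsilon>) f \<le> p"
        using c tau
        by (intro time_average_limit_upper[OF M Y_measurable[OF eps] L[OF eps] _ _ Ds, of "real (Suc m) * \<tau>"] fc f01 f0)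
           (auto simp: p_def)
      moreover have "measure (\<mu> \<epsilon>) C \<le> integral\<^sup>L (\<mu> \<epsilon>) f"
      proof -
        have Cm: "C \<in> sets (\<mu> \<epsilon>)" using Cs mu_sets[OF eps] by simp
        have "measure (\<mu> \<epsilon>) C = integral\<^sup>L (\<mu> \<epsilon>) (indicator C)"
          using Cm sets.sets_into_space[OF Cm] by (simp add: Int_absorb2)
        also have "\<dots> \<le> integral\<^sup>L (\<mu> \<epsilon>) f"
        proof (rule integral_mono)
          show "integrable (\<mu> \<epsilon>) f" by (rule integrable_bounded_Hn[OF N.prob_space_axioms mu_sets[OF eps] fc f01])
          show "integrable (\<mu> \<epsilon>) (indicator C :: L2 \<Rightarrow> real)" using Cm by (simp add: N.emeasure_eq_measure)
          fix v show "indicator C v \<le> f v" using f1[of v] f01[of v] by (auto simp: indicator_def)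
        qed
        finally show ?thesis .
      qed
      moreover have "p \<le> exp (- a / \<epsilon>\<^sup>2)"
      proof -
        define y where "y = 1 / \<epsilon>\<^sup>2"
        have y: "0 < y" "X \<le> y" using eps x by (simp_all add: y_def)
        have "\<theta> * a1 * y \<le> a1 * y" using \<theta> a1p y by (intro mult_right_mono) (auto simp: mult_left_le_one_le)
        then have "c2 * exp (- a1 * y) \<le> c2 * exp (- \<theta> * a1 * y)" using c by (intro mult_left_mono) auto
        then have "p \<le> (c1 + c2) * exp (- \<theta> * a1 * y)" by (simp add: p_def y_def algebra_simps)
        also have "c1 + c2 = exp (ln (c1 + c2))" using c by simp
        also have "exp (ln (c1 + c2)) * exp (- \<theta> * a1 * y) = exp (ln (c1 + c2) - \<theta> * a1 * y)"
          by (simp add: exp_add[symmetric])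
        also have "ln (c1 + c2) \<le> (\<theta> * a1 - a) * y"
          using y(2) \<theta>(3) by (simp add: X_def field_simps)
        then have "exp (ln (c1 + c2) - \<theta> * a1 * y) \<le> exp (- a * y)" by (simp add: algebra_simps)
        finally show ?thesis by (simp add: y_def)
      qed
      ultimately show ?case by linarith
    qed
  qed
qed

text \<open>Joint continuity in the final step length and the noise, argued along sequences. The
  window lies below \<open>s0\<close> so that it stays within one step, and it has positive length,
  as needed for the time average.\<close>

lemma endpt_near:
  assumes s0: "0 < s0" and \<delta>: "0 < \<delta>"
  obtains r s1 where "0 < r" "0 < s1" "s1 < s0"
    "\<And>s z. s1 < s \<Longrightarrow> s \<le> s0 \<Longrightarrow> (\<And>k i. k \<le> m \<Longrightarrow> i \<in> {1..n} \<Longrightarrow> \<bar>z k i - z0 k i\<bar> \<le> r) \<Longrightarrow>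
       norm (endpt 0 m s z - endpt 0 m s0 z0) \<le> \<delta>"
proof -
  define r where "r j = 1 / real (Suc j)" for j
  define s1 where "s1 j = s0 * (1 - 1 / real (Suc (Suc j)))" for j
  have r: "0 < r j" for j by (simp add: r_def)
  have s1: "0 < s1 j" "s1 j < s0" for j using s0 by (simp_all add: s1_def field_simps add_pos_nonneg)
  have rl: "r \<longlonglongrightarrow> 0" unfolding r_def using LIMSEQ_inverse_real_of_nat by (simp add: inverse_eq_divide)
  have "(\<lambda>j. s0 * (1 - r (Suc j))) \<longlonglongrightarrow> s0 * (1 - 0)" by (intro tendsto_intros LIMSEQ_Suc rl)
  then have s1l: "s1 \<longlonglongrightarrow> s0" by (simp add: s1_def[abs_def] r_def)
  have "\<exists>j. \<forall>s z. s1 j < s \<longrightarrow> s \<le> s0 \<longrightarrow> (\<forall>k i. k \<le> m \<longrightarrow> i \<in> {1..n} \<longrightarrow> \<bar>z k i - z0 k i\<bar> \<le> r j) \<longrightarrow>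
       norm (endpt 0 m s z - endpt 0 m s0 z0) \<le> \<delta>"
  proof (rule ccontr)
    assume "\<not> ?thesis"
    then have "\<forall>j. \<exists>s z. s1 j < s \<and> s \<le> s0 \<and> (\<forall>k i. k \<le> m \<longrightarrow> i \<in> {1..n} \<longrightarrow> \<bar>z k i - z0 k i\<bar> \<le> r j) \<and>
       \<delta> < norm (endpt 0 m s z - endpt 0 m s0 z0)"
      by (simp add: not_le)
    then obtain s z where sz: "\<And>j. s1 j < s j" "\<And>j. s j \<le> s0"
      "\<And>j k i. k \<le> m \<Longrightarrow> i \<in> {1..n} \<Longrightarrow> \<bar>z j k i - z0 k i\<bar> \<le> r j"
      "\<And>j. \<delta> < norm (endpt 0 m (s j) (z j) - endpt 0 m s0 z0)"
      by metis
    have sl: "s \<longlonglongrightarrow> s0"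
      by (rule tendsto_sandwich[OF _ _ s1l tendsto_const]) (intro always_eventually allI less_imp_le sz(1) sz(2))+
    have zl: "(\<lambda>j. z j k i) \<longlonglongrightarrow> z0 k i" if "k \<le> m" "i \<in> {1..n}" for k i
    proof (rule LIM_zero_cancel, rule Lim_null_comparison[OF _ rl])
      show "\<forall>\<^sub>F j in sequentially. norm (z j k i - z0 k i) \<le> r j" using sz(3)[OF that] by simp
    qed
    have "(\<lambda>j. endpt 0 m (s j) (z j)) \<longlonglongrightarrow> endpt 0 m s0 z0" by (rule tendsto_endpt[OF zl sl])
    then have "(\<lambda>j. norm (endpt 0 m (s j) (z j) - endpt 0 m s0 z0)) \<longlonglongrightarrow> norm (endpt 0 m s0 z0 - endpt 0 m s0 z0)"
      by (intro tendsto_intros)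
    then have "\<delta> \<le> norm (endpt 0 m s0 z0 - endpt 0 m s0 z0)"
      by (rule tendsto_lowerbound) (use sz(4) in \<open>auto intro!: always_eventually less_imp_le\<close>)
    then show False using \<delta> by simp
  qed
  then obtain j where "\<And>s z. s1 j < s \<Longrightarrow> s \<le> s0 \<Longrightarrow> (\<And>k i. k \<le> m \<Longrightarrow> i \<in> {1..n} \<Longrightarrow> \<bar>z k i - z0 k i\<bar> \<le> r j) \<Longrightarrow>
       norm (endpt 0 m s z - endpt 0 m s0 z0) \<le> \<delta>" by blast
  then show ?thesis using that[of "r j" "s1 j"] r s1 by blast
qed

lemma cost_slack:
  assumes "cost m z0 < a" "0 < r0"
  obtains r where "0 < r" "r < r0" "(\<Sum>k\<le>m. \<Sum>i=1..n. (\<bar>z0 k i\<bar> + r)\<^sup>2) / 2 < a"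
proof -
  have "((\<lambda>r. (\<Sum>k\<le>m. \<Sum>i=1..n. (\<bar>z0 k i\<bar> + r)\<^sup>2) / 2) \<longlongrightarrow> (\<Sum>k\<le>m. \<Sum>i=1..n. (\<bar>z0 k i\<bar> + 0)\<^sup>2) / 2) (at_right 0)"
    by (intro tendsto_intros) auto
  moreover have "(\<Sum>k\<le>m. \<Sum>i=1..n. (\<bar>z0 k i\<bar> + 0)\<^sup>2) / 2 < a"
    using assms(1) by (simp add: cost_def sqsum_def)
  ultimately have "\<forall>\<^sub>F r in at_right 0. (\<Sum>k\<le>m. \<Sum>i=1..n. (\<bar>z0 k i\<bar> + r)\<^sup>2) / 2 < a"
    by (rule order_tendstoD(2))
  moreover have "\<forall>\<^sub>F r in at_right 0. r \<in> {0<..<r0}" by (rule eventually_at_right_real[OF assms(2)])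
  ultimately have "\<forall>\<^sub>F r in at_right 0. 0 < r \<and> r < r0 \<and> (\<Sum>k\<le>m. \<Sum>i=1..n. (\<bar>z0 k i\<bar> + r)\<^sup>2) / 2 < a"
    by eventually_elim auto
  from eventually_happens'[OF trivial_limit_at_right_real this] show ?thesis using that by blast
qed

text \<open>A nearly optimal noise sequence is padded until the restart error is at most half of
  \<delta>; a box of noise and a window of phases around it keep the end point within the other
  half.\<close>

lemma mu_lower:
  assumes a: "qpot u < ereal a" and \<delta>: "0 < \<delta>"
  shows "\<forall>\<^sub>F \<epsilon> in at_right 0. exp (- a / \<epsilon>\<^sup>2) \<le> measure (\<mu> \<epsilon>) ({v. norm (v - u) \<le> 2 * \<delta>} \<inter> Hn n)"
proof -
  obtain m' s0 z' where 0: "0 < s0" "s0 \<le> \<tau>" "endpt 0 m' s0 z' = u" "cost m' z' < a"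
    by (rule qpot_lessE[OF a])
  have a0: "0 \<le> a + 1" using 0(4) cost_nonneg[of m' z'] by linarith
  \<comment> \<open>The tail event gets the rate \<open>a + 1\<close>, so it is negligible against
    the box probability.\<close>
  define R where "R = sqrt (4 * (noise_bd + 1) * (a + 1))"
  have R: "0 \<le> R" using noise_bd_nonneg a0 by (simp add: R_def)
  obtain m'' where m'': "\<And>k. m'' \<le> k \<Longrightarrow> \<rho> ^ k * R \<le> \<delta> / 2"
    by (rule power_small[OF R, of "\<delta> / 2"]) (use \<delta> in auto)
  define m where "m = max m' m''"
  obtain z0 where "endpt 0 m s0 z0 = endpt 0 m' s0 z'" "cost m z0 = cost m' z'"
    by (rule pad_exists[of m' m s0 z']) (auto simp: m_def)
  with 0 have z0: "endpt 0 m s0 z0 = u" "cost m z0 < a" by auto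
  have rm: "\<rho> ^ m * R \<le> \<delta> / 2" by (rule m'') (simp add: m_def)
  obtain r0 s1 where r0: "0 < r0" "0 < s1" "s1 < s0"
    "\<And>s z. s1 < s \<Longrightarrow> s \<le> s0 \<Longrightarrow> (\<And>k i. k \<le> m \<Longrightarrow> i \<in> {1..n} \<Longrightarrow> \<bar>z k i - z0 k i\<bar> \<le> r0) \<Longrightarrow>
       norm (endpt 0 m s z - endpt 0 m s0 z0) \<le> \<delta> / 2"
    using endpt_near[OF 0(1), of "\<delta> / 2" m z0] \<delta> by (metis half_gt_zero)
  obtain r where r: "0 < r" "r < r0" "(\<Sum>k\<le>m. \<Sum>i=1..n. (\<bar>z0 k i\<bar> + r)\<^sup>2) / 2 < a"
    by (rule cost_slack[OF z0(2) r0(1)])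
  define c where "c = (\<Sum>k\<le>m. \<Sum>i=1..n. (\<bar>z0 k i\<bar> + r)\<^sup>2) / 2"
  have ca: "0 < a - c" using r(3) by (simp add: c_def)
  define \<kappa> where "\<kappa> = (s0 - s1) / \<tau>"
  have \<kappa>: "0 < \<kappa>" using r0 tau by (simp add: \<kappa>_def)
  define c2 where "c2 = exp (real n / (2 * (1 - \<rho>)))"
  define D where "D = {v. norm (v - u) \<le> \<delta>} \<inter> Hn n"
  have Ds: "D \<in> sets (restrict_space borel (Hn n))"
    unfolding D_def by (intro closed_Int_Hn_sets closed_Collect_le continuous_intros)
  define E where "E = {v. norm (v - u) \<le> 2 * \<delta>} \<inter> Hn n"
  have Es: "E \<in> sets (restrict_space borel (Hn n))"
    unfolding E_def by (intro closed_Int_Hn_sets closed_Collect_le continuous_intros)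
  \<comment> \<open>The radii \<delta> and \<open>2 * \<delta>\<close> leave room for a continuous
    function that is 1 on \<open>D\<close> and 0 outside \<open>E\<close>.\<close>
  define f where "f v = max 0 (min 1 (2 - norm (v - u) / \<delta>))" for v
  have fc: "continuous_on (Hn n) f" unfolding f_def by (intro continuous_intros) (use \<delta> in auto)
  have f01: "0 \<le> f v \<and> f v \<le> 1" for v by (simp add: f_def)
  have f1: "f v = 1" if "v \<in> D" for v using that \<delta> by (auto simp: f_def D_def field_simps min_def max_def)
  have f0: "f v = 0" if "v \<in> Hn n" "v \<notin> E" for v
    using that \<delta> by (auto simp: f_def E_def field_simps min_def max_def)
  \<comment> \<open>Three requirements: the tail is dominated, the slack \<open>a - c\<close> pays
    for the time fraction \<kappa>, and \<epsilon> meets the smallness condition of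
    \<open>prob_lower_bound\<close>.\<close>
  define X where "X = max c2 (max ((1 + 1 / \<kappa>) / (a - c)) (pi / (2 * r\<^sup>2)))"
  show ?thesis
    using eventually_inverse_square_ge[of X]
  proof eventually_elim
    case (elim \<epsilon>)
    then have eps: "0 < \<epsilon>" and x: "X \<le> 1 / \<epsilon>\<^sup>2" by auto
    interpret N: prob_space "\<mu> \<epsilon>" by (rule mu_prob[OF eps])
    define y where "y = 1 / \<epsilon>\<^sup>2"
    have y: "0 < y" "c2 \<le> y" "(1 + 1 / \<kappa>) / (a - c) \<le> y" "pi / (2 * r\<^sup>2) \<le> 1 / \<epsilon>\<^sup>2"
      using eps x by (simp_all add: y_def X_def)
    have er: "\<epsilon> \<le> 2 * r / sqrt (2 * pi)"
    proof (rule power2_le_imp_le)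
      have "\<epsilon>\<^sup>2 * pi \<le> 2 * r\<^sup>2" using y(4) eps r(1) by (simp add: field_simps)
      then show "\<epsilon>\<^sup>2 \<le> (2 * r / sqrt (2 * pi))\<^sup>2" by (simp add: power_divide power_mult_distrib field_simps)
    qed (use r in auto)
    define p where "p = exp (- c / \<epsilon>\<^sup>2) - tail R \<epsilon>"
    have key: "1 / \<kappa> * exp (- a * y) \<le> p"
    proof -
      have "1 + 1 / \<kappa> \<le> (a - c) * y" using y(3) ca by (simp add: pos_divide_le_eq mult.commute)
      also have "\<dots> \<le> exp ((a - c) * y)" using exp_ge_add_one_self[of "(a - c) * y"] by linarith
      finally have 1: "1 + 1 / \<kappa> \<le> exp ((a - c) * y)" .
      have "c2 \<le> exp y" using y(2) exp_ge_add_one_self[of y] by linarith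
      then have 2: "c2 * exp (- y) \<le> 1" by (simp add: exp_minus field_simps)
      have "1 / \<kappa> \<le> exp ((a - c) * y) - c2 * exp (- y)" using 1 2 by linarith
      then have "1 / \<kappa> * exp (- a * y) \<le> (exp ((a - c) * y) - c2 * exp (- y)) * exp (- a * y)"
        by (intro mult_right_mono) auto
      also have "\<dots> = exp (- c * y) - c2 * exp (- (a + 1) * y)"
      proof -
        have "exp ((a - c) * y) * exp (- a * y) = exp (- c * y)" "exp (- y) * exp (- a * y) = exp (- (a + 1) * y)"
          by (simp_all add: exp_add[symmetric] algebra_simps)
        then show ?thesis by (simp only: left_diff_distrib mult.assoc)
      qed
      also have "\<dots> = p"
        unfolding p_def R_def tail_sqrt[OF a0] by (simp add: c2_def y_def)
      finally show ?thesis .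
    qed
    have "0 \<le> 1 / \<kappa> * exp (- a * y)" using \<kappa> by simp
    with key have p0: "0 \<le> p" by linarith
    have "p \<le> measure M {\<omega> \<in> space M. Y \<epsilon> (real K * \<tau> + s) \<omega> \<in> D}" if K: "m \<le> K" and s: "s1 < s" "s \<le> s0" for K s
    proof -
      have s': "0 < s" "s \<le> \<tau>" using s r0 0 by auto
      have near: "norm (endpt 0 m s z - u) + \<rho> ^ m * R \<le> \<delta>"
        if "\<And>k i. k \<le> m \<Longrightarrow> i \<in> {1..n} \<Longrightarrow> \<bar>z k i - z0 k i\<bar> \<le> r" for z
      proof -
        have "\<bar>z k i - z0 k i\<bar> \<le> r0" if "k \<le> m" "i \<in> {1..n}" for k i
          using \<open>\<And>k i. k \<le> m \<Longrightarrow> i \<in> {1..n} \<Longrightarrow> \<bar>z k i - z0 k i\<bar> \<le> r\<close>[OF that] r(2) by linarith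
        from r0(4)[OF s this] show ?thesis using rm z0(1) by simp
      qed
      have "{\<omega> \<in> space M. Y \<epsilon> (real K * \<tau> + s) \<omega> \<in> D} = {\<omega> \<in> space M. norm (Y \<epsilon> (real K * \<tau> + s) \<omega> - u) \<le> \<delta>}"
        using measurable_space[OF Y_measurable[OF eps, of "real K * \<tau> + s"]] s' tau
        by (auto simp: D_def space_restrict_space)
      then show ?thesis
        using prob_lower_bound[OF M W S[OF eps] eps s' K R r(1) er near] unfolding p_def c_def by simp
    qed
    then have "p * \<kappa> \<le> integral\<^sup>L (\<mu> \<epsilon>) f"
      unfolding \<kappa>_def using r0 0
      by (intro time_average_limit_lower[OF M Y_measurable[OF eps] L[OF eps] _ _ _ p0 Ds _ fc f01 f1, where m = m]) auto
    also have "\<dots> \<le> measure (\<mu> \<epsilon>) E"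
    proof -
      have Em: "E \<in> sets (\<mu> \<epsilon>)" using Es mu_sets[OF eps] by simp
      have "integral\<^sup>L (\<mu> \<epsilon>) f \<le> integral\<^sup>L (\<mu> \<epsilon>) (indicator E)"
      proof (rule integral_mono)
        show "integrable (\<mu> \<epsilon>) f" by (rule integrable_bounded_Hn[OF N.prob_space_axioms mu_sets[OF eps] fc f01])
        show "integrable (\<mu> \<epsilon>) (indicator E :: L2 \<Rightarrow> real)" using Em by (simp add: N.emeasure_eq_measure)
        fix v assume "v \<in> space (\<mu> \<epsilon>)"
        then show "f v \<le> indicator E v" using f0[of v] f01[of v] mu_space[OF eps] by (auto simp: indicator_def)
      qed
      also have "\<dots> = measure (\<mu> \<epsilon>) E" using Em sets.sets_into_space[OF Em] by (simp add: Int_absorb2)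
      finally show ?thesis .
    qed
    finally have "p * \<kappa> \<le> measure (\<mu> \<epsilon>) E" .
    moreover have "exp (- a / \<epsilon>\<^sup>2) \<le> p * \<kappa>" using key \<kappa> by (simp add: y_def field_simps)
    ultimately show ?case unfolding E_def by linarith
  qed
qed

text \<open>Compact sublevel sets are closed, so the sets where \<open>qpot\<close> exceeds a
  nonnegative level are open; negative levels are exceeded everywhere.\<close>

lemma qpot_rate_function: "rate_function_on (Hn n) qpot"
  unfolding rate_function_on_def
proof (intro conjI ballI)
  fix x show "qpot x \<le> Liminf (at x within Hn n) qpot"
    unfolding le_Liminf_iff
  proof (intro allI impI)
    fix y assume "y < qpot x"
    then obtain b where b: "y < ereal b" "ereal b < qpot x" using ereal_dense2 by blast
    show "\<forall>\<^sub>F v in at x within Hn n. y < qpot v"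
    proof (cases "0 \<le> b")
      case True
      have "open (- {u. qpot u \<le> ereal b})"
        using compact_imp_closed[OF compact_sublevel[OF True]] by (simp add: open_closed)
      moreover have "x \<in> - {u. qpot u \<le> ereal b}" using b by simp
      ultimately have "\<forall>\<^sub>F v in at x within Hn n. v \<in> - {u. qpot u \<le> ereal b}"
        by (rule eventually_at_topological[THEN iffD2, OF exI, OF conjI, OF _ conjI]) auto
      then show ?thesis by eventually_elim (use b in auto)
    next
      case False
      then have "y < 0" using b(1) by (metis ereal_less_eq(5) less_le_trans linear)
      then show ?thesis
        by (intro always_eventually allI less_le_trans[OF _ qpot_nonneg])
    qed
  qed
qed (rule qpot_nonneg)

lemma qpot_good_rate_function: "good_rate_function_on (Hn n) qpot"
  unfolding good_rate_function_on_def
proof (intro conjI allI impI qpot_rate_function)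
  fix \<alpha> :: real assume "0 \<le> \<alpha>"
  then have "compact ({u. qpot u \<le> ereal \<alpha>} \<inter> Hn n)"
    by (intro compact_Int_closed compact_sublevel closed_Hn)
  moreover have "{x \<in> Hn n. qpot x \<le> ereal \<alpha>} = {u. qpot u \<le> ereal \<alpha>} \<inter> Hn n" by auto
  ultimately show "compact {x \<in> Hn n. qpot x \<le> ereal \<alpha>}" by simp
qed

lemma LDP: "LDP_on (Hn n) \<mu> qpot"
  unfolding LDP_on_def
proof (intro conjI allI impI ballI qpot_rate_function mu_borel_prob)
  fix U assume U: "U \<in> sets (restrict_space borel (Hn n))"
  have UH: "U \<subseteq> Hn n" using sets.sets_into_space[OF U] by (simp add: space_restrict_space)
  let ?g = "\<lambda>\<epsilon>. ereal (\<epsilon>\<^sup>2) * elog (measure (\<mu> \<epsilon>) U)"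
  let ?l = "Liminf (at_right 0) ?g"
  have "- ?l \<le> (INF x\<in>top_of_set (Hn n) interior_of U. qpot x)"
  proof (rule INF_greatest)
    fix u assume "u \<in> top_of_set (Hn n) interior_of U"
    then obtain G where G: "openin (top_of_set (Hn n)) G" "u \<in> G" "G \<subseteq> U"
      unfolding interior_of_def by blast
    then obtain T where "open T" "G = Hn n \<inter> T" unfolding openin_open by blast
    with G have T: "open T" "u \<in> T" "T \<inter> Hn n \<subseteq> U" by auto
    obtain e where e: "0 < e" "ball u e \<subseteq> T" using T(1,2) open_contains_ball by blast
    \<comment> \<open>\<open>mu_lower\<close> concerns a closed ball of radius
      \<open>2 * \<delta>\<close>; with \<open>\<delta> = e / 3\<close> it fits into the open ball
      of radius \<open>e\<close>.\<close>
    have sub: "{v. norm (v - u) \<le> 2 * (e / 3)} \<inter> Hn n \<subseteq> U"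
    proof
      fix v assume v: "v \<in> {v. norm (v - u) \<le> 2 * (e / 3)} \<inter> Hn n"
      then have "norm (v - u) \<le> 2 * (e / 3)" by simp
      with e(1) have "norm (v - u) < e" by linarith
      then have "v \<in> ball u e" by (subst mem_ball, subst dist_commute, subst dist_norm)
      then have "v \<in> T" using e(2) by (rule subsetD[rotated])
      then show "v \<in> U" using v T(3) by blast
    qed
    show "- ?l \<le> qpot u"
    proof (rule ccontr)
      assume "\<not> - ?l \<le> qpot u"
      then have "qpot u < - ?l" by simp
      then obtain a where a: "qpot u < ereal a" "ereal a < - ?l" using ereal_dense2 by blast
      have e3: "0 < e / 3" using e(1) by simp
      have "\<forall>\<^sub>F \<epsilon> in at_right 0. - ereal a \<le> ?g \<epsilon>"
        using mu_lower[OF a(1) e3] eventually_inverse_square_ge[of 0]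
      proof eventually_elim
        case (elim \<epsilon>)
        then have eps: "0 < \<epsilon>" by simp
        interpret N: prob_space "\<mu> \<epsilon>" by (rule mu_prob[OF eps])
        have "exp (- a / \<epsilon>\<^sup>2) \<le> measure (\<mu> \<epsilon>) U"
          by (rule order_trans[OF elim(1) N.finite_measure_mono[OF sub]]) (simp only: U mu_sets[OF eps])
        then have "0 < measure (\<mu> \<epsilon>) U" "- a / \<epsilon>\<^sup>2 \<le> ln (measure (\<mu> \<epsilon>) U)"
          by (auto intro: less_le_trans[OF exp_gt_zero] simp: ln_ge_iff[OF less_le_trans[OF exp_gt_zero]])
        then show ?case using eps by (simp add: elog_def field_simps)
      qed
      from Liminf_bounded[OF this] have "- ereal a \<le> ?l" .
      then have "- ?l \<le> ereal a" by (rule ereal_uminus_le_reorder[THEN iffD1])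
      then show False using a(2) by simp
    qed
  qed
  then show "- (INF x\<in>top_of_set (Hn n) interior_of U. qpot x) \<le> ?l"
    by (rule ereal_uminus_le_reorder[THEN iffD1])
  show "?l \<le> Limsup (at_right 0) ?g"
    by (rule Liminf_le_Limsup) (rule trivial_limit_at_right_real)
  show "Limsup (at_right 0) ?g \<le> - (INF x\<in>top_of_set (Hn n) closure_of U. qpot x)" (is "?s \<le> - ?i")
  proof (rule ccontr)
    let ?C = "top_of_set (Hn n) closure_of U"
    assume "\<not> ?s \<le> - ?i"
    then have "- ?i < ?s" by simp
    then have "- ?s < ?i" by (rule ereal_uminus_less_reorder[THEN iffD1])
    then obtain a where a: "- ?s < ereal a" "ereal a < ?i" using ereal_dense2 by blast
    \<comment> \<open>The closure is relative to \<open>Hn n\<close>; since that subspace is closed,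
      it is also closed in the whole space, as \<open>mu_upper\<close> demands.\<close>
    have "closedin (top_of_set (Hn n)) ?C" by (rule closedin_closure_of)
    then have C: "closed ?C" "?C \<subseteq> Hn n"
      using closed_Hn closedin_closed_trans closedin_imp_subset by blast+
    have Cs: "?C \<in> sets (restrict_space borel (Hn n))"
      using closed_Int_Hn_sets[OF C(1)] C(2) by (simp add: Int_absorb2)
    have UC: "U \<subseteq> ?C" using UH by (intro closure_of_subset) simp
    have "\<forall>\<^sub>F \<epsilon> in at_right 0. ?g \<epsilon> \<le> - ereal a"
      using mu_upper[OF C a(2)] eventually_inverse_square_ge[of 0]
    proof eventually_elim
      case (elim \<epsilon>)
      then have eps: "0 < \<epsilon>" by simp
      interpret N: prob_space "\<mu> \<epsilon>" by (rule mu_prob[OF eps])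
      have le: "measure (\<mu> \<epsilon>) U \<le> exp (- a / \<epsilon>\<^sup>2)"
        by (rule order_trans[OF N.finite_measure_mono[OF UC] elim(1)]) (simp only: Cs mu_sets[OF eps])
      show ?case
      proof (cases "measure (\<mu> \<epsilon>) U = 0")
        case True then show ?thesis using eps by (simp add: elog_def)
      next
        case False
        then have "0 < measure (\<mu> \<epsilon>) U" by (simp add: zero_less_measure_iff)
        then have "ln (measure (\<mu> \<epsilon>) U) \<le> - a / \<epsilon>\<^sup>2" using le ln_mono by fastforce
        then show ?thesis using False eps by (simp add: elog_def field_simps)
      qed
    qed
    from Limsup_bounded[OF this] have "?s \<le> - ereal a" .
    then have "- (- ?s) \<le> - ereal a" by (simp only: ereal_uminus_uminus)
    then have "ereal a \<le> - ?s" by (simp only: ereal_minus_le_minus)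
    then show False using a(1) by simp
  qed
qed

end

theorem theorem4p5:
  fixes M :: "'w measure" and \<beta> :: "nat \<Rightarrow> real \<Rightarrow> 'w \<Rightarrow> real"
    and Q Qh F :: "L2 \<Rightarrow> L2" and F' :: "L2 \<Rightarrow> L2 \<Rightarrow> L2"
    and q :: "nat \<Rightarrow> real" and L\<^sub>F L \<tau> \<tau>\<^sub>0 :: real and n :: nat
    and Y :: "real \<Rightarrow> real \<Rightarrow> 'w \<Rightarrow> L2" and \<mu> :: "real \<Rightarrow> L2 measure"
  assumes "prob_space M" and "cylindrical_wiener M \<beta>"
    and "bounded_linear Q" and "self_adjoint Q" and "positive_definite Q"
    and "\<And>i. i \<ge> 1 \<Longrightarrow> q i > 0 \<and> Q (eb i) = q i *\<^sub>R eb i"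
    and "is_pos_sqrt Qh Q"
    and "dom_A \<subseteq> range Qh"
    and "range Qh \<subseteq> dom_neg_A_pow (1/2)" and "hilbert_schmidt (neg_A_pow (1/2) \<circ> Qh)"
    and "bounded_linear (inv Qh \<circ> neg_A_inv)"
    and "\<And>u. (F has_derivative F' u) (at u)"
    and "L\<^sub>F > 0" and "L > 0"
    and "\<And>u v. norm (F u - F v) \<le> L\<^sub>F * norm (u - v)"
    and "\<And>u. u \<in> Hdot 1 \<Longrightarrow> F u \<in> Hdot 1 \<and> Hdot_norm 1 (F u) \<le> L * (1 + Hdot_norm 1 u)"
    and "\<And>u v. u \<in> Hdot 2 \<Longrightarrow> v \<in> Hdot 2 \<Longrightarrow>
           F' u v \<in> Hdot 2 \<and> Hdot_norm 2 (F' u v) \<le> L * (1 + (Hdot_norm 2 u)\<^sup>2) * Hdot_norm 2 v"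
    and "F 0 = 0" and "L\<^sub>F < lam 1"
    and "n \<ge> 1"
    and "\<tau>\<^sub>0 > 0" and "(exp (lam 1 * \<tau>\<^sub>0) - 1) / (lam 1 * \<tau>\<^sub>0) = (lam 1 + L\<^sub>F) / (2 * L\<^sub>F)"
    and "0 < \<tau>" and "\<tau> \<le> \<tau>\<^sub>0"
    and "\<And>\<epsilon>. \<epsilon> > 0 \<Longrightarrow> AEE_solution M \<beta> F Qh n \<tau> \<epsilon> 0 (Y \<epsilon>)"
    and "\<And>\<epsilon>. \<epsilon> > 0 \<Longrightarrow> time_average_limit M n (Y \<epsilon>) (\<mu> \<epsilon>)"
  shows "good_rate_function_on (Hn n) (quasi_potential F Qh n \<tau>) \<and>
         LDP_on (Hn n) \<mu> (quasi_potential F Qh n \<tau>)"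
proof -
  have Qh: "bounded_linear Qh" "self_adjoint Qh"
    using \<open>is_pos_sqrt Qh Q\<close> by (auto simp: is_pos_sqrt_def)
  have eb: "Qh (eb i) = sqrt (q i) *\<^sub>R eb i" if "i \<ge> 1" for i
    by (rule pos_sqrt_eigenvector[OF \<open>is_pos_sqrt Qh Q\<close> conjunct2[OF assms(6)[OF that]] conjunct1[OF assms(6)[OF that]]])
  interpret aee_ldp q F L\<^sub>F \<tau> n Qh M \<beta> Y \<mu>
  proof (intro aee_ldp.intro aee_noise.intro aee.intro aee_noise_axioms.intro aee_ldp_axioms.intro)
    show "0 < q i" if "1 \<le> i" for i by (rule conjunct1[OF assms(6)[OF that]])
  qed (fact assms Qh eb)+
  have "quasi_potential F Qh n \<tau> = qpot"
    by (rule ext) (rule quasi_potential_eq_qpot)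
  then show ?thesis
    using qpot_good_rate_function LDP by simp
qed

end
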